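(* Let $M_2\subset M_1$ be separable metric spaces, and $\lambda\ge1$. Then the pair $(\mathscr{F}(M_1),\mathscr{F}(M_2))$ has the $\lambda$-BAP if and only if the following holds: for every pair $(X_1,X_2)$ of a Banach space and a closed subspace, and any $f\in\mathrm{Lip}^1(M_1,M_2;X_1^{**},X_2^{**})$, there is a net in $\mathrm{Lip}^\lambda(M_1,M_2;X_1,X_2)$ which converges to $f$ in the pointwise-weak$^*$ topology.
   Context: Banach spaces are real. Metric spaces are pointed with distinguished point $0$, and $M_2\subset M_1$ share the distinguished point. For a pointed metric space $M$, $\mathrm{Lip}_0(M)$ is the Banach space of Lipschitz functions $f:M\to\mathbb{R}$ with $f(0)=0$, normed by the Lipschitz constant; the Lipschitz-free space $\mathscr{F}(M)$ is the closed linear span in $\mathrm{Lip}_0(M)^*$ of the evaluation functionals $\delta(x):f\mapsto f(x)$, $x\in M$. $\mathscr{F}(M_2)$ is identified with the closed span of $\{\delta(x):x\in M_2\}$ in $\mathscr{F}(M_1)$. For a Banach space $Z$ and a closed subspace $W$, the pair $(Z,W)$ has the $\lambda$-BAP if for each $\varepsilon>0$ and compact $A\subset Z$ there is a finite-rank linear map $S:Z\to Z$ with $\|S\|\le\lambda$, $\|S(z)-z\|\le\varepsilon$ for each $z\in A$, and $S(W)\subseteq W$. For complete metric spaces $X_2\subset X_1$, $\mathrm{Lip}^\lambda(M_1,M_2;X_1,X_2)$ is the set of all $\lambda$-Lipschitz maps $f:M_1\to X_1$ with $f(M_2)\subset X_2$. $X_2^{**}$ is canonically identified with $X_2^{\perp\perp}\subseteq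 X_1^{**}$, and $X_1$ is canonically embedded in $X_1^{**}$. A net $(f_\alpha)$ converges to $f$ in the pointwise-weak$^*$ topology if $f_\alpha(x)\to f(x)$ in the weak$^*$ topology of $X_1^{**}$ for every $x\in M_1$. *)

theory Defs
  imports "HOL-Analysis.Analysis" "HOL-Library.Function_Algebras"
begin

text \<open>
  Real-valued functions on a set form a real vector space under pointwise operations. Function
  spaces, dual spaces and biduals below are linear subspaces of such function types.
\<close>

instantiation "fun" :: (type, scaleR) scaleR
begin

definition scaleR_fun_def: "r *\<^sub>R f = (\<lambda>x. r *\<^sub>R f x)"

instance ..

end

lemma scaleR_fun_apply [simp]: "(r *\<^sub>R f) x = r *\<^sub>R f x"
  by (simp add: scaleR_fun_def)

instance "fun" :: (type, real_vector) real_vector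
  by standard (simp_all add: fun_eq_iff scaleR_add_right scaleR_add_left)


section \<open>Normed spaces as objects\<close>

text \<open>
  A statement quantifying over all Banach spaces inside a formula cannot use type classes for them.
  A normed space is therefore a linear subspace \<open>carr X\<close> of an ambient real vector space
  \<open>'v\<close>, together with a norm on it. The ambient space has no norm of its own, and the values
  of \<open>nrm X\<close> outside \<open>carr X\<close> are irrelevant.
\<close>

record 'v nspace =
  carr :: "'v set"
  nrm :: "'v \<Rightarrow> real"

definition normed_space :: "'v::real_vector nspace \<Rightarrow> bool" where
  "normed_space X \<longleftrightarrow>
     subspace (carr X) \<and>
     (\<forall>x\<in>carr X. 0 \<le> nrm X x) \<and>
     (\<forall>x\<in>carr X. nrm X x = 0 \<longleftrightarrow> x = 0) \<and>
     (\<forall>c. \<forall>x\<in>carr X. nrm X (c *\<^sub>R x) = \<bar>c\<bar> * nrm X x) \<and>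
     (\<forall>x\<in>carr X. \<forall>y\<in>carr X. nrm X (x + y) \<le> nrm X x + nrm X y)"

text \<open>
  The value 0 outside the carrier is needed because \<^locale>\<open>Metric_space\<close> requires a nonnegative
  symmetric distance on the whole type.
\<close>

definition ndist :: "'v::real_vector nspace \<Rightarrow> 'v \<Rightarrow> 'v \<Rightarrow> real" where
  "ndist X x y = (if x \<in> carr X \<and> y \<in> carr X then nrm X (x - y) else 0)"

lemma normed_space_Metric_space:
  assumes "normed_space X"
  shows "Metric_space (carr X) (ndist X)"
proof -
  have X: "subspace (carr X)"
    and nonneg: "\<And>x. x \<in> carr X \<Longrightarrow> 0 \<le> nrm X x"
    and zero: "\<And>x. x \<in> carr X \<Longrightarrow> nrm X x = 0 \<longleftrightarrow> x = 0"
    and scale: "\<And>c x. x \<in> carr X \<Longrightarrow> nrm X (c *\<^sub>R x) = \<bar>c\<bar> * nrm X x"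
    and add: "\<And>x y. x \<in> carr X \<Longrightarrow> y \<in> carr X \<Longrightarrow> nrm X (x + y) \<le> nrm X x + nrm X y"
    using assms by (simp_all only: normed_space_def)
  have sub: "x - y \<in> carr X" if "x \<in> carr X" "y \<in> carr X" for x y
    using X that by (rule subspace_diff)
  have minus: "nrm X (x - y) = nrm X (y - x)" if "x \<in> carr X" "y \<in> carr X" for x y
    using scale[OF sub[OF that(2,1)], of "- 1"] by simp
  have tri: "nrm X (x - z) \<le> nrm X (x - y) + nrm X (y - z)"
    if "x \<in> carr X" "y \<in> carr X" "z \<in> carr X" for x y z
    using add[OF sub[OF that(1,2)] sub[OF that(2,3)]] by simp
  show ?thesis
  proof (rule Metric_space.intro)
    fix x y z
    show "0 \<le> ndist X x y"
      unfolding ndist_def by (auto intro!: nonneg sub)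
    show "ndist X x y = ndist X y x"
      unfolding ndist_def using minus[of x y] by presburger
    assume x: "x \<in> carr X" and y: "y \<in> carr X"
    show "ndist X x y = 0 \<longleftrightarrow> x = y"
      unfolding ndist_def using x y zero[OF sub[OF x y]] by simp
    assume z: "z \<in> carr X"
    show "ndist X x z \<le> ndist X x y + ndist X y z"
      unfolding ndist_def using x y z tri[OF x y z] by simp
  qed
qed

definition norm_topology :: "'v::real_vector nspace \<Rightarrow> 'v topology" where
  "norm_topology X = Metric_space.mtopology (carr X) (ndist X)"

definition banach_space :: "'v::real_vector nspace \<Rightarrow> bool" where
  "banach_space X \<longleftrightarrow> normed_space X \<and> Metric_space.mcomplete (carr X) (ndist X)"

definition closed_subspace :: "'v::real_vector nspace \<Rightarrow> 'v set \<Rightarrow> bool" where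
  "closed_subspace X W \<longleftrightarrow> subspace W \<and> closedin (norm_topology X) W"

definition closed_lin_span :: "'v::real_vector nspace \<Rightarrow> 'v set \<Rightarrow> 'v set" where
  "closed_lin_span X A = norm_topology X closure_of (span A)"

definition linear_map_on :: "'v::real_vector set \<Rightarrow> ('v \<Rightarrow> 'w::real_vector) \<Rightarrow> bool" where
  "linear_map_on V T \<longleftrightarrow>
     (\<forall>x\<in>V. \<forall>y\<in>V. T (x + y) = T x + T y) \<and> (\<forall>c. \<forall>x\<in>V. T (c *\<^sub>R x) = c *\<^sub>R T x)"


section \<open>Duals, annihilators, weak* topology\<close>

text \<open>
  A bounded functional on \<open>X\<close> is represented by the function which agrees with it on
  \<open>carr X\<close> and is 0 elsewhere, so that functionals are equal iff they agree on \<open>carr X\<close>.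
\<close>

definition dual_space :: "'v::real_vector nspace \<Rightarrow> ('v \<Rightarrow> real) nspace" where
  "dual_space X =
     \<lparr>carr = {\<phi>. linear_map_on (carr X) \<phi> \<and> (\<exists>K. \<forall>x\<in>carr X. \<bar>\<phi> x\<bar> \<le> K * nrm X x) \<and>
                 (\<forall>x. x \<notin> carr X \<longrightarrow> \<phi> x = 0)},
      nrm = (\<lambda>\<phi>. Sup {\<bar>\<phi> x\<bar> | x. x \<in> carr X \<and> nrm X x \<le> 1})\<rparr>"

abbreviation bidual :: "'v::real_vector nspace \<Rightarrow> (('v \<Rightarrow> real) \<Rightarrow> real) nspace" where
  "bidual X \<equiv> dual_space (dual_space X)"

definition canonical_embedding :: "'v::real_vector nspace \<Rightarrow> 'v \<Rightarrow> ('v \<Rightarrow> real) \<Rightarrow> real" where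
  "canonical_embedding X x = (\<lambda>\<phi>. if \<phi> \<in> carr (dual_space X) then \<phi> x else 0)"

definition annihilator :: "'v::real_vector nspace \<Rightarrow> 'v set \<Rightarrow> ('v \<Rightarrow> real) set" where
  "annihilator X W = {\<phi> \<in> carr (dual_space X). \<forall>w\<in>W. \<phi> w = 0}"

abbreviation biannihilator ::
  "'v::real_vector nspace \<Rightarrow> 'v set \<Rightarrow> (('v \<Rightarrow> real) \<Rightarrow> real) set" where
  "biannihilator X W \<equiv> annihilator (dual_space X) (annihilator X W)"

definition weak_star_topology :: "'v::real_vector nspace \<Rightarrow> ('v \<Rightarrow> real) topology" where
  \<comment> \<open>the weak* topology of the dual of \<open>X\<close>\<close>
  "weak_star_topology X =
     topology_generated_by
       {{\<phi> \<in> carr (dual_space X). \<phi> x \<in> U} | x U. x \<in> carr X \<and> open U}"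

definition pointwise_weak_star ::
  "'v::real_vector nspace \<Rightarrow> ('a \<Rightarrow> ('v \<Rightarrow> real) \<Rightarrow> real) topology" where
  \<comment> \<open>on maps from \<open>'a\<close> to the bidual of \<open>X\<close>\<close>
  "pointwise_weak_star X = product_topology (\<lambda>_. weak_star_topology (dual_space X)) UNIV"


section \<open>Lipschitz maps and Lipschitz-free spaces\<close>

text \<open>
  The metric space \<open>M\<^sub>1\<close> is the whole type \<open>'a\<close>, and \<open>p\<close> is its distinguished point.
\<close>

definition Lip0 :: "'a::metric_space \<Rightarrow> ('a \<Rightarrow> real) nspace" where
  "Lip0 p = \<lparr>carr = {f. f p = 0 \<and> (\<exists>L. L-lipschitz_on UNIV f)},
             nrm = (\<lambda>f. Inf {L. L-lipschitz_on UNIV f})\<rparr>"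

definition lip_delta :: "'a::metric_space \<Rightarrow> 'a \<Rightarrow> ('a \<Rightarrow> real) \<Rightarrow> real" where
  "lip_delta p x = (\<lambda>f. if f \<in> carr (Lip0 p) then f x else 0)"

definition lipschitz_free :: "'a::metric_space \<Rightarrow> (('a \<Rightarrow> real) \<Rightarrow> real) nspace" where
  "lipschitz_free p =
     \<lparr>carr = closed_lin_span (dual_space (Lip0 p)) (range (lip_delta p)),
      nrm = nrm (dual_space (Lip0 p))\<rparr>"

definition lipschitz_free_sub ::
  "'a::metric_space \<Rightarrow> 'a set \<Rightarrow> (('a \<Rightarrow> real) \<Rightarrow> real) set" where
  "lipschitz_free_sub p M2 = closed_lin_span (lipschitz_free p) (lip_delta p ` M2)"

definition Lip_pair ::
  "real \<Rightarrow> 'a::metric_space set \<Rightarrow> 'v::real_vector nspace \<Rightarrow> 'v set \<Rightarrow> ('a \<Rightarrow> 'v) set" where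
  \<comment> \<open>no condition at the distinguished point\<close>
  "Lip_pair lam M2 X1 X2 =
     {f. range f \<subseteq> carr X1 \<and> (\<forall>x y. nrm X1 (f x - f y) \<le> lam * dist x y) \<and> f ` M2 \<subseteq> X2}"


section \<open>Bounded approximation property of a pair\<close>

text \<open>
  Maps on \<open>Z\<close> are considered only through their values on \<open>carr Z\<close>; the bound on the
  operator norm is \<open>\<parallel>S z\<parallel> \<le> lam * \<parallel>z\<parallel>\<close> for all \<open>z\<close>.
\<close>

definition pair_BAP :: "real \<Rightarrow> 'z::real_vector nspace \<Rightarrow> 'z set \<Rightarrow> bool" where
  "pair_BAP lam Z W \<longleftrightarrow>
     (\<forall>\<epsilon>>0. \<forall>A. compactin (norm_topology Z) A \<longrightarrow>
        (\<exists>S::'z \<Rightarrow> 'z.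
           linear_map_on (carr Z) S \<and> S ` carr Z \<subseteq> carr Z \<and>
           (\<exists>B. finite B \<and> S ` carr Z \<subseteq> span B) \<and>
           (\<forall>z\<in>carr Z. nrm Z (S z) \<le> lam * nrm Z z) \<and>
           (\<forall>z\<in>A. nrm Z (S z - z) \<le> \<epsilon>) \<and>
           S ` W \<subseteq> W))"

text \<open>
  A net of maps enters a convergence statement only through its eventuality filter. Accordingly a
  net in a set \<open>L\<close> is a proper filter on maps which eventually lies in \<open>L\<close>; it converges to \<open>f\<close>
  when the canonical images in the bidual do.
\<close>

definition pointwise_weak_star_net_limit ::
  "'v::real_vector nspace \<Rightarrow> ('a \<Rightarrow> 'v) set \<Rightarrow> ('a \<Rightarrow> ('v \<Rightarrow> real) \<Rightarrow> real) \<Rightarrow> bool" where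
  "pointwise_weak_star_net_limit X L f \<longleftrightarrow>
     (\<exists>F. F \<noteq> bot \<and> eventually (\<lambda>g. g \<in> L) F \<and>
          limitin (pointwise_weak_star X) (\<lambda>g x. canonical_embedding X (g x)) f F)"

text \<open>
  Linear size of the ambient space: if \<open>'v\<close> contains a linearly independent family indexed by the
  reals, then every separable Banach space is isometric to some \<open>X :: 'v nspace\<close>. Every Banach space
  whatsoever occurs over some such type (the product of its own underlying vector space with
  the real sequences), so a theorem about all \<open>X :: 'v nspace\<close>, for every \<open>'v\<close> satisfying
  this condition, covers all Banach spaces.
\<close>

definition continuum_dimensional :: "'v::real_vector itself \<Rightarrow> bool" where
  "continuum_dimensional _ \<longleftrightarrow> (\<exists>B::'v set. independent B \<and> (UNIV::real set) \<lesssim> B)"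

end

theory Submission
  imports Defs
begin

text \<open>
  The link between the two sides is that operators on \<open>F(M\<^sub>1)\<close> are the same as Lipschitz maps on
  \<open>M\<^sub>1\<close>. A \<open>K\<close>-Lipschitz map \<open>h\<close> from \<open>M\<^sub>1\<close> to a dual space \<open>X\<^sup>*\<close> with \<open>h(0) = 0\<close> extends to an operator
  of norm at most \<open>K\<close> by the explicit formula \<open>\<mu> \<mapsto> (u \<mapsto> \<mu>(x \<mapsto> h x u))\<close>, since each \<open>x \<mapsto> h x u\<close> is a
  Lipschitz function to which \<open>\<mu>\<close> can be applied (\<open>lip_extension\<close>).

  From the approximation property to nets (\<open>pair_BAP_imp_net_limit\<close>): let \<open>f\<close> be \<open>1\<close>-Lipschitz into
  \<open>X\<^sub>1\<^sup>*\<^sup>*\<close>, and let \<open>T\<close> be the operator extending \<open>f - f(0)\<close>; it maps \<open>F(M\<^sub>2)\<close> into \<open>X\<^sub>2\<^sup>\<bottom>\<^sup>\<bottom>\<close>. Let \<open>S\<close> be a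
  finite-rank operator on the pair, close to the identity on finitely many \<open>\<delta>(x)\<close>. The range of \<open>S\<close> is
  finite-dimensional, so a local reflexivity principle for pairs replaces \<open>T\<close> on that range by an
  operator \<open>R\<close> into \<open>X\<^sub>1\<close> of nearly the same norm, which maps the range of \<open>S\<close> on \<open>F(M\<^sub>2)\<close> into \<open>X\<^sub>2\<close> and
  has nearly the same values at finitely many functionals (\<open>local_reflexivity_map\<close>). The maps
  \<open>x \<mapsto> R(S(\<delta>(x)))\<close>, scaled slightly and translated by an approximation of \<open>f(0)\<close> in \<open>X\<^sub>2\<close>, form the net.

  From nets to the approximation property (\<open>net_limits_imp_pair_BAP\<close>): the finite rank must come from
  a suitable test space. Choose finite sets \<open>D\<^sub>n\<close> and points \<open>r\<^sub>n(x) \<in> D\<^sub>n\<close> which converge to \<open>x\<close> and lie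
  in \<open>M\<^sub>2\<close> if \<open>x\<close> does. Let \<open>X\<^sub>1\<close> be the space of sequences with entries \<open>n + 1\<close> in \<open>F(D\<^sub>n)\<close> which converge
  to their entry \<open>0\<close>, under the supremum norm, and let \<open>X\<^sub>2\<close> consist of the sequences with entries in
  \<open>F(D\<^sub>n \<inter> M\<^sub>2)\<close>. The sequence \<open>(\<delta>(x), \<delta>(r\<^sub>0(x)), \<delta>(r\<^sub>1(x)), \<dots>)\<close> depends on \<open>x\<close> in an uncontrolled way,
  but if its entries \<open>1, \<dots>, n\<close> are erased, the result converges weak* in \<open>X\<^sub>1\<^sup>*\<^sup>*\<close> as \<open>n \<longlonglongrightarrow> \<infinity>\<close>, and only
  the tails matter for the limit \<open>f(x)\<close>; so \<open>f\<close> is \<open>1\<close>-Lipschitz. A Lipschitz map \<open>g\<close> into \<open>X\<^sub>1\<close> close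
  to \<open>f\<close> has entries \<open>0\<close> weakly close to \<open>\<delta>(x)\<close>. By convexity they can be taken close in norm, and then so
  is entry \<open>n + 1\<close> for large \<open>n\<close>. The latter is a Lipschitz map into the finite-dimensional space
  \<open>F(D\<^sub>n)\<close>, whose extension to \<open>F(M\<^sub>1)\<close> has finite rank. The space \<open>X\<^sub>1\<close> has a copy in every vector space
  of dimension at least the continuum, because a sequence in it is determined by countably many reals.

  Both the local reflexivity principle and the passage from weak to norm approximation rest on one form
  of the Hahn--Banach theorem, \<open>linear_separation\<close>.
\<close>

section \<open>Hahn--Banach separation\<close>

definition sublinear_on :: "'b::real_vector set \<Rightarrow> ('b \<Rightarrow> real) \<Rightarrow> bool" where
  "sublinear_on V q \<longleftrightarrow>
     (\<forall>x\<in>V. \<forall>y\<in>V. q (x + y) \<le> q x + q y) \<and> (\<forall>a\<ge>0. \<forall>x\<in>V. q (a *\<^sub>R x) \<le> a * q x)"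

lemma sublinear_on_add: "sublinear_on V q \<Longrightarrow> x \<in> V \<Longrightarrow> y \<in> V \<Longrightarrow> q (x + y) \<le> q x + q y"
  and sublinear_on_scale_le: "sublinear_on V q \<Longrightarrow> 0 \<le> a \<Longrightarrow> x \<in> V \<Longrightarrow> q (a *\<^sub>R x) \<le> a * q x"
  by (auto simp: sublinear_on_def)

lemma sublinear_on_zero:
  assumes "subspace V" "sublinear_on V q"
  shows "q 0 = 0"
proof -
  have "0 \<in> V" using assms(1) by (rule subspace_0)
  then show ?thesis
    using sublinear_on_scale_le[OF assms(2), of 0 0] sublinear_on_add[OF assms(2), of 0 0] by simp
qed

lemma sublinear_on_scale:
  assumes V: "subspace V" and q: "sublinear_on V q" and "0 \<le> a" "x \<in> V"
  shows "q (a *\<^sub>R x) = a * q x"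
proof (cases "a = 0")
  case True
  then show ?thesis using sublinear_on_zero[OF V q] by simp
next
  case False
  then have a: "a > 0" using assms by simp
  have "q (inverse a *\<^sub>R (a *\<^sub>R x)) \<le> inverse a * q (a *\<^sub>R x)"
    using a by (intro sublinear_on_scale_le[OF q] subspace_scale[OF V] assms) auto
  then have "a * q x \<le> q (a *\<^sub>R x)" using a by (simp add: field_simps)
  with sublinear_on_scale_le[OF q assms(3,4)] show ?thesis by simp
qed

text \<open>
  The relaxed functional is \<open>q' z = inf {q (z + t c) - t \<eta> | t \<ge> 0, c \<in> C}\<close>. It is used twice: with a
  single point \<open>c\<close> it shows that a minimal sublinear functional is linear, and with a convex set
  \<open>C\<close> it forces every linear functional below it to be at least \<open>\<eta>\<close> on \<open>C\<close>.
\<close>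

lemma sublinear_on_relax:
  assumes V: "subspace V" and q: "sublinear_on V q"
    and C: "C \<subseteq> V" "C \<noteq> {}" "convex C" and \<eta>: "\<And>c. c \<in> C \<Longrightarrow> \<eta> \<le> q c"
  shows "\<exists>q'. sublinear_on V q' \<and> (\<forall>x\<in>V. q' x \<le> q x) \<and> (\<forall>c\<in>C. q' (- c) \<le> - \<eta>)"
proof -
  define R where "R z = {q (z + t *\<^sub>R c) - t * \<eta> | t c. 0 \<le> t \<and> c \<in> C}" for z
  define q' where "q' z = Inf (R z)" for z
  have inV: "z + t *\<^sub>R c \<in> V" if "z \<in> V" "c \<in> C" for z t c
    using that C by (blast intro: subspace_add[OF V] subspace_scale[OF V])
  have lower: "- q (- z) \<le> q (z + t *\<^sub>R c) - t * \<eta>" if "z \<in> V" "0 \<le> t" "c \<in> C" for z t c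
  proof -
    have "t * \<eta> \<le> t * q c" using that \<eta> by (intro mult_left_mono) auto
    also have "\<dots> = q (t *\<^sub>R c)" using that C by (subst sublinear_on_scale[OF V q]) auto
    also have "\<dots> = q ((z + t *\<^sub>R c) + (- z))" by simp
    also have "\<dots> \<le> q (z + t *\<^sub>R c) + q (- z)"
      using that by (intro sublinear_on_add[OF q] inV subspace_neg[OF V])
    finally show ?thesis by simp
  qed
  have bdd: "bdd_below (R z)" if "z \<in> V" for z
    using lower[OF that] by (intro bdd_belowI[of _ "- q (- z)"]) (auto simp: R_def)
  have le: "q' z \<le> q (z + t *\<^sub>R c) - t * \<eta>" if "z \<in> V" "0 \<le> t" "c \<in> C" for z t c
    unfolding q'_def using that by (intro cInf_lower bdd) (auto simp: R_def)
  have approx: "\<exists>t c. 0 \<le> t \<and> c \<in> C \<and> q (z + t *\<^sub>R c) - t * \<eta> < q' z + e" if "z \<in> V" "e > 0" for z e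
  proof -
    obtain c where "c \<in> C" using C by auto
    then have "q (z + 0 *\<^sub>R c) - 0 * \<eta> \<in> R z" unfolding R_def by blast
    then have "R z \<noteq> {}" by auto
    moreover have "Inf (R z) < q' z + e" using that by (simp add: q'_def)
    ultimately obtain r where "r \<in> R z" "r < q' z + e" using cInf_lessD by metis
    then show ?thesis unfolding R_def by auto
  qed
  have add: "q' (x + y) \<le> q' x + q' y" if x: "x \<in> V" and y: "y \<in> V" for x y
  proof (rule field_le_epsilon)
    fix e :: real assume "e > 0"
    then obtain t c s d where 1: "0 \<le> t" "c \<in> C" "q (x + t *\<^sub>R c) - t * \<eta> < q' x + e/2"
      and 2: "0 \<le> s" "d \<in> C" "q (y + s *\<^sub>R d) - s * \<eta> < q' y + e/2"
      using approx[OF x, of "e/2"] approx[OF y, of "e/2"] by auto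
    obtain b where b: "b \<in> C" "(t + s) *\<^sub>R b = t *\<^sub>R c + s *\<^sub>R d"
    proof (cases "t + s = 0")
      case True
      then have "t = 0" "s = 0" using 1 2 by auto
      then show ?thesis using that[of c] 1 by simp
    next
      case False
      have "(t / (t + s)) *\<^sub>R c + (s / (t + s)) *\<^sub>R d \<in> C"
        using 1 2 False by (intro convexD[OF C(3)]) (auto simp: add_divide_distrib[symmetric])
      moreover have "(t + s) *\<^sub>R ((t / (t + s)) *\<^sub>R c + (s / (t + s)) *\<^sub>R d) = t *\<^sub>R c + s *\<^sub>R d"
        using False by (simp add: scaleR_add_right)
      ultimately show ?thesis using that by blast
    qed
    have "q' (x + y) \<le> q (x + y + (t + s) *\<^sub>R b) - (t + s) * \<eta>"
      using 1 2 b x y by (intro le subspace_add[OF V]) auto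
    also have "x + y + (t + s) *\<^sub>R b = (x + t *\<^sub>R c) + (y + s *\<^sub>R d)"
      using b by (simp add: algebra_simps)
    also have "q \<dots> \<le> q (x + t *\<^sub>R c) + q (y + s *\<^sub>R d)"
      using 1 2 x y by (intro sublinear_on_add[OF q] inV)
    finally show "q' (x + y) \<le> q' x + q' y + e" using 1 2 by (simp add: algebra_simps)
  qed
  have scale: "q' (a *\<^sub>R x) \<le> a * q' x" if a: "0 \<le> a" and x: "x \<in> V" for a x
  proof (cases "a = 0")
    case True
    obtain c where c: "c \<in> C" using C by auto
    have "q' 0 \<le> q (0 + 0 *\<^sub>R c) - 0 * \<eta>" using c V by (intro le subspace_0) auto
    then show ?thesis using True sublinear_on_zero[OF V q] by simp
  next
    case False
    then have a: "a > 0" using a by simp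
    show ?thesis
    proof (rule field_le_epsilon)
      fix e :: real assume "e > 0"
      then obtain t c where 1: "0 \<le> t" "c \<in> C" "q (x + t *\<^sub>R c) - t * \<eta> < q' x + e/a"
        using approx[OF x, of "e/a"] a by auto
      have "q' (a *\<^sub>R x) \<le> q (a *\<^sub>R x + (a * t) *\<^sub>R c) - (a * t) * \<eta>"
        using 1 a x by (intro le subspace_scale[OF V]) auto
      also have "a *\<^sub>R x + (a * t) *\<^sub>R c = a *\<^sub>R (x + t *\<^sub>R c)" by (simp add: algebra_simps)
      also have "q \<dots> = a * q (x + t *\<^sub>R c)"
        using a 1 x by (intro sublinear_on_scale[OF V q] inV) auto
      also have "a * q (x + t *\<^sub>R c) - (a * t) * \<eta> = a * (q (x + t *\<^sub>R c) - t * \<eta>)"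
        by (simp add: algebra_simps)
      also have "\<dots> \<le> a * (q' x + e/a)" using 1 a by (intro mult_left_mono) auto
      also have "\<dots> = a * q' x + e" using a by (simp add: field_simps)
      finally show "q' (a *\<^sub>R x) \<le> a * q' x + e" .
    qed
  qed
  have below: "q' x \<le> q x" if "x \<in> V" for x
  proof -
    obtain c where "c \<in> C" using C by auto
    then show ?thesis using le[OF that, of 0 c] by simp
  qed
  have neg: "q' (- c) \<le> - \<eta>" if "c \<in> C" for c
    using le[of "- c" 1 c] that C subspace_neg[OF V, of c] sublinear_on_zero[OF V q] by auto
  have "sublinear_on V q'" using add scale by (auto simp: sublinear_on_def)
  then show ?thesis using below neg by blast
qed

text \<open>
  Relaxing \<open>m\<close> at \<open>x\<close> with \<open>\<eta> = m x\<close> cannot make it smaller, so \<open>m (- x) \<le> - m x\<close>: a minimal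
  sublinear functional is odd, hence additive.
\<close>

lemma minimal_sublinear_on_linear:
  assumes V: "subspace V" and m: "sublinear_on V m"
    and minimal: "\<And>q. sublinear_on V q \<Longrightarrow> (\<And>x. x \<in> V \<Longrightarrow> q x \<le> m x) \<Longrightarrow> \<forall>x\<in>V. q x = m x"
  shows "linear_map_on V m"
proof -
  have neg: "m (- x) = - m x" if x: "x \<in> V" for x
  proof (rule antisym)
    obtain q where q: "sublinear_on V q" "\<And>x. x \<in> V \<Longrightarrow> q x \<le> m x" "q (- x) \<le> - m x"
      using sublinear_on_relax[OF V m, of "{x}" "m x"] x by auto
    have "m (- x) = q (- x)" using minimal[OF q(1,2)] subspace_neg[OF V x] by simp
    then show "m (- x) \<le> - m x" using q(3) by simp
    have "m (x + - x) \<le> m x + m (- x)" using x subspace_neg[OF V x] by (intro sublinear_on_add[OF m])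
    then show "- m x \<le> m (- x)" using sublinear_on_zero[OF V m] by simp
  qed
  have add: "m (x + y) = m x + m y" if x: "x \<in> V" and y: "y \<in> V" for x y
  proof (rule antisym)
    show "m (x + y) \<le> m x + m y" using x y by (rule sublinear_on_add[OF m])
    have "m ((x + y) + - y) \<le> m (x + y) + m (- y)"
      using x y by (intro sublinear_on_add[OF m] subspace_add[OF V] subspace_neg[OF V])
    then show "m x + m y \<le> m (x + y)" using neg[OF y] by simp
  qed
  have "m (a *\<^sub>R x) = a * m x" if x: "x \<in> V" for a x
  proof (cases "0 \<le> a")
    case True
    then show ?thesis using sublinear_on_scale[OF V m] x by simp
  next
    case False
    then have "m (- a *\<^sub>R x) = - a * m x" using x by (intro sublinear_on_scale[OF V m]) auto
    moreover have "m (- (a *\<^sub>R x)) = - m (a *\<^sub>R x)" using x by (intro neg subspace_scale[OF V])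
    ultimately show ?thesis by simp
  qed
  with add show ?thesis by (simp add: linear_map_on_def)
qed

text \<open>
  Zorn's lemma provides a minimal sublinear functional below \<open>p\<close>: the pointwise infimum of a chain is
  finite, since every member \<open>q\<close> satisfies \<open>q x \<ge> - p (- x)\<close>. In this form of the Hahn--Banach
  theorem, constraints on the functional are built into \<open>p\<close> beforehand.
\<close>

theorem linear_minorant_exists:
  assumes V: "subspace V" and p: "sublinear_on V p"
  shows "\<exists>\<phi>. linear_map_on V \<phi> \<and> (\<forall>x\<in>V. \<phi> x \<le> p x)"
proof -
  define A where "A = {q. sublinear_on V q \<and> (\<forall>x\<in>V. q x \<le> p x) \<and> (\<forall>x. x \<notin> V \<longrightarrow> q x = 0)}"
  have "\<exists>m\<in>A. \<forall>q\<in>A. q \<le> m \<longrightarrow> q = m"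
  proof (rule predicate_Zorn)
    show "partial_order_on A (relation_of (\<lambda>a b. b \<le> a) A)"
      by (auto simp: partial_order_on_def preorder_on_def refl_on_def trans_def antisym_def relation_of_def)
    fix C assume "C \<in> Chains (relation_of (\<lambda>a b. b \<le> a) A)"
    then have CA: "C \<subseteq> A" and chain: "\<And>q r. q \<in> C \<Longrightarrow> r \<in> C \<Longrightarrow> q \<le> r \<or> r \<le> q"
      by (auto simp: Chains_def relation_of_def)
    show "\<exists>u\<in>A. \<forall>q\<in>C. u \<le> q"
    proof (cases "C = {}")
      case True
      have "(\<lambda>x. if x \<in> V then p x else 0) \<in> A"
        using p V by (auto simp: A_def sublinear_on_def subspace_add subspace_scale)
      then show ?thesis using True by auto
    next
      case False
      define u where "u x = (if x \<in> V then INF q\<in>C. q x else 0)" for x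
      have sub: "sublinear_on V q" if "q \<in> C" for q using that CA by (auto simp: A_def)
      have lower: "- p (- x) \<le> q x" if "q \<in> C" "x \<in> V" for q x
      proof -
        have "q (x + - x) \<le> q x + q (- x)"
          using that by (intro sublinear_on_add[OF sub] subspace_neg[OF V])
        moreover have "q (- x) \<le> p (- x)" using that CA subspace_neg[OF V, of x] by (auto simp: A_def)
        ultimately show ?thesis using sublinear_on_zero[OF V sub[OF that(1)]] by simp
      qed
      have le: "u x \<le> q x" if "q \<in> C" "x \<in> V" for q x
        using that lower by (auto simp: u_def intro!: cINF_lower bdd_belowI2)
      have approx: "\<exists>q\<in>C. q x < u x + e" if "x \<in> V" "e > 0" for x e
      proof -
        have "(INF q\<in>C. q x) < u x + e" using that by (simp add: u_def)
        then show ?thesis using cInf_lessD[of "(\<lambda>q. q x) ` C"] False by auto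
      qed
      have add: "u (x + y) \<le> u x + u y" if x: "x \<in> V" and y: "y \<in> V" for x y
      proof (rule field_le_epsilon)
        fix e :: real assume "e > 0"
        then obtain q r where 1: "q \<in> C" "q x < u x + e/2" "r \<in> C" "r y < u y + e/2"
          using approx[OF x, of "e/2"] approx[OF y, of "e/2"] by auto
        have "\<exists>s\<in>C. s \<le> q \<and> s \<le> r" using chain[of q r] 1 by auto
        then obtain s where s: "s \<in> C" "s x \<le> q x" "s y \<le> r y" by (auto simp: le_fun_def)
        have "u (x + y) \<le> s (x + y)" using s x y by (intro le subspace_add[OF V])
        also have "\<dots> \<le> s x + s y" using sub[OF s(1)] x y by (rule sublinear_on_add)
        finally show "u (x + y) \<le> u x + u y + e" using 1 s by simp
      qed
      have scale: "u (a *\<^sub>R x) \<le> a * u x" if a: "0 \<le> a" and x: "x \<in> V" for a x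
      proof (rule field_le_epsilon)
        fix e :: real assume e: "e > 0"
        obtain q where q: "q \<in> C" "q x < u x + e/(a+1)" using approx[OF x, of "e/(a+1)"] a e by auto
        have "u (a *\<^sub>R x) \<le> q (a *\<^sub>R x)" using q x by (intro le subspace_scale[OF V])
        also have "\<dots> \<le> a * q x" using sub[OF q(1)] a x by (rule sublinear_on_scale_le)
        also have "\<dots> \<le> a * (u x + e/(a+1))" using q a by (intro mult_left_mono) auto
        also have "\<dots> \<le> a * u x + e" using a e by (simp add: field_simps)
        finally show "u (a *\<^sub>R x) \<le> a * u x + e" .
      qed
      obtain q0 where "q0 \<in> C" using False by auto
      then have "u x \<le> p x" if "x \<in> V" for x using le[of q0 x] that CA by (fastforce simp: A_def)
      then have "u \<in> A" using add scale by (auto simp: A_def sublinear_on_def u_def)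
      moreover have "u \<le> q" if "q \<in> C" for q
      proof (rule le_funI)
        fix x show "u x \<le> q x" using le[OF that, of x] that CA by (cases "x \<in> V") (auto simp: A_def u_def)
      qed
      ultimately show ?thesis by blast
    qed
  qed
  then obtain m where m: "m \<in> A" and min: "\<And>q. q \<in> A \<Longrightarrow> q \<le> m \<Longrightarrow> q = m" by blast
  have "linear_map_on V m"
  proof (rule minimal_sublinear_on_linear[OF V])
    show "sublinear_on V m" using m by (simp add: A_def)
    fix q assume q: "sublinear_on V q" "\<And>x. x \<in> V \<Longrightarrow> q x \<le> m x"
    define r where "r x = (if x \<in> V then q x else 0)" for x
    have "r \<in> A" using q m V order_trans
      by (fastforce simp: A_def r_def sublinear_on_def subspace_add subspace_scale)
    moreover have "r \<le> m" using q m by (auto simp: le_fun_def r_def A_def)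
    ultimately have "r = m" by (rule min)
    then show "\<forall>x\<in>V. q x = m x" by (metis r_def)
  qed
  then show ?thesis using m by (auto simp: A_def)
qed

theorem linear_separation:
  assumes V: "subspace V" and q: "sublinear_on V q"
    and C: "C \<subseteq> V" "C \<noteq> {}" "convex C" and \<eta>: "\<And>c. c \<in> C \<Longrightarrow> \<eta> \<le> q c"
  shows "\<exists>\<phi>. linear_map_on V \<phi> \<and> (\<forall>x\<in>V. \<phi> x \<le> q x) \<and> (\<forall>c\<in>C. \<eta> \<le> \<phi> c)"
proof -
  obtain q' where q': "sublinear_on V q'" "\<And>x. x \<in> V \<Longrightarrow> q' x \<le> q x" "\<And>c. c \<in> C \<Longrightarrow> q' (- c) \<le> - \<eta>"
    using sublinear_on_relax[OF V q C \<eta>] by blast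
  obtain \<phi> where \<phi>: "linear_map_on V \<phi>" "\<And>x. x \<in> V \<Longrightarrow> \<phi> x \<le> q' x"
    using linear_minorant_exists[OF V q'(1)] by blast
  have "\<eta> \<le> \<phi> c" if c: "c \<in> C" for c
  proof -
    have cV: "c \<in> V" using C c by auto
    have "\<phi> (- 1 *\<^sub>R c) = - 1 *\<^sub>R \<phi> c" using \<phi>(1) cV unfolding linear_map_on_def by blast
    then have "- \<phi> c = \<phi> (- c)" by simp
    also have "\<dots> \<le> - \<eta>" using \<phi>(2)[OF subspace_neg[OF V cV]] q'(3)[OF c] by simp
    finally show ?thesis by simp
  qed
  then show ?thesis using \<phi> q'(2) order_trans by blast
qed

section \<open>Normed spaces and their duals\<close>

lemma normed_space_subspace: "normed_space X \<Longrightarrow> subspace (carr X)"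
  and nrm_nonneg: "normed_space X \<Longrightarrow> x \<in> carr X \<Longrightarrow> 0 \<le> nrm X x"
  and nrm_eq_0_iff: "normed_space X \<Longrightarrow> x \<in> carr X \<Longrightarrow> nrm X x = 0 \<longleftrightarrow> x = 0"
  and nrm_scaleR: "normed_space X \<Longrightarrow> x \<in> carr X \<Longrightarrow> nrm X (c *\<^sub>R x) = \<bar>c\<bar> * nrm X x"
  and nrm_add_le: "normed_space X \<Longrightarrow> x \<in> carr X \<Longrightarrow> y \<in> carr X \<Longrightarrow> nrm X (x + y) \<le> nrm X x + nrm X y"
  by (simp_all only: normed_space_def)

text \<open>
  Homogeneity follows from one inequality by applying it to the inverse scalar.
\<close>

lemma normed_spaceI:
  assumes zero: "0 \<in> carr X"
    and add: "\<And>x y. x \<in> carr X \<Longrightarrow> y \<in> carr X \<Longrightarrow> x + y \<in> carr X"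
    and scale: "\<And>c x. x \<in> carr X \<Longrightarrow> c *\<^sub>R x \<in> carr X"
    and nonneg: "\<And>x. x \<in> carr X \<Longrightarrow> 0 \<le> nrm X x"
    and definite: "\<And>x. x \<in> carr X \<Longrightarrow> nrm X x = 0 \<Longrightarrow> x = 0"
    and scale_le: "\<And>c x. x \<in> carr X \<Longrightarrow> nrm X (c *\<^sub>R x) \<le> \<bar>c\<bar> * nrm X x"
    and triangle: "\<And>x y. x \<in> carr X \<Longrightarrow> y \<in> carr X \<Longrightarrow> nrm X (x + y) \<le> nrm X x + nrm X y"
  shows "normed_space X"
proof -
  have "nrm X (0 *\<^sub>R 0) \<le> \<bar>0\<bar> * nrm X 0" by (rule scale_le[OF zero])
  then have nrm0: "nrm X 0 = 0" using nonneg[OF zero] by simp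
  have "nrm X (c *\<^sub>R x) = \<bar>c\<bar> * nrm X x" if x: "x \<in> carr X" for c x
  proof (cases "c = 0")
    case False
    have "nrm X (inverse c *\<^sub>R (c *\<^sub>R x)) \<le> \<bar>inverse c\<bar> * nrm X (c *\<^sub>R x)"
      by (intro scale_le scale x)
    then have "\<bar>c\<bar> * nrm X x \<le> nrm X (c *\<^sub>R x)" using False by (simp add: field_simps)
    then show ?thesis using scale_le[OF x, of c] by simp
  qed (simp add: nrm0)
  moreover have "subspace (carr X)" using zero add scale by (rule subspaceI)
  ultimately show ?thesis using nonneg definite nrm0 triangle by (auto simp: normed_space_def)
qed

lemma carr_0 [simp]: "normed_space X \<Longrightarrow> 0 \<in> carr X"
  and carr_add: "normed_space X \<Longrightarrow> x \<in> carr X \<Longrightarrow> y \<in> carr X \<Longrightarrow> x + y \<in> carr X"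
  and carr_diff: "normed_space X \<Longrightarrow> x \<in> carr X \<Longrightarrow> y \<in> carr X \<Longrightarrow> x - y \<in> carr X"
  and carr_neg: "normed_space X \<Longrightarrow> x \<in> carr X \<Longrightarrow> - x \<in> carr X"
  and carr_scaleR: "normed_space X \<Longrightarrow> x \<in> carr X \<Longrightarrow> c *\<^sub>R x \<in> carr X"
  by (simp_all add: normed_space_subspace subspace_0 subspace_add subspace_diff subspace_neg subspace_scale)

lemma carr_sum: "normed_space X \<Longrightarrow> (\<And>i. i \<in> I \<Longrightarrow> f i \<in> carr X) \<Longrightarrow> sum f I \<in> carr X"
  by (simp add: normed_space_subspace subspace_sum)

lemmas carr_intros = carr_0 carr_add carr_diff carr_neg carr_scaleR carr_sum

lemma nrm_0 [simp]: "normed_space X \<Longrightarrow> nrm X 0 = 0"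
  by (simp add: nrm_eq_0_iff)

lemma nrm_neg: "normed_space X \<Longrightarrow> x \<in> carr X \<Longrightarrow> nrm X (- x) = nrm X x"
  using nrm_scaleR[of X x "- 1"] by simp

lemma nrm_diff_commute: "normed_space X \<Longrightarrow> x \<in> carr X \<Longrightarrow> y \<in> carr X \<Longrightarrow> nrm X (x - y) = nrm X (y - x)"
  using nrm_neg[of X "x - y"] by (simp add: carr_diff)

lemma nrm_diff_triangle:
  "normed_space X \<Longrightarrow> x \<in> carr X \<Longrightarrow> y \<in> carr X \<Longrightarrow> z \<in> carr X \<Longrightarrow>
    nrm X (x - z) \<le> nrm X (x - y) + nrm X (y - z)"
  using nrm_add_le[of X "x - y" "y - z"] by (simp add: carr_diff)

lemma nrm_le_diff: "normed_space X \<Longrightarrow> x \<in> carr X \<Longrightarrow> y \<in> carr X \<Longrightarrow> nrm X x - nrm X y \<le> nrm X (x - y)"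
  using nrm_add_le[of X "x - y" y] by (simp add: carr_diff)

lemma nrm_sum_le:
  assumes X: "normed_space X" and f: "\<And>i. i \<in> I \<Longrightarrow> f i \<in> carr X"
  shows "nrm X (sum f I) \<le> (\<Sum>i\<in>I. nrm X (f i))"
proof (cases "finite I")
  case True
  then show ?thesis using f
  proof (induction I)
    case (insert i I)
    have "nrm X (f i + sum f I) \<le> nrm X (f i) + nrm X (sum f I)"
      using insert.prems by (intro nrm_add_le X carr_sum) auto
    with insert show ?case by fastforce
  qed (use X in simp)
qed (use X in simp)

lemma nrm_sum_scaleR_le:
  assumes X: "normed_space X" and f: "\<And>i. i \<in> I \<Longrightarrow> f i \<in> carr X"
  shows "nrm X (\<Sum>i\<in>I. c i *\<^sub>R f i) \<le> (\<Sum>i\<in>I. \<bar>c i\<bar> * nrm X (f i))"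
  using nrm_sum_le[of X I "\<lambda>i. c i *\<^sub>R f i"] f by (simp add: nrm_scaleR X carr_scaleR)

lemma linear_map_on_0: "subspace V \<Longrightarrow> linear_map_on V T \<Longrightarrow> T 0 = 0"
  unfolding linear_map_on_def by (metis scaleR_zero_left subspace_0)

lemma linear_map_on_add: "linear_map_on V T \<Longrightarrow> x \<in> V \<Longrightarrow> y \<in> V \<Longrightarrow> T (x + y) = T x + T y"
  and linear_map_on_scaleR: "linear_map_on V T \<Longrightarrow> x \<in> V \<Longrightarrow> T (c *\<^sub>R x) = c *\<^sub>R T x"
  by (auto simp: linear_map_on_def)

lemma linear_map_on_neg: "linear_map_on V T \<Longrightarrow> x \<in> V \<Longrightarrow> T (- x) = - T x"
  using linear_map_on_scaleR[of V T x "- 1"] by simp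

lemma linear_map_on_diff:
  "subspace V \<Longrightarrow> linear_map_on V T \<Longrightarrow> x \<in> V \<Longrightarrow> y \<in> V \<Longrightarrow> T (x - y) = T x - T y"
  using linear_map_on_add[of V T x "- y"] by (simp add: linear_map_on_neg subspace_neg)

lemma linear_map_on_sum:
  assumes V: "subspace V" and T: "linear_map_on V T" and f: "\<And>i. i \<in> I \<Longrightarrow> f i \<in> V"
  shows "T (sum f I) = (\<Sum>i\<in>I. T (f i))"
proof (cases "finite I")
  case True
  then show ?thesis using f
    by induction (simp_all add: linear_map_on_0[OF V T] linear_map_on_add[OF T] subspace_sum[OF V])
qed (simp add: linear_map_on_0[OF V T])

lemma linear_map_on_sum_scaleR:
  assumes V: "subspace V" and T: "linear_map_on V T" and f: "\<And>i. i \<in> I \<Longrightarrow> f i \<in> V"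
  shows "T (\<Sum>i\<in>I. c i *\<^sub>R f i) = (\<Sum>i\<in>I. c i *\<^sub>R T (f i))"
  using f by (simp add: linear_map_on_sum[OF V T] linear_map_on_scaleR[OF T] subspace_scale[OF V])

lemma sum_fun_apply: "(sum f I) x = (\<Sum>i\<in>I. f i x)" for f :: "'i \<Rightarrow> 'b \<Rightarrow> 'c::comm_monoid_add"
  by (induction I rule: infinite_finite_induct) simp_all

text \<open>
  Completeness, closedness and compactness are used below only through \<open>\<epsilon>\<close>-conditions on \<open>nrm\<close>;
  this lemma and the next ones translate them.
\<close>

lemma banach_space_iff:
  "banach_space X \<longleftrightarrow> normed_space X \<and>
     (\<forall>\<sigma>::nat \<Rightarrow> _. (\<forall>n. \<sigma> n \<in> carr X) \<longrightarrow> (\<forall>e>0. \<exists>N. \<forall>m\<ge>N. \<forall>n\<ge>N. nrm X (\<sigma> m - \<sigma> n) < e) \<longrightarrow>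
        (\<exists>l\<in>carr X. \<forall>e>0. \<exists>N. \<forall>n\<ge>N. nrm X (\<sigma> n - l) < e))"
proof (cases "normed_space X")
  case True
  interpret M: Metric_space "carr X" "ndist X" by (rule normed_space_Metric_space[OF True])
  have *: "M.MCauchy \<sigma> \<longleftrightarrow> (\<forall>n. \<sigma> n \<in> carr X) \<and> (\<forall>e>0. \<exists>N. \<forall>m\<ge>N. \<forall>n\<ge>N. nrm X (\<sigma> m - \<sigma> n) < e)" for \<sigma> :: "nat \<Rightarrow> _"
  proof (cases "\<forall>n. \<sigma> n \<in> carr X")
    case True
    then show ?thesis unfolding M.MCauchy_def by (simp add: ndist_def image_subset_iff)
  qed (auto simp: M.MCauchy_def)
  have **: "(\<exists>l. limitin M.mtopology \<sigma> l sequentially) \<longleftrightarrow> (\<exists>l\<in>carr X. \<forall>e>0. \<exists>N. \<forall>n\<ge>N. nrm X (\<sigma> n - l) < e)"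
    if "\<forall>n. \<sigma> n \<in> carr X" for \<sigma> :: "nat \<Rightarrow> _"
  proof -
    have "limitin M.mtopology \<sigma> l sequentially \<longleftrightarrow> l \<in> carr X \<and> (\<forall>e>0. \<exists>N. \<forall>n\<ge>N. nrm X (\<sigma> n - l) < e)" for l
      using that unfolding M.limit_metric_sequentially by (auto simp: ndist_def)
    then show ?thesis by (simp add: Bex_def)
  qed
  show ?thesis
    unfolding banach_space_def M.mcomplete_def * by (simp add: True ** imp_conjL cong: imp_cong)
qed (auto simp: banach_space_def)

lemma closed_subspace_iff:
  assumes X: "normed_space X"
  shows "closed_subspace X W \<longleftrightarrow> subspace W \<and> W \<subseteq> carr X \<and>
     (\<forall>x\<in>carr X. (\<forall>e>0. \<exists>w\<in>W. nrm X (x - w) < e) \<longrightarrow> x \<in> W)"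
proof -
  interpret M: Metric_space "carr X" "ndist X" by (rule normed_space_Metric_space[OF X])
  have "closedin M.mtopology W \<longleftrightarrow> W \<subseteq> carr X \<and>
     (\<forall>x\<in>carr X. (\<forall>e>0. \<exists>w\<in>W. nrm X (x - w) < e) \<longrightarrow> x \<in> W)"
  proof (cases "W \<subseteq> carr X")
    case True
    then have "(\<exists>r>0. disjnt W (M.mball x r)) \<longleftrightarrow> \<not> (\<forall>e>0. \<exists>w\<in>W. nrm X (x - w) < e)" if "x \<in> carr X" for x
      using that by (fastforce simp: disjnt_iff ndist_def)
    then show ?thesis using True unfolding M.closedin_metric by blast
  qed (auto simp: M.closedin_metric)
  then show ?thesis unfolding closed_subspace_def norm_topology_def by auto
qed

lemma closed_lin_span_iff:
  assumes X: "normed_space X" and A: "A \<subseteq> carr X"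
  shows "x \<in> closed_lin_span X A \<longleftrightarrow> x \<in> carr X \<and> (\<forall>e>0. \<exists>w\<in>span A. nrm X (x - w) < e)"
proof -
  interpret M: Metric_space "carr X" "ndist X" by (rule normed_space_Metric_space[OF X])
  have "span A \<subseteq> carr X" by (rule span_minimal[OF A normed_space_subspace[OF X]])
  then show ?thesis
    unfolding closed_lin_span_def norm_topology_def M.metric_closure_of
    by (fastforce simp: ndist_def)
qed

lemma closed_lin_span_subspace:
  assumes X: "normed_space X" and A: "A \<subseteq> carr X"
  shows "subspace (closed_lin_span X A)"
proof -
  have sp: "span A \<subseteq> carr X" by (rule span_minimal[OF A normed_space_subspace[OF X]])
  note iff = closed_lin_span_iff[OF X A]
  show ?thesis
  proof (rule subspaceI)
    show "0 \<in> closed_lin_span X A" unfolding iff using X span_zero[of A] by (auto intro!: bexI[of _ 0])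
    fix x y assume x: "x \<in> closed_lin_span X A"
    { assume y: "y \<in> closed_lin_span X A"
      have "\<exists>w\<in>span A. nrm X (x + y - w) < e" if "e > 0" for e
      proof -
        have "e/2 > 0" using that by simp
        then obtain v w where vw: "v \<in> span A" "nrm X (x - v) < e/2" "w \<in> span A" "nrm X (y - w) < e/2"
          using x y unfolding iff by blast
        have "nrm X ((x - v) + (y - w)) \<le> nrm X (x - v) + nrm X (y - w)"
          using x y vw sp by (intro nrm_add_le X carr_diff) (auto simp: iff)
        then have "nrm X (x + y - (v + w)) < e" using vw by (simp add: algebra_simps)
        then show ?thesis using vw span_add by blast
      qed
      then show "x + y \<in> closed_lin_span X A" using x y unfolding iff by (auto intro: carr_intros X) }
    fix c :: real
    have "\<exists>w\<in>span A. nrm X (c *\<^sub>R x - w) < e" if "e > 0" for e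
    proof -
      have "e / (\<bar>c\<bar> + 1) > 0" using that by (intro divide_pos_pos) auto
      then obtain v where v: "v \<in> span A" "nrm X (x - v) < e / (\<bar>c\<bar> + 1)"
        using x unfolding iff by blast
      have "nrm X (c *\<^sub>R x - c *\<^sub>R v) = \<bar>c\<bar> * nrm X (x - v)"
        using v x sp nrm_scaleR[OF X carr_diff[OF X], of x v c] by (auto simp: iff scaleR_diff_right)
      also have "\<dots> \<le> \<bar>c\<bar> * (e / (\<bar>c\<bar> + 1))" using v by (intro mult_left_mono) auto
      also have "\<dots> < e" using that by (simp add: field_simps)
      finally show ?thesis using v span_scale by blast
    qed
    then show "c *\<^sub>R x \<in> closed_lin_span X A" using x unfolding iff by (auto intro: carr_intros X)
  qed
qed

lemma compactin_norm_topologyD: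
  assumes X: "normed_space X" and A: "compactin (norm_topology X) A"
  shows "A \<subseteq> carr X" "e > 0 \<Longrightarrow> \<exists>K. finite K \<and> K \<subseteq> A \<and> (\<forall>x\<in>A. \<exists>y\<in>K. nrm X (x - y) < e)"
proof -
  interpret M: Metric_space "carr X" "ndist X" by (rule normed_space_Metric_space[OF X])
  show "A \<subseteq> carr X" using compactin_subset_topspace[OF A] by (simp add: norm_topology_def)
  assume "e > 0"
  have "M.mtotally_bounded A"
    using A unfolding norm_topology_def by (rule M.compactin_imp_mtotally_bounded)
  then obtain K where K: "finite K" "K \<subseteq> A" "A \<subseteq> (\<Union>y\<in>K. M.mball y e)"
    using \<open>e > 0\<close> unfolding M.mtotally_bounded_def by (elim allE[of _ e]) (elim impE exE conjE, assumption, rule that)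
  have "\<exists>y\<in>K. nrm X (x - y) < e" if "x \<in> A" for x
  proof -
    have "x \<in> (\<Union>y\<in>K. M.mball y e)" using that K by (rule_tac subsetD)
    then obtain y where "y \<in> K" "x \<in> M.mball y e" by (elim UN_E)
    then show ?thesis using nrm_diff_commute[OF X, of x y] by (intro bexI[of _ y]) (auto simp: ndist_def)
  qed
  then show "\<exists>K. finite K \<and> K \<subseteq> A \<and> (\<forall>x\<in>A. \<exists>y\<in>K. nrm X (x - y) < e)" using K by blast
qed

lemma finite_compactin_norm_topology:
  assumes X: "normed_space X" and "finite A" "A \<subseteq> carr X"
  shows "compactin (norm_topology X) A"
proof -
  interpret M: Metric_space "carr X" "ndist X" by (rule normed_space_Metric_space[OF X])
  show ?thesis unfolding norm_topology_def using assms by (intro finite_imp_compactin) auto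
qed

lemma in_dual_iff:
  "\<phi> \<in> carr (dual_space X) \<longleftrightarrow> linear_map_on (carr X) \<phi> \<and>
     (\<exists>K. \<forall>x\<in>carr X. \<bar>\<phi> x\<bar> \<le> K * nrm X x) \<and> (\<forall>x. x \<notin> carr X \<longrightarrow> \<phi> x = 0)"
  by (simp add: dual_space_def)

lemma dual_linear: "\<phi> \<in> carr (dual_space X) \<Longrightarrow> linear_map_on (carr X) \<phi>"
  and dual_outside: "\<phi> \<in> carr (dual_space X) \<Longrightarrow> x \<notin> carr X \<Longrightarrow> \<phi> x = 0"
  by (auto simp: in_dual_iff)

lemma nrm_dual: "nrm (dual_space X) \<phi> = Sup {\<bar>\<phi> x\<bar> | x. x \<in> carr X \<and> nrm X x \<le> 1}"
  by (simp add: dual_space_def)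

lemma dual_values_bdd_above:
  assumes X: "normed_space X" and \<phi>: "\<phi> \<in> carr (dual_space X)"
  shows "bdd_above {\<bar>\<phi> x\<bar> | x. x \<in> carr X \<and> nrm X x \<le> 1}"
proof -
  obtain K where K: "\<And>x. x \<in> carr X \<Longrightarrow> \<bar>\<phi> x\<bar> \<le> K * nrm X x" using \<phi> by (auto simp: in_dual_iff)
  show ?thesis
  proof (rule bdd_aboveI)
    fix r assume "r \<in> {\<bar>\<phi> x\<bar> | x. x \<in> carr X \<and> nrm X x \<le> 1}"
    then obtain x where x: "r = \<bar>\<phi> x\<bar>" "x \<in> carr X" "nrm X x \<le> 1" by auto
    have "r \<le> K * nrm X x" using K x by simp
    also have "\<dots> \<le> \<bar>K\<bar> * 1" using x nrm_nonneg[OF X] by (intro mult_mono) auto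
    finally show "r \<le> \<bar>K\<bar>" by simp
  qed
qed

lemma dual_apply_le:
  assumes X: "normed_space X" and \<phi>: "\<phi> \<in> carr (dual_space X)" and x: "x \<in> carr X"
  shows "\<bar>\<phi> x\<bar> \<le> nrm (dual_space X) \<phi> * nrm X x"
proof (cases "x = 0")
  case True
  then show ?thesis using linear_map_on_0[OF normed_space_subspace[OF X] dual_linear[OF \<phi>]] X by simp
next
  case False
  let ?u = "inverse (nrm X x) *\<^sub>R x"
  have pos: "nrm X x > 0" using nrm_nonneg[OF X x] nrm_eq_0_iff[OF X x] False by linarith
  have u: "?u \<in> carr X" "nrm X ?u \<le> 1"
    using x pos X by (auto simp: carr_scaleR nrm_scaleR)
  then have "\<bar>\<phi> ?u\<bar> \<le> nrm (dual_space X) \<phi>"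
    unfolding nrm_dual by (intro cSup_upper dual_values_bdd_above X \<phi>) auto
  moreover have "\<phi> ?u = inverse (nrm X x) * \<phi> x"
    using linear_map_on_scaleR[OF dual_linear[OF \<phi>] x] by simp
  ultimately have "inverse (nrm X x) * \<bar>\<phi> x\<bar> \<le> nrm (dual_space X) \<phi>" using pos by (simp add: abs_mult)
  then show ?thesis using pos by (simp add: field_simps)
qed

lemma dual_nrm_le:
  assumes X: "normed_space X" and "0 \<le> K" and K: "\<And>x. x \<in> carr X \<Longrightarrow> \<bar>\<phi> x\<bar> \<le> K * nrm X x"
  shows "nrm (dual_space X) \<phi> \<le> K"
  unfolding nrm_dual
proof (rule cSup_least)
  show "{\<bar>\<phi> x\<bar> | x. x \<in> carr X \<and> nrm X x \<le> 1} \<noteq> {}" using X by (auto intro!: exI[of _ "0 :: 'a"])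
  fix r assume "r \<in> {\<bar>\<phi> x\<bar> | x. x \<in> carr X \<and> nrm X x \<le> 1}"
  then obtain x where x: "r = \<bar>\<phi> x\<bar>" "x \<in> carr X" "nrm X x \<le> 1" by auto
  have "r \<le> K * nrm X x" using K x by simp
  also have "\<dots> \<le> K * 1" using x \<open>0 \<le> K\<close> by (intro mult_left_mono) auto
  finally show "r \<le> K" by simp
qed

lemma dualI:
  assumes "\<And>x y. x \<in> carr X \<Longrightarrow> y \<in> carr X \<Longrightarrow> \<phi> (x + y) = \<phi> x + \<phi> y"
    and "\<And>c x. x \<in> carr X \<Longrightarrow> \<phi> (c *\<^sub>R x) = c * \<phi> x"
    and "\<And>x. x \<in> carr X \<Longrightarrow> \<bar>\<phi> x\<bar> \<le> K * nrm X x"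
    and "\<And>x. x \<notin> carr X \<Longrightarrow> \<phi> x = 0"
  shows "\<phi> \<in> carr (dual_space X)"
proof -
  have "\<exists>K. \<forall>x\<in>carr X. \<bar>\<phi> x\<bar> \<le> K * nrm X x" using assms(3) by blast
  then show ?thesis using assms(1,2,4) by (simp add: in_dual_iff linear_map_on_def)
qed

lemma dual_nrm_nonneg:
  assumes X: "normed_space X" and \<phi>: "\<phi> \<in> carr (dual_space X)"
  shows "0 \<le> nrm (dual_space X) \<phi>"
proof -
  have "\<bar>\<phi> 0\<bar> \<in> {\<bar>\<phi> x\<bar> | x. x \<in> carr X \<and> nrm X x \<le> 1}" using X by force
  then have "\<bar>\<phi> 0\<bar> \<le> nrm (dual_space X) \<phi>"
    unfolding nrm_dual by (rule cSup_upper) (rule dual_values_bdd_above[OF X \<phi>])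
  then show ?thesis by linarith
qed

lemma normed_space_dual:
  assumes X: "normed_space X"
  shows "normed_space (dual_space X)"
proof -
  let ?D = "dual_space X"
  have add: "\<phi> + \<psi> \<in> carr ?D \<and> nrm ?D (\<phi> + \<psi>) \<le> nrm ?D \<phi> + nrm ?D \<psi>"
    if \<phi>: "\<phi> \<in> carr ?D" and \<psi>: "\<psi> \<in> carr ?D" for \<phi> \<psi>
  proof -
    have le: "\<bar>(\<phi> + \<psi>) x\<bar> \<le> (nrm ?D \<phi> + nrm ?D \<psi>) * nrm X x" if "x \<in> carr X" for x
      using dual_apply_le[OF X \<phi> that] dual_apply_le[OF X \<psi> that] by (simp add: algebra_simps)
    have "\<phi> + \<psi> \<in> carr ?D"
      using linear_map_on_add[OF dual_linear[OF \<phi>]] linear_map_on_add[OF dual_linear[OF \<psi>]]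
        linear_map_on_scaleR[OF dual_linear[OF \<phi>]] linear_map_on_scaleR[OF dual_linear[OF \<psi>]]
        dual_outside[OF \<phi>] dual_outside[OF \<psi>] le
      by (intro dualI[where K = "nrm ?D \<phi> + nrm ?D \<psi>"]) (auto simp: algebra_simps)
    moreover have "nrm ?D (\<phi> + \<psi>) \<le> nrm ?D \<phi> + nrm ?D \<psi>"
      using le \<phi> \<psi> by (intro dual_nrm_le X add_nonneg_nonneg dual_nrm_nonneg)
    ultimately show ?thesis ..
  qed
  have scale: "c *\<^sub>R \<phi> \<in> carr ?D \<and> nrm ?D (c *\<^sub>R \<phi>) \<le> \<bar>c\<bar> * nrm ?D \<phi>" if \<phi>: "\<phi> \<in> carr ?D" for \<phi> c
  proof -
    have le: "\<bar>(c *\<^sub>R \<phi>) x\<bar> \<le> (\<bar>c\<bar> * nrm ?D \<phi>) * nrm X x" if "x \<in> carr X" for x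
      using mult_left_mono[OF dual_apply_le[OF X \<phi> that] abs_ge_zero[of c]]
      by (simp add: abs_mult mult.assoc)
    have "c *\<^sub>R \<phi> \<in> carr ?D"
      using linear_map_on_add[OF dual_linear[OF \<phi>]] linear_map_on_scaleR[OF dual_linear[OF \<phi>]]
        dual_outside[OF \<phi>] le
      by (intro dualI[where K = "\<bar>c\<bar> * nrm ?D \<phi>"]) (auto simp: algebra_simps)
    moreover have "nrm ?D (c *\<^sub>R \<phi>) \<le> \<bar>c\<bar> * nrm ?D \<phi>"
      using le \<phi> by (intro dual_nrm_le X mult_nonneg_nonneg dual_nrm_nonneg) auto
    ultimately show ?thesis ..
  qed
  show ?thesis
  proof (rule normed_spaceI)
    show "0 \<in> carr ?D" by (rule dualI[where K = 0]) auto
    show "\<phi> = 0" if \<phi>: "\<phi> \<in> carr ?D" and 0: "nrm ?D \<phi> = 0" for \<phi>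
    proof
      fix x show "\<phi> x = 0 x"
        using dual_apply_le[OF X \<phi>, of x] 0 dual_outside[OF \<phi>, of x] by (cases "x \<in> carr X") auto
    qed
  qed (use add scale dual_nrm_nonneg[OF X] in auto)
qed

lemma banach_space_dual:
  assumes X: "normed_space X"
  shows "banach_space (dual_space X)"
  unfolding banach_space_iff
proof (intro conjI allI impI)
  let ?D = "dual_space X"
  show D: "normed_space ?D" by (rule normed_space_dual[OF X])
  fix \<sigma> :: "nat \<Rightarrow> _" assume \<sigma>: "\<forall>n. \<sigma> n \<in> carr ?D" and C: "\<forall>e>0. \<exists>N. \<forall>m\<ge>N. \<forall>n\<ge>N. nrm ?D (\<sigma> m - \<sigma> n) < e"
  have le: "\<bar>\<sigma> m x - \<sigma> n x\<bar> \<le> nrm ?D (\<sigma> m - \<sigma> n) * nrm X x" if "x \<in> carr X" for m n x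
    using dual_apply_le[OF X carr_diff[OF D] that, of "\<sigma> m" "\<sigma> n"] \<sigma> by simp
  have conv: "convergent (\<lambda>n. \<sigma> n x)" for x
  proof (cases "x \<in> carr X")
    case True
    have "Cauchy (\<lambda>n. \<sigma> n x)"
    proof (rule CauchyI)
      fix e :: real assume "e > 0"
      then have "e / (nrm X x + 1) > 0" using nrm_nonneg[OF X True] by (intro divide_pos_pos) auto
      then obtain N where N: "\<And>m n. m \<ge> N \<Longrightarrow> n \<ge> N \<Longrightarrow> nrm ?D (\<sigma> m - \<sigma> n) < e / (nrm X x + 1)"
        using C by blast
      have "norm (\<sigma> m x - \<sigma> n x) < e" if "m \<ge> N" "n \<ge> N" for m n
      proof -
        have "\<bar>\<sigma> m x - \<sigma> n x\<bar> \<le> e / (nrm X x + 1) * nrm X x"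
          using le[OF True, of m n] mult_right_mono[OF less_imp_le[OF N[OF that]] nrm_nonneg[OF X True]]
          by linarith
        also have "\<dots> < e" using \<open>e > 0\<close> nrm_nonneg[OF X True] by (simp add: field_simps)
        finally show ?thesis by simp
      qed
      then show "\<exists>M. \<forall>m\<ge>M. \<forall>n\<ge>M. norm (\<sigma> m x - \<sigma> n x) < e" by blast
    qed
    then show ?thesis by (simp add: Cauchy_convergent_iff)
  next
    case False
    then have "\<sigma> n x = 0" for n using \<sigma> dual_outside by blast
    then show ?thesis by (simp add: convergent_const)
  qed
  define l where "l x = lim (\<lambda>n. \<sigma> n x)" for x
  have lim: "(\<lambda>n. \<sigma> n x) \<longlonglongrightarrow> l x" for x using conv unfolding l_def by (simp add: convergent_LIMSEQ_iff)
  have lin: "linear_map_on (carr X) (\<sigma> n)" for n using \<sigma> dual_linear by blast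
  have est: "\<exists>N. \<forall>n\<ge>N. \<forall>x\<in>carr X. \<bar>\<sigma> n x - l x\<bar> \<le> e * nrm X x" if "e > 0" for e
  proof -
    obtain N where N: "\<And>m n. m \<ge> N \<Longrightarrow> n \<ge> N \<Longrightarrow> nrm ?D (\<sigma> m - \<sigma> n) < e" using C \<open>e > 0\<close> by blast
    have "\<bar>\<sigma> n x - l x\<bar> \<le> e * nrm X x" if n: "n \<ge> N" and x: "x \<in> carr X" for n x
    proof (rule LIMSEQ_le_const2)
      show "(\<lambda>m. \<bar>\<sigma> n x - \<sigma> m x\<bar>) \<longlonglongrightarrow> \<bar>\<sigma> n x - l x\<bar>" by (intro tendsto_intros lim)
      have "\<bar>\<sigma> n x - \<sigma> m x\<bar> \<le> e * nrm X x" if "m \<ge> N" for m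
        using le[OF x, of n m] mult_right_mono[OF less_imp_le[OF N[OF n that]] nrm_nonneg[OF X x]] by linarith
      then show "\<exists>N. \<forall>m\<ge>N. \<bar>\<sigma> n x - \<sigma> m x\<bar> \<le> e * nrm X x" by blast
    qed
    then show ?thesis by blast
  qed
  have l: "l \<in> carr ?D"
  proof -
    obtain N where N: "\<And>x. x \<in> carr X \<Longrightarrow> \<bar>\<sigma> N x - l x\<bar> \<le> 1 * nrm X x"
      using est[of 1] by auto
    show ?thesis
    proof (rule dualI[where K = "nrm ?D (\<sigma> N) + 1"])
      fix x y assume "x \<in> carr X" "y \<in> carr X"
      then have "(\<lambda>n. \<sigma> n (x + y)) \<longlonglongrightarrow> l x + l y"
        using tendsto_add[OF lim[of x] lim[of y]] by (simp add: linear_map_on_add[OF lin])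
      then show "l (x + y) = l x + l y" using lim LIMSEQ_unique by blast
    next
      fix c x assume "x \<in> carr X"
      then have "(\<lambda>n. \<sigma> n (c *\<^sub>R x)) \<longlonglongrightarrow> c * l x"
        using tendsto_mult_left[OF lim[of x], of c] by (simp add: linear_map_on_scaleR[OF lin])
      then show "l (c *\<^sub>R x) = c * l x" using lim LIMSEQ_unique by blast
    next
      fix x assume x: "x \<in> carr X"
      have "\<bar>\<sigma> N x\<bar> \<le> nrm ?D (\<sigma> N) * nrm X x" using \<sigma> by (intro dual_apply_le X x) auto
      then show "\<bar>l x\<bar> \<le> (nrm ?D (\<sigma> N) + 1) * nrm X x" using N[OF x] by (simp add: algebra_simps)
    next
      fix x assume "x \<notin> carr X"
      then have "(\<lambda>n. \<sigma> n x) = (\<lambda>n. 0)" using \<sigma> dual_outside by blast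
      then show "l x = 0" using lim[of x] LIMSEQ_unique by auto
    qed
  qed
  show "\<exists>l\<in>carr ?D. \<forall>e>0. \<exists>N. \<forall>n\<ge>N. nrm ?D (\<sigma> n - l) < e"
  proof (intro bexI[OF _ l] allI impI)
    fix e :: real assume "e > 0"
    then obtain N where N: "\<And>n x. n \<ge> N \<Longrightarrow> x \<in> carr X \<Longrightarrow> \<bar>\<sigma> n x - l x\<bar> \<le> (e/2) * nrm X x"
      using est[of "e/2"] by auto
    have "nrm ?D (\<sigma> n - l) \<le> e/2" if "n \<ge> N" for n
      using N[OF that] \<open>e > 0\<close> by (intro dual_nrm_le X) auto
    then have "\<forall>n\<ge>N. nrm ?D (\<sigma> n - l) < e" using \<open>e > 0\<close> by fastforce
    then show "\<exists>N. \<forall>n\<ge>N. nrm ?D (\<sigma> n - l) < e" ..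
  qed
qed

lemma canonical_embedding_in_bidual:
  assumes X: "normed_space X" and x: "x \<in> carr X"
  shows "canonical_embedding X x \<in> carr (bidual X)"
proof (rule dualI[where K = "nrm X x"])
  note D = normed_space_dual[OF X]
  show "\<bar>canonical_embedding X x \<phi>\<bar> \<le> nrm X x * nrm (dual_space X) \<phi>" if "\<phi> \<in> carr (dual_space X)" for \<phi>
    using that dual_apply_le[OF X that x] by (simp add: canonical_embedding_def mult.commute)
qed (auto simp: canonical_embedding_def carr_add carr_scaleR normed_space_dual[OF X])

section \<open>Finite-dimensional subspaces\<close>

text \<open>
  The norm of a linear combination is a continuous function of its coefficients, and it has no zero on
  the compact set of coefficients with absolute sum \<open>1\<close>; its minimum there gives the constant.
\<close>

lemma finite_dim_coordinates_bounded:
  fixes B :: "'v::real_vector set"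
  assumes X: "normed_space X" and B: "finite B" "independent B" "B \<subseteq> carr X"
  shows "\<exists>C\<ge>0. \<forall>c. (\<Sum>b\<in>B. \<bar>c b\<bar>) \<le> C * nrm X (\<Sum>b\<in>B. c b *\<^sub>R b)"
proof -
  define N where "N c = nrm X (\<Sum>b\<in>B. c b *\<^sub>R b)" for c :: "'v \<Rightarrow> real"
  have carr: "(\<Sum>b\<in>B. c b *\<^sub>R b) \<in> carr X" for c using B by (intro carr_intros X) auto
  have lip: "\<bar>N c - N c'\<bar> \<le> (\<Sum>b\<in>B. \<bar>c b - c' b\<bar> * nrm X b)" for c c'
  proof -
    have "nrm X ((\<Sum>b\<in>B. c b *\<^sub>R b) - (\<Sum>b\<in>B. c' b *\<^sub>R b)) \<le> (\<Sum>b\<in>B. \<bar>c b - c' b\<bar> * nrm X b)"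
      using nrm_sum_scaleR_le[OF X, of B id "\<lambda>b. c b - c' b"] B
      by (auto simp: scaleR_diff_left sum_subtractf)
    then show ?thesis
      using nrm_le_diff[OF X carr carr, of c c'] nrm_le_diff[OF X carr carr, of c' c]
        nrm_diff_commute[OF X carr carr, of c c']
      unfolding N_def by linarith
  qed
  define S where "S = {c :: 'v \<Rightarrow> real. c \<in> (\<Pi>\<^sub>E b\<in>UNIV. if b \<in> B then {-1..1} else {0}) \<and> (\<Sum>b\<in>B. \<bar>c b\<bar>) = 1}"
  have coord: "continuous_on UNIV (\<lambda>c :: 'v \<Rightarrow> real. c b)" for b
    by (rule continuous_on_product_coordinates)
  have "compactin (product_topology (\<lambda>b::'v. euclidean :: real topology) UNIV)
      (\<Pi>\<^sub>E b\<in>UNIV. if b \<in> B then {-1..1} else {0})"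
    by (subst compactin_PiE) auto
  then have "compact (\<Pi>\<^sub>E b\<in>(UNIV::'v set). if b \<in> B then {-1..1} else {0::real})"
    by (simp add: euclidean_product_topology)
  moreover have "closed {c :: 'v \<Rightarrow> real. (\<Sum>b\<in>B. \<bar>c b\<bar>) = 1}"
    by (intro closed_Collect_eq continuous_intros coord)
  ultimately have S: "compact S"
    unfolding S_def Collect_conj_eq by (simp add: compact_Int_closed)
  have "continuous_on S N"
    unfolding continuous_on_def
  proof
    fix c0 assume "c0 \<in> S"
    have "((\<lambda>c. \<Sum>b\<in>B. \<bar>c b - c0 b\<bar> * nrm X b) \<longlongrightarrow> (\<Sum>b\<in>B. \<bar>c0 b - c0 b\<bar> * nrm X b)) (at c0 within S)"
      by (intro tendsto_intros) (use coord in \<open>auto simp: continuous_on_def intro: tendsto_within_subset\<close>)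
    then have *: "((\<lambda>c. \<Sum>b\<in>B. \<bar>c b - c0 b\<bar> * nrm X b) \<longlongrightarrow> 0) (at c0 within S)" by simp
    have "((\<lambda>c. N c - N c0) \<longlongrightarrow> 0) (at c0 within S)"
      by (rule Lim_null_comparison[OF _ *]) (simp add: lip)
    then show "(N \<longlongrightarrow> N c0) (at c0 within S)" by (simp add: Lim_null[symmetric])
  qed
  show ?thesis
  proof (cases "B = {}")
    case True
    then show ?thesis using X by auto
  next
    case False
    then obtain b0 where b0: "b0 \<in> B" by auto
    have "(\<lambda>b. if b = b0 then 1 else 0) \<in> S"
      using b0 B by (auto simp: S_def sum.delta if_distrib[of abs] cong: if_cong)
    then obtain c0 where c0: "c0 \<in> S" "\<And>c. c \<in> S \<Longrightarrow> N c0 \<le> N c"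
      using continuous_attains_inf[OF S _ \<open>continuous_on S N\<close>] by blast
    have "N c0 \<noteq> 0"
    proof
      assume "N c0 = 0"
      then have "(\<Sum>b\<in>B. c0 b *\<^sub>R b) = 0" using nrm_eq_0_iff[OF X carr] by (simp add: N_def)
      then have "\<forall>b\<in>B. c0 b = 0" using B independentD by blast
      then show False using c0 by (simp add: S_def)
    qed
    then have pos: "N c0 > 0" using nrm_nonneg[OF X carr, of c0] by (simp add: N_def)
    have "(\<Sum>b\<in>B. \<bar>c b\<bar>) \<le> (1 / N c0) * nrm X (\<Sum>b\<in>B. c b *\<^sub>R b)" for c
    proof (cases "(\<Sum>b\<in>B. \<bar>c b\<bar>) = 0")
      case True
      then show ?thesis using nrm_nonneg[OF X carr, of c] pos by simp
    next
      case False
      define s where "s = (\<Sum>b\<in>B. \<bar>c b\<bar>)"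
      have s: "s > 0" using False by (simp add: s_def order_less_le sum_nonneg)
      define c' where "c' b = (if b \<in> B then c b / s else 0)" for b
      have sum1: "(\<Sum>b\<in>B. \<bar>c' b\<bar>) = 1"
        using s by (simp add: c'_def s_def[symmetric] sum_divide_distrib[symmetric])
      have "\<bar>c' b\<bar> \<le> 1" if "b \<in> B" for b
        using member_le_sum[of b B "\<lambda>b. \<bar>c' b\<bar>"] that B sum1 by simp
      then have "c' b \<in> (if b \<in> B then {-1..1} else {0})" for b
        by (cases "b \<in> B") (auto simp: abs_le_iff minus_le_iff, simp add: c'_def)
      then have "c' \<in> S" using sum1 by (simp add: S_def PiE_iff)
      then have "N c0 \<le> N c'" by (rule c0)
      also have "(\<Sum>b\<in>B. c' b *\<^sub>R b) = (1 / s) *\<^sub>R (\<Sum>b\<in>B. c b *\<^sub>R b)"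
        by (simp add: c'_def scaleR_sum_right)
      then have "N c' = (1 / s) * N c" using nrm_scaleR[OF X carr, of "1/s" c] s by (simp add: N_def)
      finally show ?thesis using s pos by (simp add: N_def s_def[symmetric] field_simps)
    qed
    then show ?thesis using pos by (intro exI[of _ "1 / N c0"]) auto
  qed
qed

text \<open>
  Coefficient families whose coordinates have the same integer parts after division by \<open>\<delta>\<close>
  are \<open>\<delta>\<close>-close, and there are only finitely many families of integer parts. Choosing one member
  for each keeps the net inside \<open>T\<close>.
\<close>

lemma finite_coordinate_net:
  fixes T :: "('b \<Rightarrow> real) set"
  assumes B: "finite B" and r: "\<And>c b. c \<in> T \<Longrightarrow> b \<in> B \<Longrightarrow> \<bar>c b\<bar> \<le> r" and \<delta>: "\<delta> > 0"
  shows "\<exists>L\<subseteq>T. finite L \<and> (\<forall>c\<in>T. \<exists>l\<in>L. \<forall>b\<in>B. \<bar>c b - l b\<bar> \<le> \<delta>)"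
proof -
  define F where "F c b = (if b \<in> B then \<lfloor>c b / \<delta>\<rfloor> else 0)" for c :: "'b \<Rightarrow> real" and b
  have "F ` T \<subseteq> {f. \<forall>b. (b \<in> B \<longrightarrow> f b \<in> {\<lfloor>- r / \<delta>\<rfloor>..\<lfloor>r / \<delta>\<rfloor>}) \<and> (b \<notin> B \<longrightarrow> f b = 0)}"
  proof (clarsimp simp: F_def)
    fix c b assume "c \<in> T" "b \<in> B"
    then have "- r \<le> c b" "c b \<le> r" using r[of c b] by auto
    then show "\<lfloor>- (r / \<delta>)\<rfloor> \<le> \<lfloor>c b / \<delta>\<rfloor> \<and> \<lfloor>c b / \<delta>\<rfloor> \<le> \<lfloor>r / \<delta>\<rfloor>"
      using \<delta> by (intro conjI floor_mono) (auto simp: field_simps)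
  qed
  then have "finite (F ` T)"
    by (rule finite_subset) (rule finite_set_of_finite_funs[OF B finite_atLeastAtMost_int])
  then have "\<exists>L\<subseteq>T. finite L \<and> F ` T = F ` L" by (rule finite_subset_image[OF _ subset_refl])
  then obtain L where L: "L \<subseteq> T" "finite L" "F ` T = F ` L" by blast
  have "\<exists>l\<in>L. \<forall>b\<in>B. \<bar>c b - l b\<bar> \<le> \<delta>" if "c \<in> T" for c
  proof -
    have "F c \<in> F ` L" using imageI[OF that, of F] L(3) by simp
    then obtain l where l: "l \<in> L" "F c = F l" by auto
    have "\<bar>c b - l b\<bar> \<le> \<delta>" if "b \<in> B" for b
    proof -
      have "\<lfloor>c b / \<delta>\<rfloor> = \<lfloor>l b / \<delta>\<rfloor>" using fun_cong[OF l(2), of b] that by (simp add: F_def)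
      then have "\<bar>c b / \<delta> - l b / \<delta>\<bar> \<le> 1" by linarith
      then show ?thesis using \<delta> by (simp add: diff_divide_distrib[symmetric] abs_divide)
    qed
    then show ?thesis using l by blast
  qed
  then show ?thesis using L by blast
qed

section \<open>Nets in the pointwise weak* topology\<close>

lemma topspace_weak_star:
  assumes X: "normed_space X"
  shows "topspace (weak_star_topology X) = carr (dual_space X)"
proof -
  have "carr (dual_space X) \<in> {{\<phi> \<in> carr (dual_space X). \<phi> x \<in> U} | x U. x \<in> carr X \<and> open (U :: real set)}"
    using X by (auto intro!: exI[of _ 0] exI[of _ UNIV])
  then show ?thesis unfolding weak_star_topology_def topology_generated_by_topspace by auto
qed

lemma limitin_weak_star_iff:
  assumes X: "normed_space X"
  shows "limitin (weak_star_topology X) h l F \<longleftrightarrow>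
     l \<in> carr (dual_space X) \<and> eventually (\<lambda>i. h i \<in> carr (dual_space X)) F \<and>
     (\<forall>x\<in>carr X. ((\<lambda>i. h i x) \<longlongrightarrow> l x) F)"
proof -
  let ?D = "carr (dual_space X)"
  define S where "S = {{\<phi> \<in> ?D. \<phi> x \<in> U} | x U. x \<in> carr X \<and> open (U :: real set)}"
  have W: "weak_star_topology X = topology_generated_by S"
    by (simp add: weak_star_topology_def S_def)
  have D: "?D \<in> S" unfolding S_def using X by (auto intro!: exI[of _ 0] exI[of _ UNIV])
  note top = topspace_weak_star[OF X]
  show ?thesis
  proof (intro iffI conjI ballI)
    assume lim: "limitin (weak_star_topology X) h l F"
    then show l: "l \<in> ?D" using top by (auto simp: limitin_def)
    have opn: "openin (weak_star_topology X) U" if "U \<in> S" for U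
      unfolding W openin_topology_generated_by_iff using that by (rule generate_topology_on.Basis)
    show "eventually (\<lambda>i. h i \<in> ?D) F" using lim opn[OF D] l by (auto simp: limitin_def)
    fix x assume x: "x \<in> carr X"
    show "((\<lambda>i. h i x) \<longlongrightarrow> l x) F"
    proof (rule topological_tendstoI)
      fix U assume "open U" "l x \<in> U"
      then have "{\<phi> \<in> ?D. \<phi> x \<in> U} \<in> S" "l \<in> {\<phi> \<in> ?D. \<phi> x \<in> U}" using x l by (auto simp: S_def)
      then have "eventually (\<lambda>i. h i \<in> {\<phi> \<in> ?D. \<phi> x \<in> U}) F" using lim opn unfolding limitin_def by blast
      then show "eventually (\<lambda>i. h i x \<in> U) F" by (rule eventually_mono) auto
    qed
  next
    assume l: "l \<in> ?D \<and> eventually (\<lambda>i. h i \<in> ?D) F \<and> (\<forall>x\<in>carr X. ((\<lambda>i. h i x) \<longlongrightarrow> l x) F)"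
    have "eventually (\<lambda>i. h i \<in> U) F" if "generate_topology_on S U" "l \<in> U" for U
      using that
    proof induction
      case (Int a b)
      then show ?case by (auto intro: eventually_conj)
    next
      case (UN K)
      then obtain k where k: "k \<in> K" "l \<in> k" by auto
      with UN have "eventually (\<lambda>i. h i \<in> k) F" by auto
      then show ?case using k by (auto elim!: eventually_mono)
    next
      case (Basis s)
      then obtain x U where s: "s = {\<phi> \<in> ?D. \<phi> x \<in> U}" "x \<in> carr X" "open U" by (auto simp: S_def)
      then have "eventually (\<lambda>i. h i x \<in> U) F" using l Basis by (auto intro: topological_tendstoD)
      then show ?case using l unfolding s by (auto intro: eventually_conj)
    qed simp
    then show "limitin (weak_star_topology X) h l F"
      using l top unfolding limitin_def W openin_topology_generated_by_iff by auto
  qed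
qed

text \<open>
  The form in which nets are used: a net exists iff every basic neighbourhood of \<open>f\<close> meets \<open>L\<close>. The
  filter is generated by these intersections.
\<close>

lemma pointwise_weak_star_net_limit_iff:
  assumes X: "normed_space X" and L: "\<And>g x. g \<in> L \<Longrightarrow> g x \<in> carr X"
  shows "pointwise_weak_star_net_limit X L f \<longleftrightarrow> (\<forall>x. f x \<in> carr (bidual X)) \<and>
     (\<forall>E \<Phi> \<epsilon>. finite E \<longrightarrow> finite \<Phi> \<longrightarrow> \<Phi> \<subseteq> carr (dual_space X) \<longrightarrow> \<epsilon> > 0 \<longrightarrow>
        (\<exists>g\<in>L. \<forall>x\<in>E. \<forall>\<phi>\<in>\<Phi>. \<bar>\<phi> (g x) - f x \<phi>\<bar> < \<epsilon>))"
proof -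
  let ?D = "dual_space X"
  have "limitin (pointwise_weak_star X) (\<lambda>g x. canonical_embedding X (g x)) f F \<longleftrightarrow>
      (\<forall>x. f x \<in> carr (bidual X)) \<and> (\<forall>x. \<forall>\<phi>\<in>carr ?D. ((\<lambda>g. \<phi> (g x)) \<longlongrightarrow> f x \<phi>) F)"
    if F: "eventually (\<lambda>g. g \<in> L) F" for F
  proof -
    have "eventually (\<lambda>g. canonical_embedding X (g x) \<in> carr (bidual X)) F" for x
      using F by (rule eventually_mono) (auto intro: canonical_embedding_in_bidual[OF X] L)
    moreover have "eventually (\<lambda>g. (\<lambda>x. canonical_embedding X (g x)) \<in> UNIV \<rightarrow>\<^sub>E topspace (weak_star_topology (dual_space X))) F"
      using F by (rule eventually_mono)
        (auto simp: topspace_weak_star[OF normed_space_dual[OF X]] intro: canonical_embedding_in_bidual[OF X] L)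
    moreover have "((\<lambda>g. canonical_embedding X (g x) \<phi>) \<longlongrightarrow> f x \<phi>) F \<longleftrightarrow> ((\<lambda>g. \<phi> (g x)) \<longlongrightarrow> f x \<phi>) F"
      if "\<phi> \<in> carr ?D" for x \<phi> using that by (simp add: canonical_embedding_def)
    ultimately show ?thesis
      unfolding pointwise_weak_star_def limitin_componentwise
      by (auto simp: limitin_weak_star_iff[OF normed_space_dual[OF X]])
  qed
  then have lim: "pointwise_weak_star_net_limit X L f \<longleftrightarrow> (\<exists>F. F \<noteq> bot \<and> eventually (\<lambda>g. g \<in> L) F \<and>
      (\<forall>x. f x \<in> carr (bidual X)) \<and> (\<forall>x. \<forall>\<phi>\<in>carr ?D. ((\<lambda>g. \<phi> (g x)) \<longlongrightarrow> f x \<phi>) F))"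
    unfolding pointwise_weak_star_net_limit_def by blast
  show ?thesis
    unfolding lim
  proof (intro iffI conjI allI impI)
    assume "\<exists>F. F \<noteq> bot \<and> eventually (\<lambda>g. g \<in> L) F \<and>
      (\<forall>x. f x \<in> carr (bidual X)) \<and> (\<forall>x. \<forall>\<phi>\<in>carr ?D. ((\<lambda>g. \<phi> (g x)) \<longlongrightarrow> f x \<phi>) F)"
    then obtain F where F: "F \<noteq> bot" "eventually (\<lambda>g. g \<in> L) F" "\<And>x. f x \<in> carr (bidual X)"
      "\<And>x \<phi>. \<phi> \<in> carr ?D \<Longrightarrow> ((\<lambda>g. \<phi> (g x)) \<longlongrightarrow> f x \<phi>) F" by blast
    show "f x \<in> carr (bidual X)" for x by (rule F)
    fix E :: "'b set" and \<Phi> and \<epsilon> :: real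
    assume "finite E" "finite \<Phi>" "\<Phi> \<subseteq> carr ?D" "\<epsilon> > 0"
    then have "eventually (\<lambda>g. \<forall>x\<in>E. \<forall>\<phi>\<in>\<Phi>. \<bar>\<phi> (g x) - f x \<phi>\<bar> < \<epsilon>) F"
      using F(4) unfolding tendsto_iff dist_real_def by (intro eventually_ball_finite ballI) auto
    with F(2) have "eventually (\<lambda>g. g \<in> L \<and> (\<forall>x\<in>E. \<forall>\<phi>\<in>\<Phi>. \<bar>\<phi> (g x) - f x \<phi>\<bar> < \<epsilon>)) F"
      by (rule eventually_conj)
    then show "\<exists>g\<in>L. \<forall>x\<in>E. \<forall>\<phi>\<in>\<Phi>. \<bar>\<phi> (g x) - f x \<phi>\<bar> < \<epsilon>"
      using eventually_happens'[OF F(1)] by blast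
  next
    assume R: "(\<forall>x. f x \<in> carr (bidual X)) \<and>
     (\<forall>E \<Phi> \<epsilon>. finite E \<longrightarrow> finite \<Phi> \<longrightarrow> \<Phi> \<subseteq> carr (dual_space X) \<longrightarrow> \<epsilon> > 0 \<longrightarrow>
        (\<exists>g\<in>L. \<forall>x\<in>E. \<forall>\<phi>\<in>\<Phi>. \<bar>\<phi> (g x) - f x \<phi>\<bar> < \<epsilon>))"
    define K where "K = {(E :: 'b set, \<Phi>, \<epsilon> :: real). finite E \<and> finite \<Phi> \<and> \<Phi> \<subseteq> carr ?D \<and> \<epsilon> > 0}"
    define S where "S = (\<lambda>(E, \<Phi>, \<epsilon>). {g\<in>L. \<forall>x\<in>E. \<forall>\<phi>\<in>\<Phi>. \<bar>\<phi> (g x) - f x \<phi>\<bar> < \<epsilon>})"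
    define F where "F = (INF k\<in>K. principal (S k))"
    have K0: "({}, {}, 1) \<in> K" by (simp add: K_def)
    have ev: "eventually P F \<longleftrightarrow> (\<exists>k\<in>K. \<forall>g\<in>S k. P g)" for P
      unfolding F_def
    proof (subst eventually_INF_base)
      show "K \<noteq> {}" using K0 by auto
      fix a b assume "a \<in> K" "b \<in> K"
      then obtain E1 \<Phi>1 e1 E2 \<Phi>2 e2 where a: "a = (E1, \<Phi>1, e1)" "b = (E2, \<Phi>2, e2)"
        by (metis prod_cases3)
      have "(E1 \<union> E2, \<Phi>1 \<union> \<Phi>2, min e1 e2) \<in> K" using \<open>a \<in> K\<close> \<open>b \<in> K\<close> a by (auto simp: K_def)
      moreover have "S (E1 \<union> E2, \<Phi>1 \<union> \<Phi>2, min e1 e2) \<subseteq> S a \<inter> S b" by (auto simp: S_def a)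
      ultimately show "\<exists>x\<in>K. principal (S x) \<le> inf (principal (S a)) (principal (S b))"
        by (intro bexI[of _ "(E1 \<union> E2, \<Phi>1 \<union> \<Phi>2, min e1 e2)"]) auto
    qed (auto simp: eventually_principal)
    have "S k \<noteq> {}" if "k \<in> K" for k
    proof -
      obtain E \<Phi> \<epsilon> where k: "k = (E, \<Phi>, \<epsilon>)" by (metis prod_cases3)
      with that have "finite E" "finite \<Phi>" "\<Phi> \<subseteq> carr ?D" "\<epsilon> > 0" by (auto simp: K_def)
      with conjunct2[OF R] have "\<exists>g\<in>L. \<forall>x\<in>E. \<forall>\<phi>\<in>\<Phi>. \<bar>\<phi> (g x) - f x \<phi>\<bar> < \<epsilon>" by simp
      then show ?thesis by (auto simp: S_def k)
    qed
    then have "F \<noteq> bot" unfolding trivial_limit_def ev by blast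
    moreover have "eventually (\<lambda>g. g \<in> L) F" unfolding ev using K0 by (auto simp: S_def intro!: bexI[of _ "({}, {}, 1)"])
    moreover have "((\<lambda>g. \<phi> (g x)) \<longlongrightarrow> f x \<phi>) F" if "\<phi> \<in> carr ?D" for x \<phi>
      unfolding tendsto_iff dist_real_def ev
    proof (intro allI impI)
      fix e :: real assume "e > 0"
      then have "({x}, {\<phi>}, e) \<in> K" using that by (simp add: K_def)
      then show "\<exists>k\<in>K. \<forall>g\<in>S k. \<bar>\<phi> (g x) - f x \<phi>\<bar> < e" by (rule rev_bexI) (simp add: S_def)
    qed
    ultimately show "\<exists>F. F \<noteq> bot \<and> eventually (\<lambda>g. g \<in> L) F \<and>
      (\<forall>x. f x \<in> carr (bidual X)) \<and> (\<forall>x. \<forall>\<phi>\<in>carr ?D. ((\<lambda>g. \<phi> (g x)) \<longlongrightarrow> f x \<phi>) F)"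
      using R by (intro exI[of _ F]) simp
  qed
qed

section \<open>Local reflexivity for pairs\<close>

lemma dual_nrm_attained_approx:
  assumes X: "normed_space X" and \<phi>: "\<phi> \<in> carr (dual_space X)" and "e > 0"
  shows "\<exists>w\<in>carr X. nrm X w \<le> 1 \<and> nrm (dual_space X) \<phi> - e < \<phi> w"
proof -
  let ?S = "{\<bar>\<phi> x\<bar> | x. x \<in> carr X \<and> nrm X x \<le> 1}"
  have "nrm (dual_space X) \<phi> - e < Sup ?S" using \<open>e > 0\<close> by (simp add: nrm_dual)
  moreover have "?S \<noteq> {}" using X by (auto intro!: exI[of _ "0 :: 'a"])
  ultimately obtain r where "r \<in> ?S" "nrm (dual_space X) \<phi> - e < r" by (rule less_cSupE)
  then obtain x where x: "x \<in> carr X" "nrm X x \<le> 1" "nrm (dual_space X) \<phi> - e < \<bar>\<phi> x\<bar>" by auto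
  show ?thesis
  proof (cases "0 \<le> \<phi> x")
    case True
    then show ?thesis using x by auto
  next
    case False
    then show ?thesis using x linear_map_on_neg[OF dual_linear[OF \<phi>] x(1)]
      by (intro bexI[of _ "- x"]) (auto simp: nrm_neg X carr_neg)
  qed
qed

definition single :: "'i \<Rightarrow> 'v \<Rightarrow> 'i \<Rightarrow> 'v::zero" where
  "single i v = (\<lambda>j. if j = i then v else 0)"

lemma sum_single:
  fixes g :: "'i \<Rightarrow> 'v::comm_monoid_add"
  assumes "finite L" shows "(\<lambda>l. if l \<in> L then g l else 0) = (\<Sum>l\<in>L. single l (g l))"
  using assms by (auto simp: fun_eq_iff sum_fun_apply single_def)

lemma single_add: "single i (v + w) = single i v + single i w" for v w :: "'v::monoid_add"
  by (auto simp: single_def fun_eq_iff)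

lemma single_scaleR: "single i (c *\<^sub>R u) = c *\<^sub>R single i u" for u :: "'u::real_vector"
  by (auto simp: single_def fun_eq_iff)

text \<open>
  This reads off the components of a separating functional on a product space, with \<open>\<iota>\<close> the embedding
  of one factor.
\<close>

lemma dominated_functional_in_dual:
  assumes X: "normed_space X" and \<Psi>: "linear_map_on V \<Psi>" "\<And>v. v \<in> V \<Longrightarrow> \<Psi> v \<le> q v"
    and \<iota>: "\<And>x. x \<in> carr X \<Longrightarrow> \<iota> x \<in> V" "\<And>x y. \<iota> (x + y) = \<iota> x + \<iota> y" "\<And>c x. \<iota> (c *\<^sub>R x) = c *\<^sub>R \<iota> x"
    and q: "\<And>x. x \<in> carr X \<Longrightarrow> q (\<iota> x) \<le> nrm X x"
  shows "(\<lambda>x. if x \<in> carr X then \<Psi> (\<iota> x) else 0) \<in> carr (dual_space X)"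
proof (rule dualI[where K = 1])
  fix x assume x: "x \<in> carr X"
  have le: "\<Psi> (\<iota> y) \<le> nrm X y" if "y \<in> carr X" for y
    using \<Psi>(2)[OF \<iota>(1)[OF that]] q[OF that] by linarith
  have "- \<Psi> (\<iota> x) = \<Psi> (\<iota> (- x))"
    using linear_map_on_scaleR[OF \<Psi>(1) \<iota>(1)[OF x], of "- 1"] \<iota>(3)[of "- 1" x] by simp
  also have "\<dots> \<le> nrm X x" using le[OF carr_neg[OF X x]] by (simp add: nrm_neg[OF X x])
  finally show "\<bar>if x \<in> carr X then \<Psi> (\<iota> x) else 0\<bar> \<le> 1 * nrm X x"
    using le[OF x] x by (simp add: abs_le_iff)
qed (simp_all add: \<iota> carr_add carr_scaleR X linear_map_on_add[OF \<Psi>(1)] linear_map_on_scaleR[OF \<Psi>(1)])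

text \<open>
  A finite system of conditions on elements of biduals can be met approximately in the space
  itself: elements \<open>t i\<close> of \<open>(W i)\<^sup>\<bottom>\<^sup>\<bottom>\<close> are replaced by elements \<open>y i\<close> of \<open>W i\<close>, keeping
  finitely many norm bounds on linear combinations and the values at finitely many functionals.
  
  All admissible families \<open>y\<close> form a linear space. If none of them worked, a functional \<open>\<Psi>\<close> would
  separate the data \<open>(A y, R y)\<close> of these families from \<open>0\<close>, where \<open>A y\<close> are the combinations and \<open>R y\<close>
  the errors at functionals. It has components \<open>\<theta> l\<close>, with norms summing up to at most \<open>1\<close>, and \<open>\<beta> j\<close>. As
  it is bounded below on an affine space, it is constant there, which says that the functionals
  \<open>\<zeta> i = \<Sum>l. l i \<theta> l + \<Sum>\<phi>. \<beta> (i, \<phi>) \<phi>\<close> vanish on \<open>W i\<close>. Hence \<open>t i (\<zeta> i) = 0\<close>, and the sum of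
  these equations contradicts the norm bounds on the combinations of the \<open>t i\<close>.
\<close>

lemma local_reflexivity_finite:
  fixes X :: "'v::real_vector nspace" and W :: "'i \<Rightarrow> 'v set"
  assumes X: "normed_space X" and I: "finite I"
    and W: "\<And>i. i \<in> I \<Longrightarrow> subspace (W i)" "\<And>i. i \<in> I \<Longrightarrow> W i \<subseteq> carr X"
    and t: "\<And>i. i \<in> I \<Longrightarrow> t i \<in> biannihilator X (W i)"
    and L: "finite L" "\<And>l. l \<in> L \<Longrightarrow> nrm (bidual X) (\<Sum>i\<in>I. l i *\<^sub>R t i) \<le> 1"
    and \<Phi>: "finite \<Phi>" "\<Phi> \<subseteq> carr (dual_space X)" and \<epsilon>: "\<epsilon> > 0"
  shows "\<exists>y. (\<forall>i\<in>I. y i \<in> W i) \<and> (\<forall>l\<in>L. nrm X (\<Sum>i\<in>I. l i *\<^sub>R y i) < 1 + \<epsilon>) \<and>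
     (\<forall>i\<in>I. \<forall>\<phi>\<in>\<Phi>. \<bar>\<phi> (y i) - t i \<phi>\<bar> < \<epsilon>)"
proof (rule ccontr)
  assume contr: "\<not> ?thesis"
  let ?D = "dual_space X"
  note D = normed_space_dual[OF X] and DD = normed_space_dual[OF normed_space_dual[OF X]]
  define M where "M = (1 + \<epsilon>) / \<epsilon>"
  have M: "M > 0" using \<epsilon> by (simp add: M_def)
  define J where "J = I \<times> \<Phi>"
  have J: "finite J" using I \<Phi> by (simp add: J_def)
  define V where "V = {(v :: ('i \<Rightarrow> real) \<Rightarrow> 'v, r :: 'i \<times> ('v \<Rightarrow> real) \<Rightarrow> real). \<forall>l\<in>L. v l \<in> carr X}"
  define mx where "mx v = Max (insert 0 ((\<lambda>l. nrm X (v l)) ` L))" for v :: "('i \<Rightarrow> real) \<Rightarrow> 'v"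
  define q where "q = (\<lambda>(v, r). mx v + M * (\<Sum>j\<in>J. \<bar>r j\<bar>))"
  have mx_le: "mx v \<le> K \<longleftrightarrow> 0 \<le> K \<and> (\<forall>l\<in>L. nrm X (v l) \<le> K)" for v K
    unfolding mx_def using L(1) by (subst Max_le_iff) auto
  have le_mx: "l \<in> L \<Longrightarrow> nrm X (v l) \<le> mx v" and mx0: "0 \<le> mx v" for v l
    using mx_le[of v "mx v"] by auto
  have V: "subspace V"
    unfolding V_def by (rule subspaceI) (auto intro!: carr_intros X simp: zero_prod_def)
  have q: "sublinear_on V q"
    unfolding sublinear_on_def
  proof (intro conjI ballI allI impI)
    fix a b assume "a \<in> V" "b \<in> V"
    then obtain v r w s where ab: "a = (v, r)" "b = (w, s)" "\<And>l. l \<in> L \<Longrightarrow> v l \<in> carr X" "\<And>l. l \<in> L \<Longrightarrow> w l \<in> carr X"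
      by (auto simp: V_def)
    have "nrm X (v l + w l) \<le> mx v + mx w" if "l \<in> L" for l
      using nrm_add_le[OF X ab(3)[OF that] ab(4)[OF that]] le_mx[OF that, of v] le_mx[OF that, of w] by linarith
    then have "mx (v + w) \<le> mx v + mx w" using mx0 by (simp add: mx_le)
    moreover have "(\<Sum>j\<in>J. \<bar>r j + s j\<bar>) \<le> (\<Sum>j\<in>J. \<bar>r j\<bar>) + (\<Sum>j\<in>J. \<bar>s j\<bar>)"
      by (simp add: sum.distrib[symmetric] sum_mono)
    then have "M * (\<Sum>j\<in>J. \<bar>r j + s j\<bar>) \<le> M * ((\<Sum>j\<in>J. \<bar>r j\<bar>) + (\<Sum>j\<in>J. \<bar>s j\<bar>))"
      using M by (intro mult_left_mono) auto
    ultimately show "q (a + b) \<le> q a + q b" by (simp add: q_def ab algebra_simps)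
  next
    fix c :: real and a assume c: "0 \<le> c" and "a \<in> V"
    then obtain v r where a: "a = (v, r)" "\<And>l. l \<in> L \<Longrightarrow> v l \<in> carr X" by (auto simp: V_def)
    have "mx (c *\<^sub>R v) \<le> c * mx v"
      using c mx0 le_mx by (auto simp: mx_le nrm_scaleR[OF X a(2)] intro: mult_left_mono)
    then show "q (c *\<^sub>R a) \<le> c * q a"
      using c by (simp add: q_def a abs_mult sum_distrib_left[symmetric] algebra_simps)
  qed
  define A where "A y = (\<lambda>l. if l \<in> L then \<Sum>i\<in>I. l i *\<^sub>R y i else 0)" for y :: "'i \<Rightarrow> 'v"
  define R where "R y = (\<lambda>j. if j \<in> J then snd j (y (fst j)) - t (fst j) (snd j) else 0)" for y
  define Y where "Y = {y. \<forall>i\<in>I. y i \<in> W i}"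
  define C where "C = (\<lambda>y. (A y, R y)) ` Y"
  have Ycarr: "y i \<in> carr X" if "y \<in> Y" "i \<in> I" for y i using that W by (auto simp: Y_def)
  have "(\<lambda>_. 0) \<in> Y" using W by (auto simp: Y_def subspace_0)
  then have C0: "C \<noteq> {}" by (auto simp: C_def)
  have CV: "C \<subseteq> V" using Ycarr by (auto simp: C_def V_def A_def intro!: carr_intros X)
  have Jdual: "snd j \<in> carr ?D" "fst j \<in> I" if "j \<in> J" for j using that \<Phi> by (auto simp: J_def)
  have Cconv: "convex C"
  proof (rule convexI)
    fix a b and u v :: real
    assume "a \<in> C" "b \<in> C" and uv: "0 \<le> u" "0 \<le> v" "u + v = 1"
    then obtain y z where yz: "y \<in> Y" "z \<in> Y" "a = (A y, R y)" "b = (A z, R z)" by (auto simp: C_def)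
    define w where "w i = u *\<^sub>R y i + v *\<^sub>R z i" for i
    have "w \<in> Y" using yz W by (auto simp: Y_def w_def intro!: subspace_add subspace_scale)
    moreover have "A w = u *\<^sub>R A y + v *\<^sub>R A z"
      by (auto simp: A_def w_def fun_eq_iff scaleR_add_right sum.distrib scaleR_sum_right mult.commute)
    moreover have "R w j = u * R y j + v * R z j" for j
    proof (cases "j \<in> J")
      case True
      note j = Jdual[OF True]
      have "snd j (w (fst j)) = u * snd j (y (fst j)) + v * snd j (z (fst j))"
        unfolding w_def using Ycarr[OF yz(1) j(2)] Ycarr[OF yz(2) j(2)]
        by (simp add: linear_map_on_add[OF dual_linear[OF j(1)]] linear_map_on_scaleR[OF dual_linear[OF j(1)]] carr_scaleR X)
      moreover have "t (fst j) (snd j) = u * t (fst j) (snd j) + v * t (fst j) (snd j)"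
        using uv by (metis distrib_right mult_1)
      ultimately show ?thesis using True by (simp add: R_def algebra_simps)
    qed (simp add: R_def)
    then have "R w = u *\<^sub>R R y + v *\<^sub>R R z" by (simp add: fun_eq_iff)
    ultimately show "u *\<^sub>R a + v *\<^sub>R b \<in> C" unfolding C_def yz by (auto intro!: image_eqI[of _ _ w])
  qed
  have qC: "1 + \<epsilon> \<le> q c" if "c \<in> C" for c
  proof (rule ccontr)
    assume small: "\<not> 1 + \<epsilon> \<le> q c"
    obtain y where y: "y \<in> Y" "c = (A y, R y)" using \<open>c \<in> C\<close> by (auto simp: C_def)
    have sm: "mx (A y) + M * (\<Sum>j\<in>J. \<bar>R y j\<bar>) < 1 + \<epsilon>" using small by (simp add: q_def y)
    have Rn: "0 \<le> M * (\<Sum>j\<in>J. \<bar>R y j\<bar>)" using M by (simp add: sum_nonneg)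
    have "nrm X (\<Sum>i\<in>I. l i *\<^sub>R y i) < 1 + \<epsilon>" if "l \<in> L" for l
      using le_mx[OF that, of "A y"] sm Rn that by (simp add: A_def)
    moreover have "\<bar>\<phi> (y i) - t i \<phi>\<bar> < \<epsilon>" if "i \<in> I" "\<phi> \<in> \<Phi>" for i \<phi>
    proof -
      have "(i, \<phi>) \<in> J" using that by (simp add: J_def)
      then have "\<bar>R y (i, \<phi>)\<bar> \<le> (\<Sum>j\<in>J. \<bar>R y j\<bar>)" using member_le_sum[of "(i,\<phi>)" J "\<lambda>j. \<bar>R y j\<bar>"] J by simp
      then have "M * \<bar>R y (i, \<phi>)\<bar> \<le> M * (\<Sum>j\<in>J. \<bar>R y j\<bar>)" using M by (intro mult_left_mono) auto
      also have "\<dots> < 1 + \<epsilon>" using sm mx0[of "A y"] by linarith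
      also have "1 + \<epsilon> = M * \<epsilon>" using \<epsilon> by (simp add: M_def)
      finally have "\<bar>R y (i, \<phi>)\<bar> < \<epsilon>" using M by simp
      then show ?thesis using \<open>(i, \<phi>) \<in> J\<close> by (simp add: R_def)
    qed
    ultimately show False using contr y(1) unfolding Y_def by blast
  qed
  obtain \<Psi> where \<Psi>: "linear_map_on V \<Psi>" "\<And>x. x \<in> V \<Longrightarrow> \<Psi> x \<le> q x" "\<And>c. c \<in> C \<Longrightarrow> 1 + \<epsilon> \<le> \<Psi> c"
    using linear_separation[OF V q CV C0 Cconv qC] by blast
  define \<theta> where "\<theta> l w = (if w \<in> carr X then \<Psi> (single l w, 0) else 0)" for l w
  define \<beta> where "\<beta> j = \<Psi> (0, single j 1)" for j
  have sV: "(single l w, 0) \<in> V" if "w \<in> carr X" for l w using that X by (simp add: V_def single_def)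
  have \<theta>: "\<theta> l \<in> carr ?D" if l: "l \<in> L" for l
    unfolding \<theta>_def
  proof (rule dominated_functional_in_dual[OF X \<Psi>(1,2)])
    show "q (single l w, 0) \<le> nrm X w" if "w \<in> carr X" for w
      using that by (simp add: q_def mx_le single_def nrm_nonneg X)
  qed (simp_all add: sV single_add single_scaleR)
  have \<Psi>1: "\<Psi> (\<lambda>l. if l \<in> L then g l else 0, 0) = (\<Sum>l\<in>L. \<theta> l (g l))" if g: "\<And>l. l \<in> L \<Longrightarrow> g l \<in> carr X" for g
  proof -
    have "(\<lambda>l. if l \<in> L then g l else 0, (0 :: 'i \<times> ('v \<Rightarrow> real) \<Rightarrow> real)) = (\<Sum>l\<in>L. (single l (g l), 0))"
      by (simp add: sum_single[OF L(1)] sum_prod)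
    then show ?thesis using g by (simp add: linear_map_on_sum[OF V \<Psi>(1)] sV \<theta>_def)
  qed
  have \<Psi>2: "\<Psi> (0, \<lambda>j. if j \<in> J then r j else 0) = (\<Sum>j\<in>J. r j * \<beta> j)" for r
  proof -
    have "(0 :: ('i \<Rightarrow> real) \<Rightarrow> 'v, \<lambda>j. if j \<in> J then r j else 0) = (\<Sum>j\<in>J. r j *\<^sub>R (0, single j 1))"
      using sum_single[OF J, of r] by (simp add: sum_prod single_def fun_eq_iff sum_fun_apply if_distrib cong: if_cong)
    moreover have "(0, single j 1) \<in> V" for j using X by (simp add: V_def)
    ultimately show ?thesis
      using linear_map_on_sum_scaleR[OF V \<Psi>(1), of J "\<lambda>j. (0, single j 1)" r]
      by (simp only: \<beta>_def real_scaleR_def)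
  qed
  define \<zeta> where "\<zeta> i = (\<Sum>l\<in>L. l i *\<^sub>R \<theta> l) + (\<Sum>\<phi>\<in>\<Phi>. \<beta> (i, \<phi>) *\<^sub>R \<phi>)" for i
  define \<gamma> where "\<gamma> = (\<Sum>i\<in>I. \<Sum>\<phi>\<in>\<Phi>. \<beta> (i, \<phi>) * t i \<phi>)"
  have \<zeta>: "\<zeta> i \<in> carr ?D" for i
    unfolding \<zeta>_def using \<theta> \<Phi> by (intro carr_intros D) auto
  have \<Psi>C: "\<Psi> (A y, R y) = (\<Sum>i\<in>I. \<zeta> i (y i)) - \<gamma>" if y: "y \<in> Y" for y
  proof -
    have "(A y, R y) = (A y, 0) + (0, R y)" by simp
    moreover have "(A y, 0) \<in> V" "(0, R y) \<in> V" using CV y X by (auto simp: C_def V_def)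
    ultimately have "\<Psi> (A y, R y) = \<Psi> (A y, 0) + \<Psi> (0, R y)" using linear_map_on_add[OF \<Psi>(1)] by metis
    also have "\<Psi> (A y, 0) = (\<Sum>l\<in>L. \<theta> l (\<Sum>i\<in>I. l i *\<^sub>R y i))"
      unfolding A_def using y Ycarr by (intro \<Psi>1 carr_intros X)
    also have "\<dots> = (\<Sum>l\<in>L. \<Sum>i\<in>I. l i * \<theta> l (y i))"
      using Ycarr[OF y] by (intro sum.cong refl) (simp add: linear_map_on_sum_scaleR[OF normed_space_subspace[OF X] dual_linear[OF \<theta>]])
    also have "\<dots> = (\<Sum>i\<in>I. \<Sum>l\<in>L. l i * \<theta> l (y i))" by (rule sum.swap)
    also have "\<Psi> (0, R y) = (\<Sum>i\<in>I. \<Sum>\<phi>\<in>\<Phi>. \<beta> (i, \<phi>) * \<phi> (y i)) - \<gamma>"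
      unfolding R_def \<Psi>2
      by (simp add: J_def \<gamma>_def sum.cartesian_product case_prod_unfold sum_subtractf algebra_simps)
    finally show ?thesis
      by (simp add: \<zeta>_def sum_fun_apply sum.distrib)
  qed
  have \<zeta>W: "\<zeta> i w = 0" if i: "i \<in> I" and w: "w \<in> W i" for i w
  proof (rule ccontr)
    assume nz: "\<zeta> i w \<noteq> 0"
    \<comment> \<open>the multiple of \<open>w\<close> at which the separating functional would take the value \<open>0\<close>\<close>
    define s where "s = \<gamma> / \<zeta> i w"
    have wX: "w \<in> carr X" using W i w by auto
    have y: "single i (s *\<^sub>R w) \<in> Y" using i w W by (auto simp: Y_def single_def subspace_0 subspace_scale)
    have "\<zeta> k (single i (s *\<^sub>R w) k) = (if k = i then s * \<zeta> i w else 0)" for k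
      using linear_map_on_scaleR[OF dual_linear[OF \<zeta>] wX] linear_map_on_0[OF normed_space_subspace[OF X] dual_linear[OF \<zeta>]]
      by (simp add: single_def)
    then have "(\<Sum>k\<in>I. \<zeta> k (single i (s *\<^sub>R w) k)) = s * \<zeta> i w" using I i by simp
    then have "\<Psi> (A (single i (s *\<^sub>R w)), R (single i (s *\<^sub>R w))) = 0"
      using \<Psi>C[OF y] nz by (simp add: s_def)
    moreover have "1 + \<epsilon> \<le> \<Psi> (A (single i (s *\<^sub>R w)), R (single i (s *\<^sub>R w)))"
      using y by (intro \<Psi>(3)) (auto simp: C_def)
    ultimately show False using \<epsilon> by simp
  qed
  have "1 + \<epsilon> \<le> - \<gamma>"
  proof -
    have "(\<lambda>_. 0) \<in> Y" by fact
    then have "1 + \<epsilon> \<le> \<Psi> (A (\<lambda>_. 0), R (\<lambda>_. 0))" by (intro \<Psi>(3)) (auto simp: C_def)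
    also have "\<dots> = - \<gamma>" using \<Psi>C[OF \<open>(\<lambda>_. 0) \<in> Y\<close>]
      linear_map_on_0[OF normed_space_subspace[OF X] dual_linear[OF \<zeta>]] by simp
    finally show ?thesis .
  qed
  also have "- \<gamma> = (\<Sum>l\<in>L. (\<Sum>i\<in>I. l i *\<^sub>R t i) (\<theta> l))"
  proof -
    have t\<zeta>: "(\<Sum>l\<in>L. l i * t i (\<theta> l)) + (\<Sum>\<phi>\<in>\<Phi>. \<beta> (i, \<phi>) * t i \<phi>) = 0" if i: "i \<in> I" for i
    proof -
      have ti: "t i \<in> carr (bidual X)" "\<And>\<psi>. \<psi> \<in> annihilator X (W i) \<Longrightarrow> t i \<psi> = 0"
        using t[OF i] by (auto simp: annihilator_def)
      note lin = dual_linear[OF ti(1)]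
      have "t i (\<zeta> i) = 0" using \<zeta> \<zeta>W i by (intro ti) (auto simp: annihilator_def)
      moreover have "t i (\<zeta> i) = t i (\<Sum>l\<in>L. l i *\<^sub>R \<theta> l) + t i (\<Sum>\<phi>\<in>\<Phi>. \<beta> (i, \<phi>) *\<^sub>R \<phi>)"
        unfolding \<zeta>_def using \<theta> \<Phi> by (intro linear_map_on_add[OF lin] carr_intros D) auto
      moreover have "t i (\<Sum>l\<in>L. l i *\<^sub>R \<theta> l) = (\<Sum>l\<in>L. l i * t i (\<theta> l))"
        using \<theta> by (simp add: linear_map_on_sum_scaleR[OF normed_space_subspace[OF D] lin])
      moreover have "t i (\<Sum>\<phi>\<in>\<Phi>. \<beta> (i, \<phi>) *\<^sub>R \<phi>) = (\<Sum>\<phi>\<in>\<Phi>. \<beta> (i, \<phi>) * t i \<phi>)"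
        using \<Phi> by (subst linear_map_on_sum_scaleR[OF normed_space_subspace[OF D] lin]) auto
      ultimately show ?thesis by simp
    qed
    have "(\<Sum>i\<in>I. (\<Sum>l\<in>L. l i * t i (\<theta> l)) + (\<Sum>\<phi>\<in>\<Phi>. \<beta> (i, \<phi>) * t i \<phi>)) = 0"
      using t\<zeta> by simp
    then have "- \<gamma> = (\<Sum>i\<in>I. \<Sum>l\<in>L. l i * t i (\<theta> l))" by (simp add: sum.distrib \<gamma>_def)
    also have "\<dots> = (\<Sum>l\<in>L. \<Sum>i\<in>I. l i * t i (\<theta> l))" by (rule sum.swap)
    finally show ?thesis by (simp add: sum_fun_apply)
  qed
  also have "\<dots> \<le> (\<Sum>l\<in>L. nrm ?D (\<theta> l))"
  proof (rule sum_mono)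
    fix l assume l: "l \<in> L"
    have "(\<Sum>i\<in>I. l i *\<^sub>R t i) \<in> carr (bidual X)"
      using t by (intro carr_intros DD) (auto simp: annihilator_def)
    then have "(\<Sum>i\<in>I. l i *\<^sub>R t i) (\<theta> l) \<le> nrm (bidual X) (\<Sum>i\<in>I. l i *\<^sub>R t i) * nrm ?D (\<theta> l)"
      using dual_apply_le[OF D _ \<theta>[OF l]] by (meson abs_le_D1)
    also have "\<dots> \<le> 1 * nrm ?D (\<theta> l)" using L(2)[OF l] by (intro mult_right_mono nrm_nonneg[OF D] \<theta> l)
    finally show "(\<Sum>i\<in>I. l i *\<^sub>R t i) (\<theta> l) \<le> nrm ?D (\<theta> l)" by simp
  qed
  also have "\<dots> < 1 + \<epsilon>"
  proof -
    define e where "e = \<epsilon> / (real (card L) + 1)"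
    have e: "e > 0" using \<epsilon> by (simp add: e_def add_nonneg_pos)
    have "\<exists>w. \<forall>l\<in>L. w l \<in> carr X \<and> nrm X (w l) \<le> 1 \<and> nrm ?D (\<theta> l) - e < \<theta> l (w l)"
      using dual_nrm_attained_approx[OF X \<theta> e] by (intro bchoice) blast
    then obtain w where w: "\<And>l. l \<in> L \<Longrightarrow> w l \<in> carr X" "\<And>l. l \<in> L \<Longrightarrow> nrm X (w l) \<le> 1"
      "\<And>l. l \<in> L \<Longrightarrow> nrm ?D (\<theta> l) - e < \<theta> l (w l)" by blast
    have "(\<Sum>l\<in>L. nrm ?D (\<theta> l)) \<le> (\<Sum>l\<in>L. \<theta> l (w l) + e)"
      using w(3) by (intro sum_mono) (simp add: less_imp_le algebra_simps)
    also have "\<dots> = (\<Sum>l\<in>L. \<theta> l (w l)) + real (card L) * e" by (simp add: sum.distrib)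
    also have "(\<Sum>l\<in>L. \<theta> l (w l)) = \<Psi> (\<lambda>l. if l \<in> L then w l else 0, 0)" using w by (simp add: \<Psi>1)
    also have "\<dots> \<le> q (\<lambda>l. if l \<in> L then w l else 0, 0)" using w by (intro \<Psi>(2)) (simp add: V_def)
    also have "\<dots> \<le> 1" using w by (simp add: q_def mx_le)
    also have "real (card L) * e < \<epsilon>" using \<epsilon> by (simp add: e_def field_simps)
    finally show ?thesis by simp
  qed
  finally show False by simp
qed

lemma biannihilator_carr: "carr (bidual X) \<subseteq> biannihilator X (carr X)" if X: "normed_space X"
proof
  fix t assume t: "t \<in> carr (bidual X)"
  have "\<phi> = 0" if "\<phi> \<in> annihilator X (carr X)" for \<phi>
  proof
    fix x show "\<phi> x = 0 x" using that dual_outside[of \<phi> X x] by (cases "x \<in> carr X") (auto simp: annihilator_def)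
  qed
  moreover have "t 0 = 0"
    using linear_map_on_0[OF normed_space_subspace[OF normed_space_dual[OF X]] dual_linear[OF t]] .
  ultimately show "t \<in> biannihilator X (carr X)" using t unfolding annihilator_def[of "dual_space X"] by blast
qed

text \<open>
  The finite form is applied to the images of a basis of a finite-dimensional space. Finitely many norm
  bounds suffice: those for a net of the unit ball, and those for the normalised basis vectors, which
  control the error made in passing from a point of the ball to the nearest point of the net.
\<close>

lemma local_reflexivity_map:
  fixes X :: "'v::real_vector nspace" and Y :: "'y::real_vector nspace"
  assumes X: "normed_space X" and Y: "normed_space Y" and W: "subspace W" "W \<subseteq> carr X"
    and B: "finite B" "independent B" "B \<subseteq> carr Y"
    and T: "linear_map_on (carr Y) T" "\<And>z. z \<in> carr Y \<Longrightarrow> T z \<in> carr (bidual X)"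
      "\<And>z. z \<in> carr Y \<Longrightarrow> nrm (bidual X) (T z) \<le> nrm Y z"
    and TW: "\<And>b. b \<in> B' \<Longrightarrow> T b \<in> biannihilator X W"
    and \<Phi>: "finite \<Phi>" "\<Phi> \<subseteq> carr (dual_space X)" and \<epsilon>: "\<epsilon> > 0"
  shows "\<exists>y. (\<forall>b\<in>B. y b \<in> carr X) \<and> (\<forall>b\<in>B \<inter> B'. y b \<in> W) \<and>
     (\<forall>c. nrm X (\<Sum>b\<in>B. c b *\<^sub>R y b) \<le> (1 + \<epsilon>) * nrm Y (\<Sum>b\<in>B. c b *\<^sub>R b)) \<and>
     (\<forall>b\<in>B. \<forall>\<phi>\<in>\<Phi>. \<bar>\<phi> (y b) - T b \<phi>\<bar> < \<epsilon>)"
proof -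
  define \<epsilon>2 where "\<epsilon>2 = min 1 (\<epsilon> / 2)"
  have e2: "\<epsilon>2 > 0" "\<epsilon>2 \<le> 1" "2 * \<epsilon>2 \<le> \<epsilon>" using \<epsilon> by (auto simp: \<epsilon>2_def)
  have posB: "nrm Y b > 0" if "b \<in> B" for b
  proof -
    have "b \<noteq> 0" using that B(2) dependent_zero by blast
    then show ?thesis using that B(3) nrm_nonneg[OF Y, of b] nrm_eq_0_iff[OF Y, of b] by fastforce
  qed
  define comb where "comb c = (\<Sum>b\<in>B. c b *\<^sub>R b)" for c :: "'y \<Rightarrow> real"
  have comb: "comb c \<in> carr Y" for c unfolding comb_def using B by (intro carr_intros Y) auto
  obtain C where C: "C \<ge> 0" "\<And>c. (\<Sum>b\<in>B. \<bar>c b\<bar>) \<le> C * nrm Y (comb c)"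
    using finite_dim_coordinates_bounded[OF Y B] unfolding comb_def by blast
  define U where "U = {c. nrm Y (comb c) \<le> 1}"
  define s where "s = (\<Sum>b\<in>B. nrm Y b)"
  have s: "s \<ge> 0" unfolding s_def using B nrm_nonneg[OF Y] by (intro sum_nonneg) auto
  define \<delta> where "\<delta> = \<epsilon>2 / (2 * s + 1)"
  have \<delta>: "\<delta> > 0" using s e2 by (simp add: \<delta>_def)
  have bound: "\<bar>c b\<bar> \<le> C" if "c \<in> U" "b \<in> B" for c b
  proof -
    have "\<bar>c b\<bar> \<le> (\<Sum>b\<in>B. \<bar>c b\<bar>)" using that B(1) by (intro member_le_sum) auto
    also have "\<dots> \<le> C * nrm Y (comb c)" by (rule C)
    also have "\<dots> \<le> C * 1" using that C(1) by (intro mult_left_mono) (auto simp: U_def)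
    finally show ?thesis by simp
  qed
  obtain L0 where L0: "L0 \<subseteq> U" "finite L0" "\<And>c. c \<in> U \<Longrightarrow> \<exists>l\<in>L0. \<forall>b\<in>B. \<bar>c b - l b\<bar> \<le> \<delta>"
  proof -
    have "\<exists>L\<subseteq>U. finite L \<and> (\<forall>c\<in>U. \<exists>l\<in>L. \<forall>b\<in>B. \<bar>c b - l b\<bar> \<le> \<delta>)"
      using bound by (intro finite_coordinate_net[of B U C] B(1) \<delta>)
    then show ?thesis using that by blast
  qed
  define unit where "unit b = single b (1 / nrm Y b)" for b
  have unit_sum: "(\<Sum>b'\<in>B. unit b b' *\<^sub>R z b') = (1 / nrm Y b) *\<^sub>R z b" if "b \<in> B" for b and z :: "'y \<Rightarrow> 'z::real_vector"
  proof -
    have "(\<Sum>b'\<in>B. unit b b' *\<^sub>R z b') = (\<Sum>b'\<in>B. if b' = b then (1 / nrm Y b) *\<^sub>R z b else 0)"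
      by (intro sum.cong) (auto simp: unit_def single_def)
    then show ?thesis using that B(1) by simp
  qed
  have unitU: "unit b \<in> U" if "b \<in> B" for b
    using unit_sum[OF that, of "\<lambda>b. b"] that posB[OF that] B(3)
    by (auto simp: U_def comb_def nrm_scaleR Y subset_iff)
  define L where "L = L0 \<union> unit ` B"
  have LU: "L \<subseteq> U" using L0 unitU by (auto simp: L_def)
  have "\<exists>y. (\<forall>b\<in>B. y b \<in> (if b \<in> B' then W else carr X)) \<and> (\<forall>l\<in>L. nrm X (\<Sum>b\<in>B. l b *\<^sub>R y b) < 1 + \<epsilon>2) \<and>
     (\<forall>b\<in>B. \<forall>\<phi>\<in>\<Phi>. \<bar>\<phi> (y b) - T b \<phi>\<bar> < \<epsilon>2)"
  proof (rule local_reflexivity_finite[OF X B(1) _ _ _ _ _ \<Phi> e2(1)])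
    fix b assume b: "b \<in> B"
    show "subspace (if b \<in> B' then W else carr X)" using W normed_space_subspace[OF X] by simp
    show "(if b \<in> B' then W else carr X) \<subseteq> carr X" using W by simp
    show "T b \<in> biannihilator X (if b \<in> B' then W else carr X)"
      using TW[of b] T(2)[of b] biannihilator_carr[OF X] b B(3) by auto
  next
    show "finite L" using L0 B by (simp add: L_def)
    fix l assume "l \<in> L"
    have "(\<Sum>b\<in>B. l b *\<^sub>R T b) = T (comb l)"
      unfolding comb_def using B(3) by (subst linear_map_on_sum_scaleR[OF normed_space_subspace[OF Y] T(1)]) auto
    then show "nrm (bidual X) (\<Sum>b\<in>B. l b *\<^sub>R T b) \<le> 1"
      using T(3)[OF comb, of l] \<open>l \<in> L\<close> LU by (auto simp: U_def)
  qed
  then obtain y where y: "\<And>b. b \<in> B \<Longrightarrow> y b \<in> (if b \<in> B' then W else carr X)"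
    "\<And>l. l \<in> L \<Longrightarrow> nrm X (\<Sum>b\<in>B. l b *\<^sub>R y b) < 1 + \<epsilon>2"
    "\<And>b \<phi>. b \<in> B \<Longrightarrow> \<phi> \<in> \<Phi> \<Longrightarrow> \<bar>\<phi> (y b) - T b \<phi>\<bar> < \<epsilon>2" by blast
  have yX: "y b \<in> carr X" if "b \<in> B" for b using y(1)[OF that] W by (auto split: if_splits)
  define R where "R c = (\<Sum>b\<in>B. c b *\<^sub>R y b)" for c
  have RX: "R c \<in> carr X" for c unfolding R_def using yX by (intro carr_intros X)
  have yb: "nrm X (y b) \<le> 2 * nrm Y b" if b: "b \<in> B" for b
  proof -
    have "unit b \<in> L" using b by (auto simp: L_def)
    then have "nrm X ((1 / nrm Y b) *\<^sub>R y b) < 1 + \<epsilon>2" using y(2) unit_sum[OF b] by metis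
    then have "nrm X (y b) / nrm Y b < 2" using posB[OF b] e2 by (simp add: nrm_scaleR X yX b)
    then show ?thesis using posB[OF b] by (simp add: field_simps)
  qed
  have RU: "nrm X (R c) \<le> 1 + \<epsilon>" if c: "c \<in> U" for c
  proof -
    obtain l where l: "l \<in> L0" "\<And>b. b \<in> B \<Longrightarrow> \<bar>c b - l b\<bar> \<le> \<delta>" using L0(3)[OF c] by blast
    have "R c = R l + (\<Sum>b\<in>B. (c b - l b) *\<^sub>R y b)"
      by (simp add: R_def scaleR_diff_left sum_subtractf)
    then have "nrm X (R c) \<le> nrm X (R l) + nrm X (\<Sum>b\<in>B. (c b - l b) *\<^sub>R y b)"
      using nrm_add_le[OF X RX[of l], of "\<Sum>b\<in>B. (c b - l b) *\<^sub>R y b"] yX by (simp add: carr_intros X)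
    also have "nrm X (\<Sum>b\<in>B. (c b - l b) *\<^sub>R y b) \<le> (\<Sum>b\<in>B. \<bar>c b - l b\<bar> * nrm X (y b))"
      using yX by (rule nrm_sum_scaleR_le[OF X])
    also have "\<dots> \<le> (\<Sum>b\<in>B. \<delta> * (2 * nrm Y b))"
      using l yb yX nrm_nonneg[OF X] \<delta> by (intro sum_mono mult_mono) auto
    also have "\<dots> = \<delta> * (2 * s)" by (simp add: s_def sum_distrib_left)
    also have "\<dots> \<le> \<epsilon>2" using s e2 by (simp add: \<delta>_def field_simps)
    also have "nrm X (R l) < 1 + \<epsilon>2" using y(2)[of l] l by (simp add: L_def R_def)
    finally show ?thesis using e2 by simp
  qed
  have "nrm X (R c) \<le> (1 + \<epsilon>) * nrm Y (comb c)" for c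
  proof (cases "comb c = 0")
    case True
    then have "(\<Sum>b\<in>B. \<bar>c b\<bar>) \<le> 0" using C(2)[of c] Y by simp
    then have "\<forall>b\<in>B. c b = 0" using B(1) by (metis (no_types, lifting) abs_ge_zero abs_le_zero_iff order_antisym sum_nonneg sum_nonneg_eq_0_iff)
    then have "R c = 0" by (simp add: R_def)
    then show ?thesis using True X Y by simp
  next
    case False
    define n where "n = nrm Y (comb c)"
    have n: "n > 0" using False nrm_nonneg[OF Y comb, of c] nrm_eq_0_iff[OF Y comb, of c] by (simp add: n_def)
    define d where "d b = (1 / n) * c b" for b
    have "comb d = (1 / n) *\<^sub>R comb c" by (simp add: comb_def d_def scaleR_sum_right)
    then have "nrm Y (comb d) = 1" using n nrm_scaleR[OF Y comb, of "1 / n" c] by (simp add: n_def[symmetric])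
    then have "nrm X (R d) \<le> 1 + \<epsilon>" by (intro RU) (simp add: U_def)
    moreover have "R d = (1 / n) *\<^sub>R R c" by (simp add: R_def d_def scaleR_sum_right)
    then have "nrm X (R d) = nrm X (R c) / n" using n nrm_scaleR[OF X RX, of "1 / n" c] by simp
    ultimately show ?thesis using n by (simp add: n_def[symmetric] field_simps)
  qed
  moreover have "\<bar>\<phi> (y b) - T b \<phi>\<bar> < \<epsilon>" if "b \<in> B" "\<phi> \<in> \<Phi>" for b \<phi>
    using y(3)[OF that] e2 by linarith
  moreover have "y b \<in> W" if "b \<in> B \<inter> B'" for b using y(1)[of b] that by simp
  ultimately show ?thesis using yX unfolding R_def comb_def by blast
qed

section \<open>Lipschitz functions and Lipschitz-free spaces\<close>

lemma in_Lip0_iff: "f \<in> carr (Lip0 p) \<longleftrightarrow> f p = 0 \<and> (\<exists>L. L-lipschitz_on UNIV f)"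
  and nrm_Lip0: "nrm (Lip0 p) f = Inf {L. L-lipschitz_on UNIV f}"
  by (simp_all add: Lip0_def)

lemma Lip0_nrm_le:
  assumes "0 \<le> L" "\<And>x y. \<bar>f x - f y\<bar> \<le> L * dist x y"
  shows "nrm (Lip0 p) f \<le> L"
  unfolding nrm_Lip0
proof (rule cInf_lower)
  show "L \<in> {L. L-lipschitz_on UNIV f}" using assms by (auto simp: lipschitz_on_def dist_real_def)
  show "bdd_below {L. L-lipschitz_on UNIV f}" by (intro bdd_belowI[of _ 0]) (auto simp: lipschitz_on_def)
qed

lemma Lip0I:
  assumes "f p = 0" "0 \<le> L" "\<And>x y. \<bar>f x - f y\<bar> \<le> L * dist x y"
  shows "f \<in> carr (Lip0 p)"
  using assms unfolding in_Lip0_iff lipschitz_on_def by (auto simp: dist_real_def)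

lemma Lip0_nrm_nonneg: "f \<in> carr (Lip0 p) \<Longrightarrow> 0 \<le> nrm (Lip0 p) f"
  unfolding nrm_Lip0 by (rule cInf_greatest) (auto simp: in_Lip0_iff lipschitz_on_def)

lemma Lip0_dist_le:
  assumes f: "f \<in> carr (Lip0 p)"
  shows "\<bar>f x - f y\<bar> \<le> nrm (Lip0 p) f * dist x y"
proof (cases "x = y")
  case False
  have "\<bar>f x - f y\<bar> / dist x y \<le> nrm (Lip0 p) f"
    unfolding nrm_Lip0
  proof (rule cInf_greatest)
    show "{L. L-lipschitz_on UNIV f} \<noteq> {}" using f by (simp add: in_Lip0_iff)
    fix L assume "L \<in> {L. L-lipschitz_on UNIV f}"
    then have "\<bar>f x - f y\<bar> \<le> L * dist x y" by (auto simp: lipschitz_on_def dist_real_def)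
    then show "\<bar>f x - f y\<bar> / dist x y \<le> L" using False by (simp add: field_simps)
  qed
  then show ?thesis using False by (simp add: field_simps)
qed simp

lemma Lip0_base [simp]: "f \<in> carr (Lip0 p) \<Longrightarrow> f p = 0"
  by (simp add: in_Lip0_iff)

lemma normed_space_Lip0: "normed_space (Lip0 p)"
proof -
  let ?Z = "Lip0 p"
  have add: "f + g \<in> carr ?Z \<and> nrm ?Z (f + g) \<le> nrm ?Z f + nrm ?Z g" if f: "f \<in> carr ?Z" and g: "g \<in> carr ?Z" for f g
  proof -
    have "\<bar>(f + g) x - (f + g) y\<bar> \<le> (nrm ?Z f + nrm ?Z g) * dist x y" for x y
      using Lip0_dist_le[OF f, of x y] Lip0_dist_le[OF g, of x y] by (simp add: algebra_simps)
    moreover have "0 \<le> nrm ?Z f + nrm ?Z g" using f g by (simp add: Lip0_nrm_nonneg)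
    ultimately show ?thesis using f g by (auto intro: Lip0I Lip0_nrm_le)
  qed
  have scale: "c *\<^sub>R f \<in> carr ?Z \<and> nrm ?Z (c *\<^sub>R f) \<le> \<bar>c\<bar> * nrm ?Z f" if f: "f \<in> carr ?Z" for f c
  proof -
    have "\<bar>(c *\<^sub>R f) x - (c *\<^sub>R f) y\<bar> \<le> (\<bar>c\<bar> * nrm ?Z f) * dist x y" for x y
      using mult_left_mono[OF Lip0_dist_le[OF f, of x y] abs_ge_zero[of c]]
      by (simp add: abs_mult[symmetric] algebra_simps)
    moreover have "0 \<le> \<bar>c\<bar> * nrm ?Z f" using f by (simp add: Lip0_nrm_nonneg)
    ultimately show ?thesis using f by (auto intro: Lip0I Lip0_nrm_le)
  qed
  show ?thesis
  proof (rule normed_spaceI)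
    show "0 \<in> carr ?Z" by (rule Lip0I[where L = 0]) auto
    show "f = 0" if f: "f \<in> carr ?Z" and "nrm ?Z f = 0" for f
      using that Lip0_dist_le[OF f, of _ p] by (auto simp: fun_eq_iff)
  qed (use add scale Lip0_nrm_nonneg in auto)
qed

abbreviation Lip0_dual :: "'a::metric_space \<Rightarrow> (('a \<Rightarrow> real) \<Rightarrow> real) nspace" where
  "Lip0_dual p \<equiv> dual_space (Lip0 p)"

lemmas normed_space_Lip0_dual = normed_space_dual[OF normed_space_Lip0]

lemma lip_delta_in_dual: "lip_delta p x \<in> carr (Lip0_dual p)"
proof (rule dualI[where K = "dist x p"])
  fix f assume f: "f \<in> carr (Lip0 p)"
  show "\<bar>lip_delta p x f\<bar> \<le> dist x p * nrm (Lip0 p) f"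
    using Lip0_dist_le[OF f, of x p] f by (simp add: lip_delta_def mult.commute)
qed (auto simp: lip_delta_def carr_add carr_scaleR normed_space_Lip0)

lemma lip_delta_base: "lip_delta p p = 0"
  by (auto simp: lip_delta_def fun_eq_iff)

lemma nrm_lip_delta_diff_le: "nrm (Lip0_dual p) (lip_delta p x - lip_delta p y) \<le> dist x y"
proof (rule dual_nrm_le[OF normed_space_Lip0])
  fix f assume f: "f \<in> carr (Lip0 p)"
  show "\<bar>(lip_delta p x - lip_delta p y) f\<bar> \<le> dist x y * nrm (Lip0 p) f"
    using Lip0_dist_le[OF f, of x y] f by (simp add: lip_delta_def mult.commute)
qed simp

lemma carr_lipschitz_free: "carr (lipschitz_free p) = closed_lin_span (Lip0_dual p) (range (lip_delta p))"
  and nrm_lipschitz_free [simp]: "nrm (lipschitz_free p) = nrm (Lip0_dual p)"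
  by (simp_all add: lipschitz_free_def)

lemma closed_lin_span_subset: "normed_space X \<Longrightarrow> A \<subseteq> carr X \<Longrightarrow> closed_lin_span X A \<subseteq> carr X"
  by (auto simp: closed_lin_span_iff)

lemma span_subset_closed_lin_span:
  "normed_space X \<Longrightarrow> A \<subseteq> carr X \<Longrightarrow> span A \<subseteq> closed_lin_span X A"
  using span_minimal[of A "carr X"] by (force simp: closed_lin_span_iff normed_space_subspace)

lemma closed_subspace_closed_lin_span:
  assumes X: "normed_space X" and A: "A \<subseteq> carr X"
  shows "closed_subspace X (closed_lin_span X A)"
  unfolding closed_subspace_iff[OF X]
proof (intro conjI ballI impI)
  show "subspace (closed_lin_span X A)" "closed_lin_span X A \<subseteq> carr X"
    using closed_lin_span_subspace closed_lin_span_subset X A by blast+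
  have sp: "span A \<subseteq> carr X" by (rule span_minimal[OF A normed_space_subspace[OF X]])
  fix x assume x: "x \<in> carr X" and ap: "\<forall>e>0. \<exists>w\<in>closed_lin_span X A. nrm X (x - w) < e"
  have "\<exists>v\<in>span A. nrm X (x - v) < e" if "e > 0" for e
  proof -
    have "e/2 > 0" using that by simp
    then obtain w where w: "w \<in> closed_lin_span X A" "nrm X (x - w) < e/2" using ap by blast
    then obtain v where v: "v \<in> span A" "nrm X (w - v) < e/2"
      using \<open>e/2 > 0\<close> unfolding closed_lin_span_iff[OF X A] by blast
    have "nrm X (x - v) \<le> nrm X (x - w) + nrm X (w - v)"
      using v w x sp closed_lin_span_subset[OF X A] by (intro nrm_diff_triangle[OF X]) auto
    then show ?thesis using v w by (intro bexI[of _ v]) auto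
  qed
  then show "x \<in> closed_lin_span X A" using x by (simp add: closed_lin_span_iff[OF X A])
qed

lemma lipschitz_free_subset: "carr (lipschitz_free p) \<subseteq> carr (Lip0_dual p)"
  unfolding carr_lipschitz_free
  by (intro closed_lin_span_subset normed_space_Lip0_dual) (auto intro: lip_delta_in_dual)

lemma lip_delta_in_free: "lip_delta p x \<in> carr (lipschitz_free p)"
  unfolding carr_lipschitz_free
  by (intro subsetD[OF span_subset_closed_lin_span] normed_space_Lip0_dual span_base)
    (auto intro: lip_delta_in_dual)

lemma banach_space_normed: "banach_space X \<Longrightarrow> normed_space X"
  by (simp add: banach_space_def)

lemma banach_space_complete:
  fixes \<sigma> :: "nat \<Rightarrow> 'v::real_vector"
  assumes X: "banach_space X" and "\<And>n. \<sigma> n \<in> carr X"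
    and "\<And>e. e > 0 \<Longrightarrow> \<exists>N. \<forall>m\<ge>N. \<forall>n\<ge>N. nrm X (\<sigma> m - \<sigma> n) < e"
  obtains l where "l \<in> carr X" "\<And>e. e > 0 \<Longrightarrow> \<exists>N. \<forall>n\<ge>N. nrm X (\<sigma> n - l) < e"
proof -
  have "\<exists>l\<in>carr X. \<forall>e>0. \<exists>N. \<forall>n\<ge>N. nrm X (\<sigma> n - l) < e"
    using conjunct2[OF X[unfolded banach_space_iff], rule_format, of \<sigma>] assms(2,3) by simp
  then show ?thesis using that by blast
qed

lemma normed_space_closed_subspace:
  assumes X: "normed_space X" and W: "subspace W" "W \<subseteq> carr X"
  shows "normed_space \<lparr>carr = W, nrm = nrm X\<rparr>"
  unfolding normed_space_def
  using W nrm_nonneg[OF X] nrm_eq_0_iff[OF X] nrm_scaleR[OF X] nrm_add_le[OF X] by (simp add: subset_iff)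

lemma banach_space_closed_subspace:
  assumes X: "banach_space X" and W: "closed_subspace X W"
  shows "banach_space \<lparr>carr = W, nrm = nrm X\<rparr>"
proof -
  have nX: "normed_space X" using X by (simp add: banach_space_iff)
  note W' = W[unfolded closed_subspace_iff[OF nX]]
  show ?thesis
    unfolding banach_space_iff
  proof (intro conjI allI impI)
    show "normed_space \<lparr>carr = W, nrm = nrm X\<rparr>" using W' by (intro normed_space_closed_subspace nX) auto
    fix \<sigma> :: "nat \<Rightarrow> _" assume \<sigma>: "\<forall>n. \<sigma> n \<in> carr \<lparr>carr = W, nrm = nrm X\<rparr>"
      and C: "\<forall>e>0. \<exists>N. \<forall>m\<ge>N. \<forall>n\<ge>N. nrm \<lparr>carr = W, nrm = nrm X\<rparr> (\<sigma> m - \<sigma> n) < e"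
    have \<sigma>X: "\<forall>n. \<sigma> n \<in> carr X" using \<sigma> W' by auto
    obtain l where l: "l \<in> carr X" "\<And>e. e > 0 \<Longrightarrow> \<exists>N. \<forall>n\<ge>N. nrm X (\<sigma> n - l) < e"
      by (rule banach_space_complete[OF X, of \<sigma>]) (use C \<sigma>X in auto)
    have "\<exists>w\<in>W. nrm X (l - w) < e" if "e > 0" for e
    proof -
      obtain N where "nrm X (\<sigma> N - l) < e" using l(2)[OF \<open>e > 0\<close>] by auto
      then show ?thesis using \<sigma> nrm_diff_commute[OF nX l(1)] \<sigma>X by (intro bexI[of _ "\<sigma> N"]) auto
    qed
    then have "l \<in> W" using W' l by blast
    then show "\<exists>l\<in>carr \<lparr>carr = W, nrm = nrm X\<rparr>. \<forall>e>0. \<exists>N. \<forall>n\<ge>N. nrm \<lparr>carr = W, nrm = nrm X\<rparr> (\<sigma> n - l) < e"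
      using l by auto
  qed
qed

lemma banach_space_lipschitz_free: "banach_space (lipschitz_free p)"
proof -
  have "closed_subspace (Lip0_dual p) (closed_lin_span (Lip0_dual p) (range (lip_delta p)))"
    by (intro closed_subspace_closed_lin_span normed_space_Lip0_dual) (auto intro: lip_delta_in_dual)
  then show ?thesis unfolding lipschitz_free_def
    by (intro banach_space_closed_subspace banach_space_dual normed_space_Lip0)
qed

lemma normed_space_lipschitz_free: "normed_space (lipschitz_free p)"
  by (rule banach_space_normed[OF banach_space_lipschitz_free])

lemma closed_subspace_free_sub: "closed_subspace (lipschitz_free p) (lipschitz_free_sub p N)"
  unfolding lipschitz_free_sub_def
  by (intro closed_subspace_closed_lin_span normed_space_lipschitz_free) (auto intro: lip_delta_in_free)

lemma subspace_free_sub: "subspace (lipschitz_free_sub p N)"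
  and free_sub_subset: "lipschitz_free_sub p N \<subseteq> carr (lipschitz_free p)"
  using closed_subspace_free_sub[of p N] by (auto simp: closed_subspace_iff[OF normed_space_lipschitz_free])

lemma free_sub_approx:
  "\<mu> \<in> lipschitz_free_sub p N \<Longrightarrow> e > 0 \<Longrightarrow> \<exists>\<nu>\<in>span (lip_delta p ` N). nrm (Lip0_dual p) (\<mu> - \<nu>) < e"
  unfolding lipschitz_free_sub_def
  by (subst (asm) closed_lin_span_iff) (auto intro: lip_delta_in_free normed_space_lipschitz_free)

lemma lip_delta_in_free_sub: "x \<in> N \<Longrightarrow> lip_delta p x \<in> lipschitz_free_sub p N"
  unfolding lipschitz_free_sub_def
  by (intro subsetD[OF span_subset_closed_lin_span] normed_space_lipschitz_free span_base)
    (auto intro: lip_delta_in_free)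

lemma lipschitz_free_eq_free_sub: "carr (lipschitz_free p) = lipschitz_free_sub p UNIV"
proof
  show "carr (lipschitz_free p) \<subseteq> lipschitz_free_sub p UNIV"
  proof
    fix \<mu> assume \<mu>: "\<mu> \<in> carr (lipschitz_free p)"
    then have "\<forall>e>0. \<exists>w\<in>span (range (lip_delta p)). nrm (Lip0_dual p) (\<mu> - w) < e"
      unfolding carr_lipschitz_free by (subst (asm) closed_lin_span_iff) (auto intro: lip_delta_in_dual normed_space_Lip0_dual)
    then show "\<mu> \<in> lipschitz_free_sub p UNIV"
      unfolding lipschitz_free_sub_def using \<mu>
      by (subst closed_lin_span_iff) (auto intro: lip_delta_in_free normed_space_lipschitz_free)
  qed
qed (rule free_sub_subset)

text \<open>
  Elements of \<open>F(N)\<close> do not see a Lipschitz function outside \<open>N\<close>: this is clear on the span of the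
  evaluations at points of \<open>N\<close>, and passes to the closure.
\<close>

lemma free_sub_vanish:
  assumes \<mu>: "\<mu> \<in> lipschitz_free_sub p N" and u: "u \<in> carr (Lip0 p)" "\<And>x. x \<in> N \<Longrightarrow> u x = 0"
  shows "\<mu> u = 0"
proof -
  have span: "\<nu> u = 0 \<and> \<nu> \<in> carr (Lip0_dual p)" if "\<nu> \<in> span (lip_delta p ` N)" for \<nu>
    using that
  proof (induction rule: span_induct_alt)
    case base
    show ?case by (intro conjI carr_0 normed_space_Lip0_dual) simp
  next
    case (step c x y)
    then obtain a where a: "a \<in> N" "x = lip_delta p a" by auto
    have "c *\<^sub>R x + y \<in> carr (Lip0_dual p)"
      using step a by (intro carr_add carr_scaleR normed_space_Lip0_dual) (auto intro: lip_delta_in_dual)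
    moreover have "x u = 0" using a u by (simp add: lip_delta_def)
    moreover from this have "(c *\<^sub>R x + y) u = 0" using step by simp
    ultimately show ?case by blast
  qed
  have \<mu>D: "\<mu> \<in> carr (Lip0_dual p)" using \<mu> free_sub_subset lipschitz_free_subset by blast
  have "\<bar>\<mu> u\<bar> \<le> 0 + e" if "e > 0" for e
  proof -
    have n: "nrm (Lip0 p) u + 1 > 0" using Lip0_nrm_nonneg[OF u(1)] by simp
    then obtain \<nu> where \<nu>: "\<nu> \<in> span (lip_delta p ` N)" "nrm (Lip0_dual p) (\<mu> - \<nu>) < e / (nrm (Lip0 p) u + 1)"
      using free_sub_approx[OF \<mu>, of "e / (nrm (Lip0 p) u + 1)"] \<open>e > 0\<close> by auto
    have "\<bar>(\<mu> - \<nu>) u\<bar> \<le> nrm (Lip0_dual p) (\<mu> - \<nu>) * nrm (Lip0 p) u"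
      using span \<nu> \<mu>D by (intro dual_apply_le normed_space_Lip0 carr_diff normed_space_Lip0_dual u) auto
    also have "\<dots> \<le> (e / (nrm (Lip0 p) u + 1)) * nrm (Lip0 p) u"
      using \<nu> Lip0_nrm_nonneg[OF u(1)] by (intro mult_right_mono) auto
    also have "\<dots> \<le> e" using n \<open>e > 0\<close> by (simp add: field_simps)
    finally show ?thesis using span[OF \<nu>(1)] by simp
  qed
  then have "\<bar>\<mu> u\<bar> \<le> 0" by (rule field_le_epsilon)
  then show ?thesis by simp
qed

text \<open>
  The linearisation of a Lipschitz map \<open>h\<close> into a dual space. The formula makes sense on the
  whole dual of \<open>Lip0 p\<close>, and on evaluation functionals it agrees with \<open>h\<close>.
\<close>

definition lip_extension :: "'x::real_vector nspace \<Rightarrow> ('a \<Rightarrow> 'x \<Rightarrow> real) \<Rightarrow> (('a \<Rightarrow> real) \<Rightarrow> real) \<Rightarrow> 'x \<Rightarrow> real" where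
  "lip_extension X h \<mu> = (\<lambda>u. if u \<in> carr X then \<mu> (\<lambda>x. h x u) else 0)"

context
  fixes X :: "'x::real_vector nspace" and h :: "'a::metric_space \<Rightarrow> 'x \<Rightarrow> real" and K :: real and p :: 'a
  assumes X: "normed_space X" and h: "\<And>x. h x \<in> carr (dual_space X)" and hp: "h p = 0" and K: "0 \<le> K"
    and lip: "\<And>x y. nrm (dual_space X) (h x - h y) \<le> K * dist x y"
begin

lemma lip_extension_coefficient:
  assumes u: "u \<in> carr X"
  shows "(\<lambda>x. h x u) \<in> carr (Lip0 p)" "nrm (Lip0 p) (\<lambda>x. h x u) \<le> K * nrm X u"
proof -
  have "\<bar>h x u - h y u\<bar> \<le> (K * nrm X u) * dist x y" for x y
  proof -
    have "\<bar>(h x - h y) u\<bar> \<le> nrm (dual_space X) (h x - h y) * nrm X u"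
      by (intro dual_apply_le X carr_diff normed_space_dual h u)
    also have "\<dots> \<le> (K * dist x y) * nrm X u" using lip by (intro mult_right_mono nrm_nonneg X u)
    finally show ?thesis by (simp add: mult_ac)
  qed
  moreover have "0 \<le> K * nrm X u" using K u by (simp add: nrm_nonneg X)
  ultimately show "(\<lambda>x. h x u) \<in> carr (Lip0 p)" "nrm (Lip0 p) (\<lambda>x. h x u) \<le> K * nrm X u"
    using hp by (auto intro: Lip0I Lip0_nrm_le)
qed

lemma lip_extension_bound:
  assumes \<mu>: "\<mu> \<in> carr (Lip0_dual p)" and u: "u \<in> carr X"
  shows "\<bar>lip_extension X h \<mu> u\<bar> \<le> (K * nrm (Lip0_dual p) \<mu>) * nrm X u"
proof -
  have "\<bar>\<mu> (\<lambda>x. h x u)\<bar> \<le> nrm (Lip0_dual p) \<mu> * nrm (Lip0 p) (\<lambda>x. h x u)"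
    by (intro dual_apply_le normed_space_Lip0 \<mu> lip_extension_coefficient u)
  also have "\<dots> \<le> nrm (Lip0_dual p) \<mu> * (K * nrm X u)"
    using \<mu> by (intro mult_left_mono lip_extension_coefficient u nrm_nonneg normed_space_Lip0_dual)
  finally show ?thesis using u by (simp add: lip_extension_def mult_ac)
qed

lemma lip_extension_in_dual:
  assumes \<mu>: "\<mu> \<in> carr (Lip0_dual p)"
  shows "lip_extension X h \<mu> \<in> carr (dual_space X)"
proof (rule dualI[where K = "K * nrm (Lip0_dual p) \<mu>"])
  fix u v assume uv: "u \<in> carr X" "v \<in> carr X"
  have "(\<lambda>x. h x (u + v)) = (\<lambda>x. h x u) + (\<lambda>x. h x v)"
    using uv by (simp add: fun_eq_iff linear_map_on_add[OF dual_linear[OF h]])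
  then show "lip_extension X h \<mu> (u + v) = lip_extension X h \<mu> u + lip_extension X h \<mu> v"
    using uv linear_map_on_add[OF dual_linear[OF \<mu>]]
    by (simp add: lip_extension_def carr_add X lip_extension_coefficient)
next
  fix c u assume u: "u \<in> carr X"
  have "(\<lambda>x. h x (c *\<^sub>R u)) = c *\<^sub>R (\<lambda>x. h x u)"
    using u by (simp add: fun_eq_iff linear_map_on_scaleR[OF dual_linear[OF h]])
  then show "lip_extension X h \<mu> (c *\<^sub>R u) = c * lip_extension X h \<mu> u"
    using u linear_map_on_scaleR[OF dual_linear[OF \<mu>]]
    by (simp add: lip_extension_def carr_scaleR X lip_extension_coefficient)
next
  show "\<bar>lip_extension X h \<mu> u\<bar> \<le> (K * nrm (Lip0_dual p) \<mu>) * nrm X u" if "u \<in> carr X" for u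
    using \<mu> that by (rule lip_extension_bound)
qed (simp add: lip_extension_def)

lemma nrm_lip_extension_le:
  assumes \<mu>: "\<mu> \<in> carr (Lip0_dual p)"
  shows "nrm (dual_space X) (lip_extension X h \<mu>) \<le> K * nrm (Lip0_dual p) \<mu>"
  using \<mu> K by (intro dual_nrm_le X lip_extension_bound) (auto simp: nrm_nonneg normed_space_Lip0_dual)

lemma lip_extension_delta: "lip_extension X h (lip_delta p x) = h x"
  using dual_outside[OF h] by (auto simp: lip_extension_def lip_delta_def fun_eq_iff lip_extension_coefficient)

lemma lip_extension_vanish:
  assumes "\<mu> \<in> lipschitz_free_sub p N" "\<And>x. x \<in> N \<Longrightarrow> h x u = 0"
  shows "lip_extension X h \<mu> u = 0"
  using free_sub_vanish[OF assms(1) lip_extension_coefficient(1)] assms(2) by (simp add: lip_extension_def)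

end

lemma linear_lip_extension: "linear_map_on V (lip_extension X h)"
  by (auto simp: linear_map_on_def lip_extension_def fun_eq_iff)

text \<open>
  For finite \<open>E\<close>, the Lipschitz functions \<open>max 0 (1 - dist x e / r)\<close>, with \<open>r\<close> at most the distance
  from \<open>e\<close> to \<open>p\<close> and to the other points of \<open>E\<close>, are dual to the evaluations at points of \<open>E\<close>. So
  \<open>F(E)\<close> is spanned by these evaluations, although it is defined as a closure.
\<close>

lemma finite_free_sub_representation:
  fixes p :: "'a::metric_space"
  assumes E: "finite E"
  shows "\<exists>u. (\<forall>e\<in>E - {p}. u e \<in> carr (Lip0 p)) \<and>
    (\<forall>\<mu>\<in>lipschitz_free_sub p E. \<mu> = (\<Sum>e\<in>E - {p}. \<mu> (u e) *\<^sub>R lip_delta p e))"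
proof -
  have "\<exists>r>0. \<forall>e'\<in>insert p E - {e}. r \<le> dist e' e" for e
  proof -
    have "finite (insert p E)" using E by simp
    then show ?thesis
    proof (induction)
      case (insert a F)
      then obtain r where r: "r > 0" "\<forall>e'\<in>F - {e}. r \<le> dist e' e" by blast
      show ?case
      proof (cases "a = e")
        case False
        then show ?thesis using r by (intro exI[of _ "min r (dist a e)"]) (auto simp: min_le_iff_disj)
      qed (use r in blast)
    qed (auto intro: exI[of _ 1])
  qed
  then obtain r where r: "\<And>e. r e > 0" "\<And>e e'. e' \<in> insert p E \<Longrightarrow> e' \<noteq> e \<Longrightarrow> r e \<le> dist e' e"
    by (metis DiffI singletonD)
  define u where "u e x = max 0 (1 - dist x e / r e)" for e x :: 'a
  have ue: "u e e' = (if e' = e then 1 else 0)" if "e' \<in> insert p E" for e e'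
    using r(2)[OF that, of e] r(1)[of e] by (auto simp: u_def)
  have uL: "u e \<in> carr (Lip0 p)" if "e \<in> E - {p}" for e
  proof (rule Lip0I[where L = "1 / r e"])
    show "u e p = 0" using that ue[of p e] by auto
    show "0 \<le> 1 / r e" using r(1)[of e] by simp
    fix x y
    have "\<bar>u e x - u e y\<bar> \<le> \<bar>dist x e / r e - dist y e / r e\<bar>" by (simp add: u_def)
    also have "\<dots> = \<bar>dist x e - dist y e\<bar> / r e" using r(1)[of e] by (simp add: diff_divide_distrib[symmetric])
    also have "\<dots> \<le> dist x y / r e" using r(1)[of e] abs_dist_diff_le[of x e y]
      by (intro divide_right_mono) (auto simp: dist_commute)
    finally show "\<bar>u e x - u e y\<bar> \<le> 1 / r e * dist x y" by simp
  qed
  have "\<mu> = (\<Sum>e\<in>E - {p}. \<mu> (u e) *\<^sub>R lip_delta p e)" if \<mu>: "\<mu> \<in> lipschitz_free_sub p E" for \<mu>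
  proof
    fix w
    have \<mu>D: "\<mu> \<in> carr (Lip0_dual p)" using \<mu> free_sub_subset lipschitz_free_subset by blast
    show "\<mu> w = (\<Sum>e\<in>E - {p}. \<mu> (u e) *\<^sub>R lip_delta p e) w"
    proof (cases "w \<in> carr (Lip0 p)")
      case True
      define s where "s = (\<Sum>e\<in>E - {p}. w e *\<^sub>R u e)"
      have s: "s \<in> carr (Lip0 p)" unfolding s_def using uL by (intro carr_intros normed_space_Lip0)
      have "\<mu> (w - s) = 0"
      proof (rule free_sub_vanish[OF \<mu>])
        show "w - s \<in> carr (Lip0 p)" using True s by (intro carr_intros normed_space_Lip0)
        fix x assume x: "x \<in> E"
        have "s x = (\<Sum>e\<in>E - {p}. if e = x then w e else 0)"
          unfolding s_def sum_fun_apply using ue[of x] x by (intro sum.cong) auto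
        also have "\<dots> = w x" using x E True by (auto simp: sum.delta)
        finally show "(w - s) x = 0" by simp
      qed
      moreover have "\<mu> (w - s) = \<mu> w - \<mu> s"
        using True s by (intro linear_map_on_diff[OF normed_space_subspace[OF normed_space_Lip0] dual_linear[OF \<mu>D]])
      moreover have "\<mu> s = (\<Sum>e\<in>E - {p}. w e *\<^sub>R \<mu> (u e))"
        unfolding s_def using uL by (intro linear_map_on_sum_scaleR[OF normed_space_subspace[OF normed_space_Lip0] dual_linear[OF \<mu>D]])
      ultimately show ?thesis using True by (simp add: sum_fun_apply lip_delta_def mult.commute)
    next
      case False
      then show ?thesis using dual_outside[OF \<mu>D False] by (simp add: sum_fun_apply lip_delta_def)
    qed
  qed
  then show ?thesis using uL by blast
qed

section \<open>From the approximation property to nets\<close>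

text \<open>
  The constants are chosen in this order: the error \<open>e1\<close> of the finite-rank operator \<open>S\<close>, then the error
  \<open>\<epsilon>2\<close> of local reflexivity, which depends on \<open>S\<close> through the coordinate bound \<open>C\<close> of its range.
  The basis of the range of \<open>S\<close> extends one of the range of \<open>S\<close> on \<open>F(M2)\<close>, so that the condition on
  \<open>M2\<close> becomes a condition on basis vectors.
\<close>

theorem pair_BAP_imp_net_limit:
  fixes p :: "'a::metric_space" and X1 :: "'v::real_vector nspace"
  assumes bap: "pair_BAP lam (lipschitz_free p) (lipschitz_free_sub p M2)"
    and p: "p \<in> M2" and lam: "0 \<le> lam"
    and X: "normed_space X1" and X2: "subspace X2" "X2 \<subseteq> carr X1"
    and f: "f \<in> Lip_pair 1 M2 (bidual X1) (biannihilator X1 X2)"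
  shows "pointwise_weak_star_net_limit X1 (Lip_pair lam M2 X1 X2) f"
proof (subst pointwise_weak_star_net_limit_iff[OF X])
  show "g x \<in> carr X1" if "g \<in> Lip_pair lam M2 X1 X2" for g x using that by (auto simp: Lip_pair_def)
  note D = normed_space_dual[OF X] and DD = normed_space_dual[OF normed_space_dual[OF X]]
  have fX: "f x \<in> carr (bidual X1)" and flip: "nrm (bidual X1) (f x - f y) \<le> dist x y" for x y
    using f by (auto simp: Lip_pair_def)
  have fM: "f x \<in> biannihilator X1 X2" if "x \<in> M2" for x using f that by (auto simp: Lip_pair_def)
  let ?Z = "lipschitz_free p" and ?W = "lipschitz_free_sub p M2" and ?N = "nrm (Lip0_dual p)"
  note Z = normed_space_lipschitz_free[of p]
  define h where "h x = f x - f p" for x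
  define T where "T = lip_extension (dual_space X1) h"
  have h: "h x \<in> carr (bidual X1)" for x unfolding h_def by (intro carr_intros DD fX)
  have hlip: "nrm (bidual X1) (h x - h y) \<le> 1 * dist x y" for x y using flip[of x y] by (simp add: h_def)
  have hp: "h p = 0" by (simp add: h_def)
  note ext = lip_extension_in_dual[OF D h hp zero_le_one hlip, folded T_def]
    nrm_lip_extension_le[OF D h hp zero_le_one hlip, folded T_def]
    lip_extension_delta[OF D h hp zero_le_one hlip, folded T_def]
    lip_extension_vanish[OF D h hp zero_le_one hlip, folded T_def]
  have ZD: "z \<in> carr (Lip0_dual p)" if "z \<in> carr ?Z" for z using that lipschitz_free_subset by blast
  have TZ: "T z \<in> carr (bidual X1)" "nrm (bidual X1) (T z) \<le> ?N z" if "z \<in> carr ?Z" for z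
    using ext(1,2)[OF ZD[OF that]] by auto
  have Tlin: "linear_map_on V T" for V unfolding T_def by (rule linear_lip_extension)
  have T\<delta>: "T (lip_delta p x) = h x" for x by (rule ext(3))
  have TW: "T z \<in> biannihilator X1 X2" if z: "z \<in> ?W" for z
  proof -
    have "T z \<psi> = 0" if "\<psi> \<in> annihilator X1 X2" for \<psi>
      using that fM fM[OF p] by (intro ext(4)[OF z]) (auto simp: h_def annihilator_def)
    then show ?thesis using TZ(1)[of z] z free_sub_subset by (auto simp: annihilator_def)
  qed
  show "(\<forall>x. f x \<in> carr (bidual X1)) \<and> (\<forall>E \<Phi> \<epsilon>. finite E \<longrightarrow> finite \<Phi> \<longrightarrow> \<Phi> \<subseteq> carr (dual_space X1) \<longrightarrow> \<epsilon> > 0 \<longrightarrow>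
        (\<exists>g\<in>Lip_pair lam M2 X1 X2. \<forall>x\<in>E. \<forall>\<phi>\<in>\<Phi>. \<bar>\<phi> (g x) - f x \<phi>\<bar> < \<epsilon>))"
  proof (intro conjI allI impI)
    fix E :: "'a set" and \<Phi> and \<epsilon> :: real
    assume E: "finite E" and \<Phi>: "finite \<Phi>" "\<Phi> \<subseteq> carr (dual_space X1)" and \<epsilon>: "\<epsilon> > 0"
    define F0 where "F0 = (\<Sum>\<phi>\<in>\<Phi>. nrm (dual_space X1) \<phi>)"
    define d0 where "d0 = (\<Sum>x\<in>E. dist x p)"
    have F0: "nrm (dual_space X1) \<phi> \<le> F0" if "\<phi> \<in> \<Phi>" for \<phi>
      unfolding F0_def using that \<Phi> nrm_nonneg[OF D] by (intro member_le_sum) auto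
    have F0': "0 \<le> F0" unfolding F0_def using \<Phi> nrm_nonneg[OF D] by (intro sum_nonneg) auto
    have d0: "dist x p \<le> d0" if "x \<in> E" for x unfolding d0_def using that E by (intro member_le_sum) auto
    have d0': "0 \<le> d0" unfolding d0_def by (intro sum_nonneg) auto
    \<comment> \<open>the final estimate has three contributions of at most \<open>\<epsilon> / 4\<close>, from \<open>y0\<close>, \<open>e1\<close> and \<open>\<epsilon>2\<close>; \<open>F0\<close> may be \<open>0\<close>\<close>
    define e1 where "e1 = \<epsilon> / (4 * (F0 + 1))"
    have e1: "e1 > 0" "e1 * F0 \<le> \<epsilon> / 4" using \<epsilon> F0' by (auto simp: e1_def field_simps)
    have "compactin (norm_topology ?Z) (lip_delta p ` E)"
      using E lip_delta_in_free by (intro finite_compactin_norm_topology Z) auto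
    then obtain S B0 where S: "linear_map_on (carr ?Z) S" "S ` carr ?Z \<subseteq> carr ?Z"
      and B0: "finite B0" "S ` carr ?Z \<subseteq> span B0"
      and Sn: "\<And>z. z \<in> carr ?Z \<Longrightarrow> ?N (S z) \<le> lam * ?N z"
      and Sd: "\<And>x. x \<in> E \<Longrightarrow> ?N (S (lip_delta p x) - lip_delta p x) \<le> e1" and SW: "S ` ?W \<subseteq> ?W"
      using bap e1(1) unfolding pair_BAP_def nrm_lipschitz_free
      by (elim allE[of _ e1] impE allE[of _ "lip_delta p ` E"]) auto
    note Zs = normed_space_subspace[OF Z]
    obtain B' where B': "B' \<subseteq> S ` ?W" "independent B'" "S ` ?W \<subseteq> span B'"
      by (rule maximal_independent_subset)
    have "B' \<subseteq> S ` carr ?Z" using B'(1) free_sub_subset by blast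
    then obtain B where B: "B' \<subseteq> B" "B \<subseteq> S ` carr ?Z" "independent B" "S ` carr ?Z \<subseteq> span B"
      by (rule maximal_independent_subset_extend[OF _ B'(2)])
    have Bfin: "finite B" using independent_span_bound[OF B0(1) B(3)] B(2) B0(2) by blast
    have BZ: "B \<subseteq> carr ?Z" using B(2) S(2) by blast
    obtain C where C: "C \<ge> 0" "\<And>c. (\<Sum>b\<in>B. \<bar>c b\<bar>) \<le> C * ?N (\<Sum>b\<in>B. c b *\<^sub>R b)"
      using finite_dim_coordinates_bounded[OF Z Bfin B(3) BZ] by auto
    define Q where "Q = C * (lam * d0)"
    have Q: "0 \<le> Q" using C lam d0' by (simp add: Q_def)
    define H where "H = 3 * Q + 2 * (lam * d0 * F0) + 1"
    have H: "H > 0" using Q lam d0' F0' by (simp add: H_def add_nonneg_pos)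
    define \<epsilon>2 where "\<epsilon>2 = min 1 (\<epsilon> / (4 * H))"
    have e2: "\<epsilon>2 > 0" "\<epsilon>2 \<le> 1" "\<epsilon>2 * H \<le> \<epsilon> / 4"
    proof -
      show "\<epsilon>2 > 0" "\<epsilon>2 \<le> 1" using \<epsilon> H by (auto simp: \<epsilon>2_def)
      have "\<epsilon>2 * H \<le> \<epsilon> / (4 * H) * H" using H by (intro mult_right_mono) (auto simp: \<epsilon>2_def)
      then show "\<epsilon>2 * H \<le> \<epsilon> / 4" using H by simp
    qed
    have "\<exists>y. (\<forall>b\<in>B. y b \<in> carr X1) \<and> (\<forall>b\<in>B \<inter> B'. y b \<in> X2) \<and>
     (\<forall>c. nrm X1 (\<Sum>b\<in>B. c b *\<^sub>R y b) \<le> (1 + \<epsilon>2) * nrm ?Z (\<Sum>b\<in>B. c b *\<^sub>R b)) \<and>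
     (\<forall>b\<in>B. \<forall>\<phi>\<in>\<Phi>. \<bar>\<phi> (y b) - T b \<phi>\<bar> < \<epsilon>2)"
    proof -
      have TB': "T b \<in> biannihilator X1 X2" if "b \<in> B'" for b using that TW B'(1) SW by blast
      show ?thesis using BZ
        by (intro local_reflexivity_map[OF X Z X2 Bfin B(3) BZ Tlin _ _ _ \<Phi> e2(1)]) (auto simp: TZ intro: TB')
    qed
    then obtain y where "\<forall>b\<in>B. y b \<in> carr X1" "\<forall>b\<in>B \<inter> B'. y b \<in> X2"
      "\<forall>c. nrm X1 (\<Sum>b\<in>B. c b *\<^sub>R y b) \<le> (1 + \<epsilon>2) * nrm ?Z (\<Sum>b\<in>B. c b *\<^sub>R b)"
      "\<forall>b\<in>B. \<forall>\<phi>\<in>\<Phi>. \<bar>\<phi> (y b) - T b \<phi>\<bar> < \<epsilon>2" by blast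
    then have y: "\<And>b. b \<in> B \<Longrightarrow> y b \<in> carr X1" "\<And>b. b \<in> B' \<Longrightarrow> y b \<in> X2"
      "\<And>c. nrm X1 (\<Sum>b\<in>B. c b *\<^sub>R y b) \<le> (1 + \<epsilon>2) * ?N (\<Sum>b\<in>B. c b *\<^sub>R b)"
      "\<And>b \<phi>. b \<in> B \<Longrightarrow> \<phi> \<in> \<Phi> \<Longrightarrow> \<bar>\<phi> (y b) - T b \<phi>\<bar> < \<epsilon>2" using B(1) by auto
    obtain y0 where y0: "y0 \<in> X2" "\<And>\<phi>. \<phi> \<in> \<Phi> \<Longrightarrow> \<bar>\<phi> y0 - f p \<phi>\<bar> < \<epsilon> / 4"
      using local_reflexivity_finite[OF X, of "{()}" "\<lambda>_. X2" "\<lambda>_. f p" "{}" \<Phi> "\<epsilon> / 4"] X2 fM[OF p] \<Phi> \<epsilon> by auto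
    \<comment> \<open>the scaling which compensates the factor \<open>1 + \<epsilon>2\<close> in the norm of the lifted operator\<close>
    define \<kappa> where "\<kappa> = 1 / (1 + \<epsilon>2)"
    have \<kappa>: "0 < \<kappa>" "\<kappa> \<le> 1" "1 - \<kappa> \<le> 2 * \<epsilon>2" using e2 by (auto simp: \<kappa>_def field_simps)
    define s where "s x = S (lip_delta p x)" for x
    define r where "r x = representation B (s x)" for x
    have sZ: "s x \<in> carr ?Z" for x using S(2) lip_delta_in_free by (auto simp: s_def)
    have s_span: "s x \<in> span B" for x using B(4) lip_delta_in_free by (auto simp: s_def)
    have sr: "(\<Sum>b\<in>B. r x b *\<^sub>R b) = s x" for x
      unfolding r_def using sum_representation_eq[OF B(3) s_span Bfin] by simp
    define g where "g x = y0 + \<kappa> *\<^sub>R (\<Sum>b\<in>B. r x b *\<^sub>R y b)" for x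
    have y0X: "y0 \<in> carr X1" using y0 X2 by auto
    have RX: "(\<Sum>b\<in>B. r x b *\<^sub>R y b) \<in> carr X1" for x using y by (intro carr_intros X)
    have gX: "g x \<in> carr X1" for x unfolding g_def by (rule carr_add[OF X y0X carr_scaleR[OF X RX]])
    have s_diff: "?N (s x - s x') \<le> lam * dist x x'" for x x'
    proof -
      have "s x - s x' = S (lip_delta p x - lip_delta p x')"
        unfolding s_def by (subst linear_map_on_diff[OF Zs S(1)]) (auto intro: lip_delta_in_free)
      then have "?N (s x - s x') \<le> lam * ?N (lip_delta p x - lip_delta p x')"
        using Sn[OF carr_diff[OF Z lip_delta_in_free lip_delta_in_free]] by simp
      also have "\<dots> \<le> lam * dist x x'" by (intro mult_left_mono nrm_lip_delta_diff_le lam)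
      finally show ?thesis .
    qed
    have "s p = 0" using linear_map_on_0[OF Zs S(1)] by (simp add: s_def lip_delta_base)
    then have s_bound: "?N (s x) \<le> lam * d0" if "x \<in> E" for x
      using s_diff[of x p] mult_left_mono[OF d0[OF that] lam] by simp
    have glip: "nrm X1 (g x - g x') \<le> lam * dist x x'" for x x'
    proof -
      have "g x - g x' = \<kappa> *\<^sub>R (\<Sum>b\<in>B. (r x b - r x' b) *\<^sub>R y b)"
        by (simp add: g_def scaleR_diff_right[symmetric] scaleR_diff_left sum_subtractf)
      then have "nrm X1 (g x - g x') = \<kappa> * nrm X1 (\<Sum>b\<in>B. (r x b - r x' b) *\<^sub>R y b)"
        using \<kappa> y by (simp add: nrm_scaleR X carr_intros)
      also have "\<dots> \<le> \<kappa> * ((1 + \<epsilon>2) * ?N (\<Sum>b\<in>B. (r x b - r x' b) *\<^sub>R b))"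
        using \<kappa> y(3)[of "\<lambda>b. r x b - r x' b"] by (intro mult_left_mono) auto
      also have "\<dots> = ?N (\<Sum>b\<in>B. (r x b - r x' b) *\<^sub>R b)" using e2 by (simp add: \<kappa>_def)
      also have "(\<Sum>b\<in>B. (r x b - r x' b) *\<^sub>R b) = s x - s x'"
        by (simp add: scaleR_diff_left sum_subtractf sr)
      also have "?N (s x - s x') \<le> lam * dist x x'" by (rule s_diff)
      finally show ?thesis .
    qed
    have gM: "g x \<in> X2" if "x \<in> M2" for x
    proof -
      have "s x \<in> S ` ?W" using that lip_delta_in_free_sub by (auto simp: s_def)
      then have "s x \<in> span B'" using B'(3) by blast
      then have "r x = representation B' (s x)"
        unfolding r_def by (rule representation_extend[OF B(3) _ B(1)])
      then have "r x b *\<^sub>R y b \<in> X2" for b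
        using representation_ne_zero[of B' "s x" b] y(2)[of b] subspace_scale[OF X2(1)] subspace_0[OF X2(1)]
        by (cases "r x b = 0") auto
      then have "(\<Sum>b\<in>B. r x b *\<^sub>R y b) \<in> X2" by (rule subspace_sum[OF X2(1)])
      then show ?thesis unfolding g_def by (intro subspace_add[OF X2(1) y0(1)] subspace_scale[OF X2(1)])
    qed
    have "\<bar>\<phi> (g x) - f x \<phi>\<bar> < \<epsilon>" if x: "x \<in> E" and \<phi>: "\<phi> \<in> \<Phi>" for x \<phi>
    proof -
      have \<phi>D: "\<phi> \<in> carr (dual_space X1)" using \<phi> \<Phi> by auto
      note lin = dual_linear[OF \<phi>D] and Xs = normed_space_subspace[OF X]
      define a where "a = (\<Sum>b\<in>B. r x b * \<phi> (y b))"
      have "\<phi> (g x) = \<phi> y0 + \<phi> (\<kappa> *\<^sub>R (\<Sum>b\<in>B. r x b *\<^sub>R y b))"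
        unfolding g_def by (intro linear_map_on_add[OF lin] y0X carr_scaleR X RX)
      also have "\<phi> (\<kappa> *\<^sub>R (\<Sum>b\<in>B. r x b *\<^sub>R y b)) = \<kappa> *\<^sub>R \<phi> (\<Sum>b\<in>B. r x b *\<^sub>R y b)"
        by (intro linear_map_on_scaleR[OF lin] RX)
      also have "\<phi> (\<Sum>b\<in>B. r x b *\<^sub>R y b) = a"
        unfolding a_def by (subst linear_map_on_sum_scaleR[OF Xs lin]) (auto intro: y)
      finally have 1: "\<phi> (g x) = \<phi> y0 + \<kappa> * a" by simp
      have "T (s x) = (\<Sum>b\<in>B. r x b *\<^sub>R T b)"
        unfolding sr[symmetric] using BZ by (intro linear_map_on_sum_scaleR[OF Zs Tlin]) auto
      then have "T (s x) \<phi> = (\<Sum>b\<in>B. r x b * T b \<phi>)" by (simp add: sum_fun_apply)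
      then have "\<bar>a - T (s x) \<phi>\<bar> = \<bar>\<Sum>b\<in>B. r x b * (\<phi> (y b) - T b \<phi>)\<bar>"
        by (simp add: a_def sum_subtractf right_diff_distrib)
      also have "\<dots> \<le> (\<Sum>b\<in>B. \<bar>r x b * (\<phi> (y b) - T b \<phi>)\<bar>)" by (rule sum_abs)
      also have "\<dots> \<le> (\<Sum>b\<in>B. \<bar>r x b\<bar> * \<epsilon>2)"
      proof (rule sum_mono)
        fix b assume "b \<in> B"
        then have "\<bar>\<phi> (y b) - T b \<phi>\<bar> \<le> \<epsilon>2" using y(4) \<phi> by (simp add: less_imp_le)
        then show "\<bar>r x b * (\<phi> (y b) - T b \<phi>)\<bar> \<le> \<bar>r x b\<bar> * \<epsilon>2"
          unfolding abs_mult by (rule mult_left_mono) simp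
      qed
      also have "\<dots> = (\<Sum>b\<in>B. \<bar>r x b\<bar>) * \<epsilon>2" by (simp add: sum_distrib_right)
      also have "\<dots> \<le> (C * ?N (s x)) * \<epsilon>2" using C(2)[of "r x"] e2 by (intro mult_right_mono) (auto simp: sr)
      also have "\<dots> \<le> Q * \<epsilon>2"
        unfolding Q_def using C s_bound[OF x] e2 by (intro mult_right_mono mult_left_mono) auto
      finally have 2: "\<bar>a - T (s x) \<phi>\<bar> \<le> Q * \<epsilon>2" .
      have Tb: "\<bar>T z \<phi>\<bar> \<le> ?N z * F0" if "z \<in> carr ?Z" for z
      proof -
        have "\<bar>T z \<phi>\<bar> \<le> nrm (bidual X1) (T z) * nrm (dual_space X1) \<phi>"
          by (rule dual_apply_le[OF D TZ(1)[OF that] \<phi>D])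
        also have "\<dots> \<le> ?N z * F0"
          using TZ(2)[OF that] F0[OF \<phi>] nrm_nonneg[OF Z that] nrm_nonneg[OF D \<phi>D] by (intro mult_mono) auto
        finally show ?thesis .
      qed
      have "T (s x) \<phi> - h x \<phi> = T (s x - lip_delta p x) \<phi>"
        unfolding T\<delta>[symmetric] using linear_map_on_diff[OF Zs Tlin sZ lip_delta_in_free, of x x] by simp
      then have "\<bar>T (s x) \<phi> - h x \<phi>\<bar> \<le> ?N (s x - lip_delta p x) * F0"
        using Tb[OF carr_diff[OF Z sZ lip_delta_in_free]] by simp
      also have "\<dots> \<le> e1 * F0" using Sd[OF x] F0' unfolding s_def by (intro mult_right_mono)
      finally have 3: "\<bar>T (s x) \<phi> - h x \<phi>\<bar> \<le> \<epsilon> / 4" using e1 by simp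
      have "\<bar>T (s x) \<phi>\<bar> \<le> (lam * d0) * F0"
        using Tb[OF sZ, of x] mult_right_mono[OF s_bound[OF x] F0'] by linarith
      moreover have "Q * \<epsilon>2 \<le> Q" using Q e2 by (intro mult_left_le) auto
      ultimately have "\<bar>a\<bar> \<le> lam * d0 * F0 + Q" using 2 by linarith
      then have "(1 - \<kappa>) * \<bar>a\<bar> \<le> (2 * \<epsilon>2) * (lam * d0 * F0 + Q)" using \<kappa> e2 by (intro mult_mono) auto
      moreover have "\<bar>\<kappa> * a - a\<bar> = (1 - \<kappa>) * \<bar>a\<bar>"
      proof -
        have "\<kappa> * a - a = - ((1 - \<kappa>) * a)" by (simp add: algebra_simps)
        then show ?thesis using \<kappa> by (simp add: abs_mult)
      qed
      ultimately have 4: "\<bar>\<kappa> * a - a\<bar> \<le> (2 * \<epsilon>2) * (lam * d0 * F0 + Q)" by simp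
      have "f x \<phi> = f p \<phi> + h x \<phi>" by (simp add: h_def)
      then have "\<bar>\<phi> (g x) - f x \<phi>\<bar> \<le> \<bar>\<phi> y0 - f p \<phi>\<bar> + \<bar>\<kappa> * a - a\<bar> + \<bar>a - T (s x) \<phi>\<bar> + \<bar>T (s x) \<phi> - h x \<phi>\<bar>"
        unfolding 1 by linarith
      also have "\<dots> < \<epsilon> / 4 + (2 * \<epsilon>2) * (lam * d0 * F0 + Q) + Q * \<epsilon>2 + \<epsilon> / 4"
        using y0(2)[OF \<phi>] 2 3 4 by linarith
      also have "\<dots> \<le> \<epsilon> / 4 + \<epsilon>2 * H + \<epsilon> / 4" using e2 by (simp add: H_def algebra_simps)
      also have "\<dots> \<le> \<epsilon>" using e2 \<epsilon> by linarith
      finally show ?thesis .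
    qed
    moreover have "g \<in> Lip_pair lam M2 X1 X2" using gX glip gM by (auto simp: Lip_pair_def)
    ultimately show "\<exists>g\<in>Lip_pair lam M2 X1 X2. \<forall>x\<in>E. \<forall>\<phi>\<in>\<Phi>. \<bar>\<phi> (g x) - f x \<phi>\<bar> < \<epsilon>" by blast
  qed (rule fX)
qed

section \<open>Finite approximations of a separable space\<close>

lemma nearest_point_sequence:
  fixes A :: "'a::metric_space set"
  assumes A: "countable A" "A \<noteq> {}"
  shows "\<exists>D r. (\<forall>n. finite (D n) \<and> D n \<subseteq> A) \<and> (\<forall>n x. r n x \<in> D n) \<and>
     (\<forall>x\<in>closure A. (\<lambda>n. r n x) \<longlonglongrightarrow> x)"
proof -
  define d where "d = from_nat_into A"
  have dA: "range d = A" unfolding d_def using A by (simp add: range_from_nat_into)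
  define r where "r n x = arg_min_on (\<lambda>y. dist y x) (d ` {..n::nat})" for n x
  have r: "r n x \<in> d ` {..n}" "\<And>k. k \<le> n \<Longrightarrow> dist (r n x) x \<le> dist (d k) x" for n x
    unfolding r_def by (auto intro!: arg_min_if_finite(1) arg_min_least)
  have "(\<lambda>n. r n x) \<longlonglongrightarrow> x" if x: "x \<in> closure A" for x
  proof (rule metric_LIMSEQ_I)
    fix e :: real assume "e > 0"
    then obtain a where "a \<in> A" "dist a x < e" using x closure_approachable by blast
    then obtain k where "dist (d k) x < e" using dA by auto
    then have "\<forall>n\<ge>k. dist (r n x) x < e" using r(2) le_less_trans by blast
    then show "\<exists>N. \<forall>n\<ge>N. dist (r n x) x < e" ..
  qed
  moreover have "d ` {..n} \<subseteq> A" for n using dA by auto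
  ultimately show ?thesis using r(1) by (intro exI[of _ "\<lambda>n. d ` {..n}"] exI[of _ r]) simp
qed

lemma countable_dense_in_subset:
  fixes M :: "'a::metric_space set"
  assumes C: "countable C" "closure C = (UNIV :: 'a set)"
  shows "\<exists>A. countable A \<and> A \<subseteq> M \<and> M \<subseteq> closure A"
proof -
  define A where "A = (\<lambda>(c, k). SOME y. y \<in> M \<and> dist c y < 1 / real (Suc k)) `
    {(c, k). c \<in> C \<and> (\<exists>y\<in>M. dist c y < 1 / real (Suc k))}"
  have sub: "A \<subseteq> M" unfolding A_def by (auto intro: someI2)
  have "countable {(c, k). c \<in> C \<and> (\<exists>y\<in>M. dist c y < 1 / real (Suc k))}"
    by (rule countable_subset[of _ "C \<times> UNIV"]) (use C in auto)
  then have cnt: "countable A" unfolding A_def by (rule countable_image)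
  have "x \<in> closure A" if x: "x \<in> M" for x
    unfolding closure_approachable
  proof (intro allI impI)
    fix e :: real assume "e > 0"
    then obtain k where k: "1 / real (Suc k) < e / 2" using nat_approx_posE[of "e / 2"] by auto
    have "x \<in> closure C" using C by simp
    then obtain c where c: "c \<in> C" "dist c x < 1 / real (Suc k)"
      using closure_approachable[of x C] by (metis divide_pos_pos of_nat_0_less_iff zero_less_Suc zero_less_one)
    define y where "y = (SOME y. y \<in> M \<and> dist c y < 1 / real (Suc k))"
    have y: "y \<in> M \<and> dist c y < 1 / real (Suc k)" unfolding y_def by (rule someI[of _ x]) (use x c in auto)
    have "y \<in> A" unfolding A_def y_def using c x by (intro image_eqI[of _ _ "(c, k)"]) auto
    moreover have "dist y x < e" using y c k dist_triangle[of y x c] by (simp add: dist_commute)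
    ultimately show "\<exists>y\<in>A. dist y x < e" by blast
  qed
  then show ?thesis using sub cnt by blast
qed

text \<open>
  Points of \<open>M\<close> are approximated from a dense sequence of \<open>M\<close>, all other points from a dense sequence of
  the whole space.
\<close>

lemma separable_pair_approximation:
  fixes M :: "'a::metric_space set"
  assumes sep: "separable_space (euclidean :: 'a topology)" and M: "M \<noteq> {}"
  shows "\<exists>D r. (\<forall>n. finite (D n)) \<and> (\<forall>n x. r n x \<in> D n) \<and> (\<forall>n. \<forall>x\<in>M. r n x \<in> M) \<and>
     (\<forall>x. (\<lambda>n. r n x) \<longlonglongrightarrow> x)"
proof -
  obtain C :: "'a set" where C: "countable C" "closure C = UNIV"
    using sep by (auto simp: separable_space_def)
  then have "C \<noteq> {}" by auto
  obtain A where A: "countable A" "A \<subseteq> M" "M \<subseteq> closure A" using countable_dense_in_subset[OF C] by blast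
  then have "A \<noteq> {}" using M by auto
  obtain D1 r1 where 1: "\<forall>n. finite (D1 n) \<and> D1 n \<subseteq> C" "\<forall>n x. r1 n x \<in> D1 n"
      "\<forall>x\<in>closure C. (\<lambda>n. r1 n x) \<longlonglongrightarrow> x"
    using nearest_point_sequence[OF C(1) \<open>C \<noteq> {}\<close>] by (elim exE conjE)
  obtain D2 r2 where 2: "\<forall>n. finite (D2 n) \<and> D2 n \<subseteq> A" "\<forall>n x. r2 n x \<in> D2 n"
      "\<forall>x\<in>closure A. (\<lambda>n. r2 n x) \<longlonglongrightarrow> x"
    using nearest_point_sequence[OF A(1) \<open>A \<noteq> {}\<close>] by (elim exE conjE)
  show ?thesis
  proof (intro exI[of _ "\<lambda>n. D1 n \<union> D2 n"] exI[of _ "\<lambda>n x. if x \<in> M then r2 n x else r1 n x"]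
      conjI allI ballI)
    show "finite (D1 n \<union> D2 n)" "(if x \<in> M then r2 n x else r1 n x) \<in> D1 n \<union> D2 n" for n x
      using 1 2 by auto
    show "(if x \<in> M then r2 n x else r1 n x) \<in> M" if "x \<in> M" for n x
      using 2(1)[rule_format, of n] 2(2)[rule_format, of n x] A(2) that by auto
    show "(\<lambda>n. if x \<in> M then r2 n x else r1 n x) \<longlonglongrightarrow> x" for x
      using 1(3) 2(3) A(3) C(2) by (cases "x \<in> M") auto
  qed
qed

section \<open>Copies of Banach spaces in a given vector space\<close>

text \<open>
  The norm is transported along \<open>J\<close>, which is meant to be linear and injective on \<open>carr Y\<close>.
\<close>

definition isometric_copy :: "('w \<Rightarrow> 'v) \<Rightarrow> 'w::real_vector nspace \<Rightarrow> 'v::real_vector nspace" where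
  "isometric_copy J Y = \<lparr>carr = J ` carr Y, nrm = (\<lambda>v. nrm Y (inv_into (carr Y) J v))\<rparr>"

lemma carr_isometric_copy: "carr (isometric_copy J Y) = J ` carr Y"
  by (simp add: isometric_copy_def)

lemma nrm_isometric_copy: "inj_on J (carr Y) \<Longrightarrow> y \<in> carr Y \<Longrightarrow> nrm (isometric_copy J Y) (J y) = nrm Y y"
  by (simp add: isometric_copy_def)

lemma normed_space_isometric_copy:
  assumes Y: "normed_space Y" and J: "linear J" "inj_on J (carr Y)"
  shows "normed_space (isometric_copy J Y)"
  unfolding normed_space_def carr_isometric_copy
proof (intro conjI ballI allI)
  show "subspace (J ` carr Y)" using J(1) normed_space_subspace[OF Y] by (rule linear_subspace_image)
next
  fix v assume "v \<in> J ` carr Y"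
  then obtain x where x: "x \<in> carr Y" "v = J x" by auto
  show "0 \<le> nrm (isometric_copy J Y) v" using x by (simp add: nrm_isometric_copy J nrm_nonneg Y)
  show "nrm (isometric_copy J Y) v = 0 \<longleftrightarrow> v = 0"
    using x inj_on_eq_iff[OF J(2) x(1) carr_0[OF Y]] by (simp add: nrm_isometric_copy J nrm_eq_0_iff Y linear_0)
  fix w assume "w \<in> J ` carr Y"
  then obtain y where y: "y \<in> carr Y" "w = J y" by auto
  show "nrm (isometric_copy J Y) (v + w) \<le> nrm (isometric_copy J Y) v + nrm (isometric_copy J Y) w"
    using x y by (simp add: linear_add[OF J(1), symmetric] nrm_isometric_copy J carr_add Y nrm_add_le)
next
  fix c v assume "v \<in> J ` carr Y"
  then obtain x where x: "x \<in> carr Y" "v = J x" by auto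
  show "nrm (isometric_copy J Y) (c *\<^sub>R v) = \<bar>c\<bar> * nrm (isometric_copy J Y) v"
    using x by (simp add: linear_scale[OF J(1), symmetric] nrm_isometric_copy J carr_scaleR Y nrm_scaleR)
qed

lemma nrm_isometric_copy_diff:
  assumes "normed_space Y" "linear J" "inj_on J (carr Y)" "x \<in> carr Y" "y \<in> carr Y"
  shows "nrm (isometric_copy J Y) (J x - J y) = nrm Y (x - y)"
  using assms by (simp add: linear_diff[symmetric] nrm_isometric_copy carr_diff)

lemma banach_space_isometric_copy:
  assumes Y: "banach_space Y" and J: "linear J" "inj_on J (carr Y)"
  shows "banach_space (isometric_copy J Y)"
  unfolding banach_space_iff
proof (intro conjI allI impI)
  note nY = banach_space_normed[OF Y]
  let ?X = "isometric_copy J Y"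
  show "normed_space ?X" by (rule normed_space_isometric_copy[OF nY J])
  fix \<sigma> :: "nat \<Rightarrow> _" assume \<sigma>: "\<forall>n. \<sigma> n \<in> carr ?X" and C: "\<forall>e>0. \<exists>N. \<forall>m\<ge>N. \<forall>n\<ge>N. nrm ?X (\<sigma> m - \<sigma> n) < e"
  have "\<forall>n. \<exists>y. y \<in> carr Y \<and> \<sigma> n = J y" using \<sigma> by (auto simp: carr_isometric_copy)
  then obtain \<tau> where \<tau>: "\<And>n. \<tau> n \<in> carr Y" "\<And>n. \<sigma> n = J (\<tau> n)" by metis
  note diff = nrm_isometric_copy_diff[OF nY J]
  obtain l where l: "l \<in> carr Y" "\<And>e. e > 0 \<Longrightarrow> \<exists>N. \<forall>n\<ge>N. nrm Y (\<tau> n - l) < e"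
    by (rule banach_space_complete[OF Y, of \<tau>]) (use C \<tau> diff in auto)
  have "\<forall>e>0. \<exists>N. \<forall>n\<ge>N. nrm ?X (\<sigma> n - J l) < e" using l \<tau> diff by simp
  then show "\<exists>l\<in>carr ?X. \<forall>e>0. \<exists>N. \<forall>n\<ge>N. nrm ?X (\<sigma> n - l) < e"
    using l(1) by (auto simp: carr_isometric_copy)
qed

lemma closed_subspace_isometric_copy:
  assumes Y: "normed_space Y" and J: "linear J" "inj_on J (carr Y)" and W: "closed_subspace Y W"
  shows "closed_subspace (isometric_copy J Y) (J ` W)"
proof -
  note W' = W[unfolded closed_subspace_iff[OF Y]]
  show ?thesis
    unfolding closed_subspace_iff[OF normed_space_isometric_copy[OF Y J]] carr_isometric_copy
  proof (intro conjI ballI impI)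
    show "subspace (J ` W)" using W' by (intro linear_subspace_image J(1)) auto
    show "J ` W \<subseteq> J ` carr Y" using W' by auto
    fix v assume "v \<in> J ` carr Y" and ap: "\<forall>e>0. \<exists>w\<in>J ` W. nrm (isometric_copy J Y) (v - w) < e"
    then obtain x where x: "x \<in> carr Y" "v = J x" by auto
    have "\<forall>e>0. \<exists>w\<in>W. nrm Y (x - w) < e"
    proof (intro allI impI)
      fix e :: real assume "e > 0"
      then obtain w where w: "w \<in> W" "nrm (isometric_copy J Y) (J x - J w) < e" using ap x by blast
      then show "\<exists>w\<in>W. nrm Y (x - w) < e"
        using nrm_isometric_copy_diff[OF Y J x(1), of w] W' by (intro bexI[of _ w]) auto
    qed
    then show "v \<in> J ` W" using W' x by blast
  qed
qed

text \<open>
  A basis of the span of \<open>V\<close> can be chosen inside \<open>V\<close>, so it has at most continuum many elements and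
  injects into an independent set of the target.
\<close>

lemma linear_injection_exists:
  fixes V :: "'w::real_vector set"
  assumes cont: "continuum_dimensional TYPE('v::real_vector)" and V: "V \<lesssim> (UNIV :: real set)"
  shows "\<exists>J :: 'w \<Rightarrow> 'v. linear J \<and> inj_on J V"
proof -
  obtain B :: "'v set" where B: "independent B" "(UNIV :: real set) \<lesssim> B"
    using cont by (auto simp: continuum_dimensional_def)
  obtain BV where BV: "BV \<subseteq> V" "independent BV" "V \<subseteq> span BV" by (rule maximal_independent_subset)
  have "BV \<lesssim> B" using subset_imp_lepoll[OF BV(1)] V B(2) by (meson lepoll_trans)
  then obtain h where h: "inj_on h BV" "h ` BV \<subseteq> B" by (auto simp: lepoll_def)
  obtain J where J: "linear J" "\<And>x. x \<in> BV \<Longrightarrow> J x = h x"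
    using linear_independent_extend[OF BV(2), of h] by blast
  have "J ` BV = h ` BV" using J(2) by simp
  then have "independent (J ` BV)" using h(2) B(1) independent_mono by metis
  moreover have "inj_on J BV" using h(1) J(2) by (simp cong: inj_on_cong)
  ultimately have "inj_on J (span BV)" using J(1) linear_inj_on_span_independent_image by blast
  then show ?thesis using J(1) BV(3) inj_on_subset by blast
qed

text \<open>
  There are as many reals as sets of naturals, and a sequence of sets of naturals is a set of pairs.
\<close>

lemma real_sequences_lepoll_reals: "(UNIV :: (nat \<Rightarrow> real) set) \<lesssim> (UNIV :: real set)"
proof -
  have "(UNIV :: real set) \<lesssim> (UNIV :: nat set set)"
    using nat_sets_eqpoll_reals eqpoll_imp_lepoll eqpoll_sym by blast
  then obtain g :: "real \<Rightarrow> nat set" where g: "inj g" by (auto simp: lepoll_def)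
  define G where "G f = {k. snd (prod_decode k) \<in> g (f (fst (prod_decode k)))}" for f :: "nat \<Rightarrow> real"
  have "inj G"
  proof (rule injI)
    fix a b assume ab: "G a = G b"
    have "g (a n) = g (b n)" for n
    proof (rule set_eqI)
      fix m show "m \<in> g (a n) \<longleftrightarrow> m \<in> g (b n)"
        using ab[unfolded set_eq_iff, rule_format, of "prod_encode (n, m)"] by (simp add: G_def)
    qed
    then show "a = b" using g by (auto simp: inj_def)
  qed
  then have "(UNIV :: (nat \<Rightarrow> real) set) \<lesssim> (UNIV :: nat set set)" by (auto simp: lepoll_def)
  then show ?thesis using nat_sets_eqpoll_reals eqpoll_imp_lepoll lepoll_trans by blast
qed

lemma finite_span_lepoll_reals:
  fixes B :: "'w::real_vector set"
  assumes B: "finite B" shows "span B \<lesssim> (UNIV :: real set)"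
proof -
  obtain k and b :: "nat \<Rightarrow> 'w" where b: "B = b ` {i. i < k}" "inj_on b {i. i < k}"
    using finite_imp_nat_seg_image_inj_on[OF B] by auto
  have "span B \<subseteq> (\<lambda>c :: nat \<Rightarrow> real. \<Sum>i<k. c i *\<^sub>R b i) ` UNIV"
  proof
    fix v assume "v \<in> span B"
    then obtain c where "v = (\<Sum>x\<in>B. c x *\<^sub>R x)" unfolding span_finite[OF B] by auto
    also have "\<dots> = (\<Sum>i<k. c (b i) *\<^sub>R b i)" unfolding b(1) lessThan_def by (rule sum.reindex_cong[OF b(2)]) auto
    finally show "v \<in> (\<lambda>c :: nat \<Rightarrow> real. \<Sum>i<k. c i *\<^sub>R b i) ` UNIV" by auto
  qed
  then have "span B \<lesssim> (UNIV :: (nat \<Rightarrow> real) set)"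
    using subset_imp_lepoll image_lepoll lepoll_trans by blast
  then show ?thesis using real_sequences_lepoll_reals lepoll_trans by blast
qed

lemma sequences_lepoll_reals:
  fixes V :: "nat \<Rightarrow> 'w set"
  assumes "\<And>n. V n \<lesssim> (UNIV :: real set)" shows "{\<sigma>. \<forall>n. \<sigma> n \<in> V n} \<lesssim> (UNIV :: real set)"
proof -
  have "\<forall>n. \<exists>f :: 'w \<Rightarrow> real. inj_on f (V n)" using assms by (auto simp: lepoll_def)
  then obtain f :: "nat \<Rightarrow> 'w \<Rightarrow> real" where f: "\<And>n. inj_on (f n) (V n)" by metis
  have "inj_on (\<lambda>\<sigma> n. f n (\<sigma> n)) {\<sigma>. \<forall>n. \<sigma> n \<in> V n}"
  proof (rule inj_onI, rule ext)
    fix \<sigma> \<tau> n assume "\<sigma> \<in> {\<sigma>. \<forall>n. \<sigma> n \<in> V n}" "\<tau> \<in> {\<sigma>. \<forall>n. \<sigma> n \<in> V n}" "(\<lambda>n. f n (\<sigma> n)) = (\<lambda>n. f n (\<tau> n))"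
    then show "\<sigma> n = \<tau> n" using inj_onD[OF f[of n], of "\<sigma> n" "\<tau> n"] by (auto dest: fun_cong[of _ _ n])
  qed
  then have "{\<sigma>. \<forall>n. \<sigma> n \<in> V n} \<lesssim> (UNIV :: (nat \<Rightarrow> real) set)" by (auto simp: lepoll_def)
  then show ?thesis using real_sequences_lepoll_reals lepoll_trans by blast
qed

section \<open>Spaces of convergent sequences\<close>

text \<open>
  Entry \<open>0\<close> of a sequence is its limit. With this convention, passing to the limit is an evaluation,
  hence linear and of norm at most \<open>1\<close>.
\<close>

definition convergent_sequences :: "'z::real_vector nspace \<Rightarrow> (nat \<Rightarrow> 'z set) \<Rightarrow> (nat \<Rightarrow> 'z) nspace" where
  "convergent_sequences Z V =
     \<lparr>carr = {\<sigma>. (\<forall>n. \<sigma> n \<in> V n) \<and> (\<lambda>n. nrm Z (\<sigma> n - \<sigma> 0)) \<longlonglongrightarrow> 0},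
      nrm = (\<lambda>\<sigma>. SUP n. nrm Z (\<sigma> n))\<rparr>"

lemma in_convergent_sequences_iff:
  "\<sigma> \<in> carr (convergent_sequences Z V) \<longleftrightarrow> (\<forall>n. \<sigma> n \<in> V n) \<and> (\<lambda>n. nrm Z (\<sigma> n - \<sigma> 0)) \<longlonglongrightarrow> 0"
  and nrm_convergent_sequences: "nrm (convergent_sequences Z V) \<sigma> = (SUP n. nrm Z (\<sigma> n))"
  by (simp_all add: convergent_sequences_def)

text \<open>
  The limit stored at entry \<open>0\<close> is kept.
\<close>

definition tail_from :: "nat \<Rightarrow> (nat \<Rightarrow> 'z::zero) \<Rightarrow> nat \<Rightarrow> 'z" where
  "tail_from n \<sigma> = (\<lambda>k. if 0 < k \<and> k \<le> n then 0 else \<sigma> k)"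

context
  fixes Z :: "'z::real_vector nspace" and V :: "nat \<Rightarrow> 'z set"
  assumes Z: "banach_space Z" and V: "\<And>n. closed_subspace Z (V n)"
begin

private lemma nZ: "normed_space Z" by (rule banach_space_normed[OF Z])

private lemma VZ: "subspace (V n)" "x \<in> V n \<Longrightarrow> x \<in> carr Z"
  "x \<in> carr Z \<Longrightarrow> (\<And>e. e > 0 \<Longrightarrow> \<exists>w\<in>V n. nrm Z (x - w) < e) \<Longrightarrow> x \<in> V n"
  using V[of n] by (auto simp: closed_subspace_iff[OF nZ])

private abbreviation "Y \<equiv> convergent_sequences Z V"

lemma convergent_sequences_apply: "\<sigma> \<in> carr Y \<Longrightarrow> \<sigma> n \<in> carr Z"
  using VZ(2) by (auto simp: in_convergent_sequences_iff)

lemma convergent_sequencesI: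
  assumes "\<And>n. \<sigma> n \<in> V n" "a \<longlonglongrightarrow> 0" "\<forall>\<^sub>F n in sequentially. nrm Z (\<sigma> n - \<sigma> 0) \<le> a n"
  shows "\<sigma> \<in> carr Y"
proof -
  have "0 \<le> nrm Z (\<sigma> n - \<sigma> 0)" for n using assms(1) VZ(2) by (intro nrm_nonneg carr_diff nZ) auto
  then have "(\<lambda>n. nrm Z (\<sigma> n - \<sigma> 0)) \<longlonglongrightarrow> 0"
    using assms(3) by (intro Lim_null_comparison[OF _ assms(2)]) simp
  then show ?thesis using assms(1) by (simp add: in_convergent_sequences_iff)
qed

lemma nrm_apply_le_convergent_sequences:
  assumes \<sigma>: "\<sigma> \<in> carr Y" shows "nrm Z (\<sigma> n) \<le> nrm Y \<sigma>"
proof -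
  have "Bseq (\<lambda>n. nrm Z (\<sigma> n - \<sigma> 0))"
    using \<sigma> by (auto simp: in_convergent_sequences_iff intro: convergent_imp_Bseq convergentI)
  then obtain K where K: "\<And>n. norm (nrm Z (\<sigma> n - \<sigma> 0)) \<le> K" by (rule BseqE) blast
  have "nrm Z (\<sigma> i) \<le> K + nrm Z (\<sigma> 0)" for i
    using nrm_le_diff[OF nZ convergent_sequences_apply[OF \<sigma>] convergent_sequences_apply[OF \<sigma>], of i 0] K[of i]
    by simp
  then have "bdd_above (range (\<lambda>n. nrm Z (\<sigma> n)))" by (intro bdd_aboveI[of _ "K + nrm Z (\<sigma> 0)"]) auto
  then show ?thesis unfolding nrm_convergent_sequences by (intro cSUP_upper) auto
qed

lemma nrm_convergent_sequences_le: "(\<And>n. nrm Z (\<sigma> n) \<le> K) \<Longrightarrow> nrm Y \<sigma> \<le> K"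
  unfolding nrm_convergent_sequences by (rule cSUP_least) auto

lemma normed_space_convergent_sequences: "normed_space Y"
proof (rule normed_spaceI)
  show "0 \<in> carr Y" using VZ(1) nZ by (simp add: in_convergent_sequences_iff subspace_0)
  fix \<sigma> assume \<sigma>: "\<sigma> \<in> carr Y"
  note \<sigma>Z = convergent_sequences_apply[OF \<sigma>] and \<sigma>le = nrm_apply_le_convergent_sequences[OF \<sigma>]
  show "0 \<le> nrm Y \<sigma>" using \<sigma>le[of 0] nrm_nonneg[OF nZ \<sigma>Z, of 0] by simp
  show "\<sigma> = 0" if "nrm Y \<sigma> = 0"
  proof
    fix n show "\<sigma> n = 0 n"
      using \<sigma>le[of n] that nrm_nonneg[OF nZ \<sigma>Z, of n] nrm_eq_0_iff[OF nZ \<sigma>Z, of n] by simp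
  qed
  fix c
  have "nrm Z ((c *\<^sub>R \<sigma>) n - (c *\<^sub>R \<sigma>) 0) = \<bar>c\<bar> * nrm Z (\<sigma> n - \<sigma> 0)" for n
    using \<sigma>Z by (simp add: scaleR_diff_right[symmetric] nrm_scaleR nZ carr_diff)
  then show "c *\<^sub>R \<sigma> \<in> carr Y"
    using \<sigma> tendsto_mult_left[of "\<lambda>n. nrm Z (\<sigma> n - \<sigma> 0)" 0 sequentially "\<bar>c\<bar>"]
    by (simp add: in_convergent_sequences_iff subspace_scale VZ(1))
  show "nrm Y (c *\<^sub>R \<sigma>) \<le> \<bar>c\<bar> * nrm Y \<sigma>"
    using \<sigma>le \<sigma>Z by (intro nrm_convergent_sequences_le) (simp add: nrm_scaleR nZ mult_left_mono)
next
  fix \<sigma> \<tau> assume \<sigma>: "\<sigma> \<in> carr Y" and \<tau>: "\<tau> \<in> carr Y"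
  note \<sigma>Z = convergent_sequences_apply[OF \<sigma>] and \<tau>Z = convergent_sequences_apply[OF \<tau>]
  show "\<sigma> + \<tau> \<in> carr Y"
  proof (rule convergent_sequencesI)
    show "(\<sigma> + \<tau>) n \<in> V n" for n using \<sigma> \<tau> VZ(1) by (simp add: in_convergent_sequences_iff subspace_add)
    show "(\<lambda>n. nrm Z (\<sigma> n - \<sigma> 0) + nrm Z (\<tau> n - \<tau> 0)) \<longlonglongrightarrow> 0"
      using \<sigma> \<tau> by (auto simp: in_convergent_sequences_iff intro: tendsto_add_zero)
    have "(\<sigma> + \<tau>) n - (\<sigma> + \<tau>) 0 = (\<sigma> n - \<sigma> 0) + (\<tau> n - \<tau> 0)" for n by simp
    then show "\<forall>\<^sub>F n in sequentially. nrm Z ((\<sigma> + \<tau>) n - (\<sigma> + \<tau>) 0) \<le> nrm Z (\<sigma> n - \<sigma> 0) + nrm Z (\<tau> n - \<tau> 0)"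
      using nrm_add_le[OF nZ carr_diff[OF nZ \<sigma>Z \<sigma>Z] carr_diff[OF nZ \<tau>Z \<tau>Z]] by (intro always_eventually allI) metis
  qed
  have "nrm Z (\<sigma> n + \<tau> n) \<le> nrm Y \<sigma> + nrm Y \<tau>" for n
    using nrm_add_le[OF nZ \<sigma>Z[of n] \<tau>Z[of n]]
      nrm_apply_le_convergent_sequences[OF \<sigma>, of n] nrm_apply_le_convergent_sequences[OF \<tau>, of n] by linarith
  then show "nrm Y (\<sigma> + \<tau>) \<le> nrm Y \<sigma> + nrm Y \<tau>" by (intro nrm_convergent_sequences_le) simp
qed

text \<open>
  The limit is determined by the other entries. This bounds the cardinality of the space by that of
  the sequences with entries in \<open>V (Suc n)\<close>, whatever \<open>V 0\<close> is.
\<close>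

lemma convergent_sequences_inj: "inj_on (\<lambda>\<sigma> n. \<sigma> (Suc n)) (carr Y)"
proof (rule inj_onI)
  fix \<sigma> \<tau> assume \<sigma>: "\<sigma> \<in> carr Y" and \<tau>: "\<tau> \<in> carr Y" and "(\<lambda>n. \<sigma> (Suc n)) = (\<lambda>n. \<tau> (Suc n))"
  then have eq: "\<sigma> (Suc n) = \<tau> (Suc n)" for n by (rule_tac fun_cong)
  define d where "d = \<sigma> - \<tau>"
  have d: "d \<in> carr Y" unfolding d_def using \<sigma> \<tau> by (intro carr_diff normed_space_convergent_sequences)
  have "nrm Z (d (Suc n) - d 0) = nrm Z (d 0)" for n
    using eq nrm_neg[OF nZ convergent_sequences_apply[OF d], of 0] by (simp add: d_def)
  then have "(\<lambda>n. nrm Z (d 0)) \<longlonglongrightarrow> 0"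
    using LIMSEQ_Suc[of "\<lambda>n. nrm Z (d n - d 0)" 0] d by (simp add: in_convergent_sequences_iff)
  then have "nrm Z (d 0) = 0" by (simp add: LIMSEQ_const_iff)
  then have "d 0 = 0" using nrm_eq_0_iff[OF nZ convergent_sequences_apply[OF d]] by simp
  then have "\<sigma> n = \<tau> n" for n using eq by (cases n) (auto simp: d_def)
  then show "\<sigma> = \<tau>" by (rule ext)
qed

lemma banach_space_convergent_sequences: "banach_space Y"
  unfolding banach_space_iff
proof (intro conjI allI impI)
  show nY: "normed_space Y" by (rule normed_space_convergent_sequences)
  fix \<sigma> :: "nat \<Rightarrow> nat \<Rightarrow> 'z"
  assume \<sigma>: "\<forall>k. \<sigma> k \<in> carr Y" and C: "\<forall>e>0. \<exists>N. \<forall>m\<ge>N. \<forall>n\<ge>N. nrm Y (\<sigma> m - \<sigma> n) < e"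
  have \<sigma>Z: "\<sigma> k n \<in> carr Z" for k n using convergent_sequences_apply \<sigma> by blast
  have le: "nrm Z (\<sigma> k n - \<sigma> j n) \<le> nrm Y (\<sigma> k - \<sigma> j)" for k j n
    using nrm_apply_le_convergent_sequences[OF carr_diff[OF nY], of "\<sigma> k" "\<sigma> j" n] \<sigma> by simp
  have "\<exists>l. l \<in> carr Z \<and> (\<forall>e>0. \<exists>N. \<forall>k\<ge>N. nrm Z (\<sigma> k n - l) < e)" for n
  proof -
    have "\<exists>N. \<forall>i\<ge>N. \<forall>j\<ge>N. nrm Z (\<sigma> i n - \<sigma> j n) < e" if "e > 0" for e
    proof -
      obtain N where N: "\<forall>i\<ge>N. \<forall>j\<ge>N. nrm Y (\<sigma> i - \<sigma> j) < e" using C \<open>e > 0\<close> by blast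
      then have "\<forall>i\<ge>N. \<forall>j\<ge>N. nrm Z (\<sigma> i n - \<sigma> j n) < e" using le le_less_trans by blast
      then show ?thesis ..
    qed
    then obtain l where "l \<in> carr Z" "\<And>e. e > 0 \<Longrightarrow> \<exists>N. \<forall>k\<ge>N. nrm Z (\<sigma> k n - l) < e"
      by (rule banach_space_complete[OF Z, of "\<lambda>k. \<sigma> k n", rotated]) (auto simp: \<sigma>Z)
    then show ?thesis by blast
  qed
  then obtain l where l: "\<And>n. l n \<in> carr Z" "\<And>n e. e > 0 \<Longrightarrow> \<exists>N. \<forall>k\<ge>N. nrm Z (\<sigma> k n - l n) < e"
    by metis
  have unif: "\<exists>N. \<forall>k\<ge>N. \<forall>n. nrm Z (\<sigma> k n - l n) < e" if "e > 0" for e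
  proof -
    have e: "e / 2 > 0" using that by simp
    obtain N where N: "\<And>i j. i \<ge> N \<Longrightarrow> j \<ge> N \<Longrightarrow> nrm Y (\<sigma> i - \<sigma> j) < e / 2" using C e by metis
    have "nrm Z (\<sigma> k n - l n) < e" if k: "k \<ge> N" for k n
    proof -
      obtain K where K: "\<And>j. j \<ge> K \<Longrightarrow> nrm Z (\<sigma> j n - l n) < e / 2" using l(2)[OF e, of n] by blast
      define j where "j = max N K"
      have "nrm Z (\<sigma> k n - l n) \<le> nrm Z (\<sigma> k n - \<sigma> j n) + nrm Z (\<sigma> j n - l n)"
        by (intro nrm_diff_triangle nZ \<sigma>Z l)
      also have "\<dots> < e" using le[of k n j] N[OF k, of j] K[of j] by (simp add: j_def)
      finally show ?thesis .
    qed
    then show ?thesis by blast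
  qed
  have lV: "l n \<in> V n" for n
  proof (rule VZ(3)[OF l(1)])
    fix e :: real assume "e > 0"
    then obtain k where "nrm Z (\<sigma> k n - l n) < e" using l(2)[of e n] by blast
    moreover have "\<sigma> k n \<in> V n" using \<sigma> by (simp add: in_convergent_sequences_iff)
    ultimately show "\<exists>w\<in>V n. nrm Z (l n - w) < e"
      using nrm_diff_commute[OF nZ l(1) \<sigma>Z] by (intro bexI[of _ "\<sigma> k n"]) auto
  qed
  have "(\<lambda>n. nrm Z (l n - l 0)) \<longlonglongrightarrow> 0"
  proof (rule LIMSEQ_I)
    fix e :: real assume "e > 0"
    then have e: "e / 3 > 0" by simp
    obtain k where k: "\<And>n. nrm Z (\<sigma> k n - l n) < e / 3" using unif[OF e] by blast
    have "(\<lambda>n. nrm Z (\<sigma> k n - \<sigma> k 0)) \<longlonglongrightarrow> 0" using \<sigma> by (simp add: in_convergent_sequences_iff)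
    from LIMSEQ_D[OF this e] obtain N where N: "\<And>n. n \<ge> N \<Longrightarrow> \<bar>nrm Z (\<sigma> k n - \<sigma> k 0)\<bar> < e / 3" by auto
    have "nrm Z (l n - l 0) < e" if "n \<ge> N" for n
    proof -
      have "nrm Z (l n - l 0) \<le> nrm Z (l n - \<sigma> k n) + nrm Z (\<sigma> k n - l 0)"
        by (intro nrm_diff_triangle nZ \<sigma>Z l)
      also have "nrm Z (\<sigma> k n - l 0) \<le> nrm Z (\<sigma> k n - \<sigma> k 0) + nrm Z (\<sigma> k 0 - l 0)"
        by (intro nrm_diff_triangle nZ \<sigma>Z l)
      also have "nrm Z (l n - \<sigma> k n) = nrm Z (\<sigma> k n - l n)" by (intro nrm_diff_commute nZ \<sigma>Z l)
      finally show ?thesis using k[of n] k[of 0] N[OF that] by linarith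
    qed
    then show "\<exists>N. \<forall>n\<ge>N. norm (nrm Z (l n - l 0) - 0) < e"
      using nrm_nonneg[OF nZ carr_diff[OF nZ l(1) l(1)]] by (intro exI[of _ N]) simp
  qed
  then have lY: "l \<in> carr Y" using lV by (simp add: in_convergent_sequences_iff)
  show "\<exists>l\<in>carr Y. \<forall>e>0. \<exists>N. \<forall>n\<ge>N. nrm Y (\<sigma> n - l) < e"
  proof (intro bexI[OF _ lY] allI impI)
    fix e :: real assume "e > 0"
    then have "e / 2 > 0" by simp
    then obtain N where N: "\<And>k n. k \<ge> N \<Longrightarrow> nrm Z (\<sigma> k n - l n) < e / 2" using unif by blast
    have "nrm Y (\<sigma> k - l) \<le> e / 2" if "k \<ge> N" for k
      using N[OF that] by (intro nrm_convergent_sequences_le) (simp add: less_imp_le)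
    then have "\<forall>k\<ge>N. nrm Y (\<sigma> k - l) < e" using \<open>e > 0\<close> by fastforce
    then show "\<exists>N. \<forall>n\<ge>N. nrm Y (\<sigma> n - l) < e" ..
  qed
qed

lemma closed_subspace_convergent_sequences:
  assumes V': "\<And>n. closed_subspace Z (V' n)"
  shows "closed_subspace Y {\<sigma> \<in> carr Y. \<forall>n. \<sigma> n \<in> V' n}"
  unfolding closed_subspace_iff[OF normed_space_convergent_sequences]
proof (intro conjI ballI impI)
  note nY = normed_space_convergent_sequences
  have V'Z: "subspace (V' n)" "x \<in> V' n \<Longrightarrow> x \<in> carr Z"
    "x \<in> carr Z \<Longrightarrow> (\<And>e. e > 0 \<Longrightarrow> \<exists>w\<in>V' n. nrm Z (x - w) < e) \<Longrightarrow> x \<in> V' n" for x n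
    using V'[of n] by (auto simp: closed_subspace_iff[OF nZ])
  show "subspace {\<sigma> \<in> carr Y. \<forall>n. \<sigma> n \<in> V' n}"
    by (rule subspaceI) (simp_all add: carr_intros nY subspace_0 subspace_add subspace_scale V'Z(1) del: plus_fun_apply, simp_all add: subspace_add V'Z(1))
  show "{\<sigma> \<in> carr Y. \<forall>n. \<sigma> n \<in> V' n} \<subseteq> carr Y" by auto
  fix \<sigma> assume \<sigma>: "\<sigma> \<in> carr Y" and ap: "\<forall>e>0. \<exists>w\<in>{\<sigma> \<in> carr Y. \<forall>n. \<sigma> n \<in> V' n}. nrm Y (\<sigma> - w) < e"
  have "\<sigma> n \<in> V' n" for n
  proof (rule V'Z(3)[OF convergent_sequences_apply[OF \<sigma>]])
    fix e :: real assume "e > 0"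
    then obtain w where w: "w \<in> carr Y" "w n \<in> V' n" "nrm Y (\<sigma> - w) < e" using ap by blast
    have "nrm Z (\<sigma> n - w n) \<le> nrm Y (\<sigma> - w)"
      using nrm_apply_le_convergent_sequences[OF carr_diff[OF nY \<sigma> w(1)], of n] by simp
    then show "\<exists>v\<in>V' n. nrm Z (\<sigma> n - v) < e" using w by (intro bexI[of _ "w n"]) auto
  qed
  then show "\<sigma> \<in> {\<sigma> \<in> carr Y. \<forall>n. \<sigma> n \<in> V' n}" using \<sigma> by simp
qed

lemma tail_from_in_convergent_sequences:
  assumes \<sigma>: "\<sigma> \<in> carr Y" shows "tail_from n \<sigma> \<in> carr Y"
proof (rule convergent_sequencesI)
  show "tail_from n \<sigma> k \<in> V k" for k
    using \<sigma> subspace_0[OF VZ(1)] by (simp add: tail_from_def in_convergent_sequences_iff)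
  show "(\<lambda>k. nrm Z (\<sigma> k - \<sigma> 0)) \<longlonglongrightarrow> 0" using \<sigma> by (simp add: in_convergent_sequences_iff)
  show "\<forall>\<^sub>F k in sequentially. nrm Z (tail_from n \<sigma> k - tail_from n \<sigma> 0) \<le> nrm Z (\<sigma> k - \<sigma> 0)"
    using eventually_gt_at_top[of n] by eventually_elim (simp add: tail_from_def)
qed

text \<open>
  Under the supremum norm a functional is absolutely summable along the single entries \<open>e k\<close> of a
  sequence: signed partial sums of the \<open>e k\<close> have norm at most that of \<open>\<sigma>\<close>. So erasing one more entry
  changes its value by the terms of a convergent series.
\<close>

lemma functional_tail_from_convergent:
  assumes \<sigma>: "\<sigma> \<in> carr Y" and \<psi>: "\<psi> \<in> carr (dual_space Y)"
  shows "convergent (\<lambda>n. \<psi> (tail_from n \<sigma>))"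
proof -
  note nY = normed_space_convergent_sequences
  note lin = dual_linear[OF \<psi>] and Ys = normed_space_subspace[OF nY] and \<sigma>Z = convergent_sequences_apply[OF \<sigma>]
  define e where "e k = single (Suc k) (\<sigma> (Suc k))" for k
  have e: "e k \<in> carr Y" for k
  proof (rule convergent_sequencesI)
    show "e k n \<in> V n" for n
      using \<sigma> subspace_0[OF VZ(1)] by (simp add: e_def single_def in_convergent_sequences_iff)
    show "(\<lambda>n. 0 :: real) \<longlonglongrightarrow> 0" by simp
    show "\<forall>\<^sub>F n in sequentially. nrm Z (e k n - e k 0) \<le> 0"
      using eventually_gt_at_top[of "Suc k"] by eventually_elim (simp add: e_def single_def nZ)
  qed
  have apply_sum: "(\<Sum>k<m. c k *\<^sub>R e k) n = (case n of 0 \<Rightarrow> 0 | Suc j \<Rightarrow> if j < m then c j *\<^sub>R \<sigma> (Suc j) else 0)"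
    for m n and c :: "nat \<Rightarrow> real"
    by (cases n) (auto simp: sum_fun_apply e_def single_def if_distrib cong: if_cong)
  have partial: "(\<Sum>k<m. \<bar>\<psi> (e k)\<bar>) \<le> nrm (dual_space Y) \<psi> * nrm Y \<sigma>" for m
  proof -
    \<comment> \<open>signs which turn the partial sum of absolute values into a value of \<open>\<psi>\<close>\<close>
    define c where "c k = sgn (\<psi> (e k))" for k
    have "(\<Sum>k<m. \<bar>\<psi> (e k)\<bar>) = \<psi> (\<Sum>k<m. c k *\<^sub>R e k)"
      using e by (simp add: linear_map_on_sum_scaleR[OF Ys lin] c_def mult.commute abs_sgn[symmetric])
    also have "\<dots> \<le> nrm (dual_space Y) \<psi> * nrm Y (\<Sum>k<m. c k *\<^sub>R e k)"
      using dual_apply_le[OF nY \<psi>, of "\<Sum>k<m. c k *\<^sub>R e k"] e by (simp add: carr_sum carr_scaleR nY abs_le_iff)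
    also have "\<dots> \<le> nrm (dual_space Y) \<psi> * nrm Y \<sigma>"
    proof (intro mult_left_mono nrm_convergent_sequences_le)
      show "0 \<le> nrm (dual_space Y) \<psi>" by (rule nrm_nonneg[OF normed_space_dual[OF nY] \<psi>])
      have 0: "0 \<le> nrm Y \<sigma>" by (rule nrm_nonneg[OF nY \<sigma>])
      have "nrm Z (c j *\<^sub>R \<sigma> (Suc j)) \<le> nrm Y \<sigma>" for j
      proof -
        have "\<bar>c j\<bar> * nrm Z (\<sigma> (Suc j)) \<le> 1 * nrm Z (\<sigma> (Suc j))"
          using nrm_nonneg[OF nZ \<sigma>Z] by (intro mult_right_mono) (auto simp: c_def abs_sgn_eq)
        then show ?thesis
          using nrm_apply_le_convergent_sequences[OF \<sigma>, of "Suc j"] by (simp add: nrm_scaleR nZ \<sigma>Z)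
      qed
      then show "nrm Z ((\<Sum>k<m. c k *\<^sub>R e k) n) \<le> nrm Y \<sigma>" for n
        unfolding apply_sum using 0 nZ by (cases n) auto
    qed
    finally show ?thesis .
  qed
  have "summable (\<lambda>k. \<bar>\<psi> (e k)\<bar>)"
    by (rule summableI_nonneg_bounded[OF _ partial]) simp
  then have "summable (\<lambda>k. \<psi> (e k))" by (rule summable_rabs_cancel)
  then have "convergent (\<lambda>n. \<psi> \<sigma> - (\<Sum>k<n. \<psi> (e k)))"
    by (intro convergent_diff convergent_const) (simp add: summable_iff_convergent)
  moreover have "\<psi> (tail_from n \<sigma>) = \<psi> \<sigma> - (\<Sum>k<n. \<psi> (e k))" for n
  proof -
    have "tail_from n \<sigma> i = (\<sigma> - (\<Sum>k<n. 1 *\<^sub>R e k)) i" for i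
      unfolding minus_apply apply_sum by (cases i) (auto simp: tail_from_def)
    then have "tail_from n \<sigma> = \<sigma> - (\<Sum>k<n. e k)" by (intro ext) simp
    then show ?thesis
      using e \<sigma> by (simp add: linear_map_on_diff[OF Ys lin] carr_sum nY linear_map_on_sum[OF Ys lin])
  qed
  ultimately show ?thesis by simp
qed

end

section \<open>From nets to the approximation property\<close>

text \<open>
  Operators of norm at most \<open>lam\<close> are equicontinuous, a compact set has a finite net, and the points of
  the net are nearly finite combinations of evaluations. So being close to the identity on a compact
  set reduces to finitely many evaluations.
\<close>

lemma lipschitz_free_approximation_on_compact:
  assumes A: "compactin (norm_topology (lipschitz_free p)) A" and \<epsilon>: "\<epsilon> > 0" and lam: "0 \<le> lam"
  shows "\<exists>E \<eta>. finite E \<and> \<eta> > 0 \<and>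
    (\<forall>S. linear_map_on (carr (lipschitz_free p)) S \<longrightarrow> S ` carr (lipschitz_free p) \<subseteq> carr (lipschitz_free p) \<longrightarrow>
      (\<forall>z\<in>carr (lipschitz_free p). nrm (Lip0_dual p) (S z) \<le> lam * nrm (Lip0_dual p) z) \<longrightarrow>
      (\<forall>x\<in>E. nrm (Lip0_dual p) (S (lip_delta p x) - lip_delta p x) \<le> \<eta>) \<longrightarrow>
      (\<forall>z\<in>A. nrm (Lip0_dual p) (S z - z) \<le> \<epsilon>))"
proof -
  let ?Z = "lipschitz_free p" and ?N = "nrm (Lip0_dual p)"
  note Z = normed_space_lipschitz_free[of p]
  note Zs = normed_space_subspace[OF Z]
  define \<tau> where "\<tau> = \<epsilon> / (2 * lam + 3)"
  have \<tau>: "\<tau> > 0" using \<epsilon> lam by (simp add: \<tau>_def)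
  obtain K where K: "finite K" "K \<subseteq> A" "\<forall>z\<in>A. \<exists>y\<in>K. ?N (z - y) < \<tau>"
    using compactin_norm_topologyD(2)[OF Z A \<tau>] by auto
  have AZ: "A \<subseteq> carr ?Z" by (rule compactin_norm_topologyD(1)[OF Z A])
  have "\<forall>y\<in>K. \<exists>t c. finite t \<and> t \<subseteq> range (lip_delta p) \<and> ?N (y - (\<Sum>a\<in>t. c a *\<^sub>R a)) < \<tau>"
  proof
    fix y assume "y \<in> K"
    then have "y \<in> lipschitz_free_sub p UNIV" using K AZ lipschitz_free_eq_free_sub by blast
    then obtain \<nu> where \<nu>: "\<nu> \<in> span (range (lip_delta p))" "?N (y - \<nu>) < \<tau>"
      using free_sub_approx[OF _ \<tau>] by blast
    then show "\<exists>t c. finite t \<and> t \<subseteq> range (lip_delta p) \<and> ?N (y - (\<Sum>a\<in>t. c a *\<^sub>R a)) < \<tau>"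
      unfolding span_explicit by blast
  qed
  from bchoice[OF this] obtain t where "\<forall>y\<in>K. \<exists>c. finite (t y) \<and> t y \<subseteq> range (lip_delta p) \<and>
    ?N (y - (\<Sum>a\<in>t y. c a *\<^sub>R a)) < \<tau>" ..
  from bchoice[OF this] obtain c where "\<forall>y\<in>K. finite (t y) \<and> t y \<subseteq> range (lip_delta p) \<and>
    ?N (y - (\<Sum>a\<in>t y. c y a *\<^sub>R a)) < \<tau>" ..
  then have t: "\<And>y. y \<in> K \<Longrightarrow> finite (t y)" "\<And>y. y \<in> K \<Longrightarrow> t y \<subseteq> range (lip_delta p)"
    "\<And>y. y \<in> K \<Longrightarrow> ?N (y - (\<Sum>a\<in>t y. c y a *\<^sub>R a)) < \<tau>" by auto
  have "finite (\<Union>y\<in>K. t y)" "(\<Union>y\<in>K. t y) \<subseteq> range (lip_delta p)" using K(1) t by auto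
  then obtain E where E: "finite E" "(\<Union>y\<in>K. t y) = lip_delta p ` E"
    using finite_subset_image[of "\<Union>y\<in>K. t y" "lip_delta p" UNIV] by blast
  define s where "s = (\<Sum>y\<in>K. \<Sum>a\<in>t y. \<bar>c y a\<bar>)"
  have s: "(\<Sum>a\<in>t y. \<bar>c y a\<bar>) \<le> s" if "y \<in> K" for y
    unfolding s_def using that K(1) by (intro member_le_sum[of y K "\<lambda>y. \<Sum>a\<in>t y. \<bar>c y a\<bar>"]) (auto intro: sum_nonneg)
  have s0: "0 \<le> s" unfolding s_def by (intro sum_nonneg) auto
  define \<eta> where "\<eta> = \<tau> / (s + 1)"
  have \<eta>: "\<eta> > 0" "s * \<eta> \<le> \<tau>" using \<tau> s0 by (auto simp: \<eta>_def field_simps)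
  have "?N (S z - z) \<le> \<epsilon>"
    if S: "linear_map_on (carr ?Z) S" "S ` carr ?Z \<subseteq> carr ?Z" "\<forall>z\<in>carr ?Z. ?N (S z) \<le> lam * ?N z"
      and SE: "\<forall>x\<in>E. ?N (S (lip_delta p x) - lip_delta p x) \<le> \<eta>" and z: "z \<in> A" for S z
  proof -
    obtain y where y: "y \<in> K" "?N (z - y) < \<tau>" using K z by blast
    define \<nu> where "\<nu> = (\<Sum>a\<in>t y. c y a *\<^sub>R a)"
    have tZ: "a \<in> carr ?Z" if "a \<in> t y" for a using that t(2)[OF y(1)] lip_delta_in_free by blast
    have \<nu>Z: "\<nu> \<in> carr ?Z" unfolding \<nu>_def using tZ by (intro carr_intros Z)
    have zZ: "z \<in> carr ?Z" "y \<in> carr ?Z" using z AZ y K by auto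
    have SZ: "S w \<in> carr ?Z" if "w \<in> carr ?Z" for w using S(2) that by blast
    have z\<nu>: "?N (z - \<nu>) \<le> 2 * \<tau>"
      using nrm_diff_triangle[OF Z zZ \<nu>Z] t(3)[OF y(1)] y(2) by (simp add: \<nu>_def)
    have "S \<nu> - \<nu> = (\<Sum>a\<in>t y. c y a *\<^sub>R (S a - a))"
      unfolding \<nu>_def using tZ by (simp add: linear_map_on_sum_scaleR[OF Zs S(1)] scaleR_diff_right sum_subtractf)
    then have "?N (S \<nu> - \<nu>) \<le> (\<Sum>a\<in>t y. \<bar>c y a\<bar> * ?N (S a - a))"
      using nrm_sum_scaleR_le[OF Z, of "t y" "\<lambda>a. S a - a" "c y"] tZ SZ by (simp add: carr_diff Z)
    also have "\<dots> \<le> (\<Sum>a\<in>t y. \<bar>c y a\<bar> * \<eta>)"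
    proof (intro sum_mono mult_left_mono)
      fix a assume "a \<in> t y"
      then have "a \<in> lip_delta p ` E" using E(2) y(1) by blast
      then show "?N (S a - a) \<le> \<eta>" using SE by blast
    qed simp
    also have "\<dots> = (\<Sum>a\<in>t y. \<bar>c y a\<bar>) * \<eta>" by (simp add: sum_distrib_right)
    also have "\<dots> \<le> s * \<eta>" using s[OF y(1)] \<eta>(1) by (intro mult_right_mono) auto
    finally have S\<nu>: "?N (S \<nu> - \<nu>) \<le> \<tau>" using \<eta>(2) by simp
    have "?N (S z - S \<nu>) \<le> lam * ?N (z - \<nu>)"
      using S(3) carr_diff[OF Z zZ(1) \<nu>Z] linear_map_on_diff[OF Zs S(1) zZ(1) \<nu>Z] by metis
    also have "\<dots> \<le> lam * (2 * \<tau>)" using z\<nu> lam by (intro mult_left_mono)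
    finally have Sz: "?N (S z - S \<nu>) \<le> lam * (2 * \<tau>)" .
    have "?N (S z - z) \<le> ?N (S z - S \<nu>) + ?N (S \<nu> - z)"
      using nrm_diff_triangle[OF Z SZ[OF zZ(1)] SZ[OF \<nu>Z] zZ(1)] by simp
    moreover have "?N (S \<nu> - z) \<le> ?N (S \<nu> - \<nu>) + ?N (\<nu> - z)"
      using nrm_diff_triangle[OF Z SZ[OF \<nu>Z] \<nu>Z zZ(1)] by simp
    moreover have "?N (\<nu> - z) = ?N (z - \<nu>)" using nrm_diff_commute[OF Z \<nu>Z zZ(1)] by simp
    ultimately have "?N (S z - z) \<le> lam * (2 * \<tau>) + \<tau> + 2 * \<tau>" using Sz S\<nu> z\<nu> by simp
    also have "\<dots> = (2 * lam + 3) * \<tau>" by (simp add: algebra_simps)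
    also have "\<dots> = \<epsilon>" using lam by (simp add: \<tau>_def add_nonneg_pos)
    finally show ?thesis .
  qed
  then show ?thesis using E(1) \<eta>(1) by blast
qed

text \<open>
  If \<open>h\<close> has values in \<open>F(E)\<close> on \<open>N\<close>, then \<open>h x = \<Sum>e. h x (u e) \<delta>(e)\<close> for \<open>x \<in> N\<close>, and elements of
  \<open>F(N)\<close> can be applied to this identity coefficientwise. The case \<open>N = UNIV\<close> gives finite rank, the case
  \<open>N = M2\<close> invariance of \<open>F(M2)\<close>.
\<close>

lemma lip_extension_in_finite_span:
  fixes p :: "'a::metric_space"
  assumes E: "finite E" and h: "\<And>x. h x \<in> carr (Lip0_dual p)" "h p = 0" "0 \<le> K"
      "\<And>x y. nrm (Lip0_dual p) (h x - h y) \<le> K * dist x y"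
    and hN: "\<And>x. x \<in> N \<Longrightarrow> h x \<in> lipschitz_free_sub p E" and \<mu>: "\<mu> \<in> lipschitz_free_sub p N"
  shows "lip_extension (Lip0 p) h \<mu> \<in> span (lip_delta p ` E)"
proof -
  obtain u where u: "\<And>e. e \<in> E - {p} \<Longrightarrow> u e \<in> carr (Lip0 p)"
    "\<And>\<mu>. \<mu> \<in> lipschitz_free_sub p E \<Longrightarrow> \<mu> = (\<Sum>e\<in>E - {p}. \<mu> (u e) *\<^sub>R lip_delta p e)"
    using finite_free_sub_representation[OF E, of p] by metis
  note coef = lip_extension_coefficient(1)[OF normed_space_Lip0 h]
  note L = normed_space_Lip0[of p]
  let ?S = "lip_extension (Lip0 p) h"
  have \<mu>D: "\<mu> \<in> carr (Lip0_dual p)" using \<mu> free_sub_subset lipschitz_free_subset by blast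
  have "?S \<mu> = (\<Sum>e\<in>E - {p}. ?S \<mu> (u e) *\<^sub>R lip_delta p e)"
  proof
    fix w show "?S \<mu> w = (\<Sum>e\<in>E - {p}. ?S \<mu> (u e) *\<^sub>R lip_delta p e) w"
    proof (cases "w \<in> carr (Lip0 p)")
      case True
      define v where "v = (\<Sum>e\<in>E - {p}. w e *\<^sub>R (\<lambda>x. h x (u e)))"
      have v: "v \<in> carr (Lip0 p)" unfolding v_def using u(1) coef by (intro carr_intros L) auto
      have "\<mu> ((\<lambda>x. h x w) - v) = 0"
      proof (rule free_sub_vanish[OF \<mu>])
        show "(\<lambda>x. h x w) - v \<in> carr (Lip0 p)" using v coef[OF True] by (intro carr_diff L)
        fix x assume "x \<in> N"
        from arg_cong[OF u(2)[OF hN[OF this]], of "\<lambda>\<nu>. \<nu> w"]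
        have "h x w = (\<Sum>e\<in>E - {p}. h x (u e) * w e)"
          using True by (simp add: sum_fun_apply lip_delta_def)
        then show "((\<lambda>x. h x w) - v) x = 0" by (simp add: v_def sum_fun_apply mult.commute)
      qed
      moreover have "\<mu> ((\<lambda>x. h x w) - v) = \<mu> (\<lambda>x. h x w) - \<mu> v"
        by (rule linear_map_on_diff[OF normed_space_subspace[OF L] dual_linear[OF \<mu>D] coef[OF True] v])
      moreover have "\<mu> v = (\<Sum>e\<in>E - {p}. w e *\<^sub>R \<mu> (\<lambda>x. h x (u e)))"
        unfolding v_def using u(1) coef
        by (intro linear_map_on_sum_scaleR[OF normed_space_subspace[OF L] dual_linear[OF \<mu>D]]) auto
      ultimately show ?thesis
        using True u(1) by (simp add: sum_fun_apply lip_delta_def lip_extension_def mult.commute)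
    next
      case False
      then show ?thesis by (simp add: sum_fun_apply lip_delta_def lip_extension_def)
    qed
  qed
  also have "\<dots> \<in> span (lip_delta p ` E)" by (intro span_sum span_scale span_base) auto
  finally show ?thesis .
qed

lemma finite_rank_operator_of_Lipschitz_map:
  fixes p :: "'a::metric_space"
  assumes E: "finite E" and hE: "\<And>x. h x \<in> lipschitz_free_sub p E"
    and hM: "\<And>x. x \<in> M2 \<Longrightarrow> h x \<in> lipschitz_free_sub p (E \<inter> M2)" and hp: "h p = 0"
    and lam: "0 \<le> lam" and hlip: "\<And>x y. nrm (Lip0_dual p) (h x - h y) \<le> lam * dist x y"
  shows "\<exists>S. linear_map_on (carr (lipschitz_free p)) S \<and> S ` carr (lipschitz_free p) \<subseteq> carr (lipschitz_free p) \<and>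
    S ` carr (lipschitz_free p) \<subseteq> span (lip_delta p ` E) \<and>
    (\<forall>z\<in>carr (lipschitz_free p). nrm (Lip0_dual p) (S z) \<le> lam * nrm (Lip0_dual p) z) \<and>
    S ` lipschitz_free_sub p M2 \<subseteq> lipschitz_free_sub p M2 \<and> (\<forall>x. S (lip_delta p x) = h x)"
proof -
  let ?Z = "lipschitz_free p" and ?W = "lipschitz_free_sub p M2"
  have hD: "h x \<in> carr (Lip0_dual p)" for x
    using hE free_sub_subset lipschitz_free_subset by blast
  define S where "S = lip_extension (Lip0 p) h"
  note ext = normed_space_Lip0[of p] hD hp lam hlip
  have span: "S \<mu> \<in> span (lip_delta p ` E)" if "\<mu> \<in> carr ?Z" for \<mu>
    unfolding S_def using that hE
    by (intro lip_extension_in_finite_span[OF E hD hp lam hlip, of UNIV]) (auto simp: lipschitz_free_eq_free_sub)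
  have spanW: "S \<mu> \<in> span (lip_delta p ` (E \<inter> M2))" if "\<mu> \<in> ?W" for \<mu>
    unfolding S_def using that hM E
    by (intro lip_extension_in_finite_span[OF _ hD hp lam hlip, of _ M2]) auto
  have "span (lip_delta p ` E) \<subseteq> carr ?Z"
    by (intro span_minimal normed_space_subspace normed_space_lipschitz_free) (auto intro: lip_delta_in_free)
  moreover have "span (lip_delta p ` (E \<inter> M2)) \<subseteq> ?W"
    by (intro span_minimal subspace_free_sub) (auto intro: lip_delta_in_free_sub)
  moreover have "nrm (Lip0_dual p) (S z) \<le> lam * nrm (Lip0_dual p) z" if "z \<in> carr ?Z" for z
    unfolding S_def using that nrm_lip_extension_le[OF ext] lipschitz_free_subset by blast
  moreover have "linear_map_on (carr ?Z) S" unfolding S_def by (rule linear_lip_extension)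
  moreover have "S (lip_delta p x) = h x" for x unfolding S_def by (rule lip_extension_delta[OF ext])
  ultimately show ?thesis using span spanW by (intro exI[of _ S] conjI) blast+
qed

lemma convex_Lip_pair:
  assumes X: "normed_space X" and X2: "subspace X2"
  shows "convex (Lip_pair lam M2 X X2)"
proof (rule convexI)
  fix f g and u v :: real
  assume f: "f \<in> Lip_pair lam M2 X X2" and g: "g \<in> Lip_pair lam M2 X X2" and uv: "0 \<le> u" "0 \<le> v" "u + v = 1"
  have fX: "f x \<in> carr X" "g x \<in> carr X" for x using f g by (auto simp: Lip_pair_def)
  have "nrm X ((u *\<^sub>R f + v *\<^sub>R g) x - (u *\<^sub>R f + v *\<^sub>R g) y) \<le> lam * dist x y" for x y
  proof -
    have "(u *\<^sub>R f + v *\<^sub>R g) x - (u *\<^sub>R f + v *\<^sub>R g) y = u *\<^sub>R (f x - f y) + v *\<^sub>R (g x - g y)"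
      by (simp add: algebra_simps)
    then have "nrm X ((u *\<^sub>R f + v *\<^sub>R g) x - (u *\<^sub>R f + v *\<^sub>R g) y) \<le> nrm X (u *\<^sub>R (f x - f y)) + nrm X (v *\<^sub>R (g x - g y))"
      using nrm_add_le[OF X carr_scaleR[OF X] carr_scaleR[OF X]] carr_diff[OF X] fX by metis
    also have "\<dots> = u * nrm X (f x - f y) + v * nrm X (g x - g y)"
      using uv fX by (simp add: nrm_scaleR X carr_diff)
    also have "\<dots> \<le> u * (lam * dist x y) + v * (lam * dist x y)"
      using f g uv by (intro add_mono mult_left_mono) (auto simp: Lip_pair_def)
    also have "\<dots> = lam * dist x y" using uv by (simp add: distrib_right[symmetric])
    finally show ?thesis .
  qed
  moreover have "(u *\<^sub>R f + v *\<^sub>R g) x \<in> carr X" for x using fX by (simp add: carr_add carr_scaleR X)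
  moreover have "(u *\<^sub>R f + v *\<^sub>R g) x \<in> X2" if "x \<in> M2" for x
    using f g that by (auto simp: Lip_pair_def intro!: subspace_add[OF X2] subspace_scale[OF X2])
  ultimately show "u *\<^sub>R f + v *\<^sub>R g \<in> Lip_pair lam M2 X X2" by (simp add: Lip_pair_def image_subset_iff)
qed

text \<open>
  Mazur's theorem for convex sets of maps, at finitely many points simultaneously: a functional
  separating \<open>G\<close> from \<open>0\<close> in the sum norm over \<open>E\<close> splits into functionals at the points of \<open>E\<close>, and the
  values of these finitely many functionals on \<open>G\<close> cannot all be small.
\<close>

lemma weak_to_norm_approximation:
  fixes G :: "('a \<Rightarrow> 'z::real_vector) set"
  assumes Z: "normed_space Z" and G: "convex G" "\<And>g x. g \<in> G \<Longrightarrow> g x \<in> carr Z"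
    and weak: "\<And>\<Phi> \<epsilon>. finite \<Phi> \<Longrightarrow> \<Phi> \<subseteq> carr (dual_space Z) \<Longrightarrow> \<epsilon> > 0 \<Longrightarrow>
      \<exists>g\<in>G. \<forall>x\<in>E. \<forall>\<phi>\<in>\<Phi>. \<bar>\<phi> (g x)\<bar> < \<epsilon>"
    and E: "finite E" and \<eta>: "\<eta> > 0"
  shows "\<exists>g\<in>G. \<forall>x\<in>E. nrm Z (g x) < \<eta>"
proof (rule ccontr)
  assume contr: "\<not> ?thesis"
  define V where "V = {v :: 'a \<Rightarrow> 'z. \<forall>x\<in>E. v x \<in> carr Z}"
  define q where "q v = (\<Sum>x\<in>E. nrm Z (v x))" for v
  \<comment> \<open>points outside \<open>E\<close> are irrelevant; cutting them off leaves finitely many components\<close>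
  define cut where "cut g = (\<lambda>x. if x \<in> E then g x else 0)" for g :: "'a \<Rightarrow> 'z"
  have V: "subspace V"
    by (rule subspaceI) (auto simp: V_def carr_add carr_scaleR Z)
  have q: "sublinear_on V q"
    unfolding sublinear_on_def
  proof (intro conjI ballI allI impI)
    show "q (v + w) \<le> q v + q w" if "v \<in> V" "w \<in> V" for v w
      using that unfolding q_def sum.distrib[symmetric] by (intro sum_mono) (auto simp: V_def intro: nrm_add_le[OF Z])
    show "q (a *\<^sub>R v) \<le> a * q v" if "0 \<le> a" "v \<in> V" for a v
      using that by (simp add: q_def V_def nrm_scaleR Z sum_distrib_left)
  qed
  have "\<exists>g. g \<in> G" using weak[of "{}" 1] by auto
  then have C0: "cut ` G \<noteq> {}" by blast
  have CV: "cut ` G \<subseteq> V" using G(2) by (auto simp: V_def cut_def)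
  have "linear cut" by (rule linearI) (auto simp: cut_def fun_eq_iff)
  then have C: "convex (cut ` G)" using G(1) by (rule convex_linear_image)
  have qC: "\<eta> \<le> q c" if c: "c \<in> cut ` G" for c
  proof -
    obtain g where g: "g \<in> G" "c = cut g" using c by blast
    then obtain x where x: "x \<in> E" "\<eta> \<le> nrm Z (g x)" using contr by force
    have "nrm Z (g x) \<le> (\<Sum>x\<in>E. nrm Z (g x))"
      using x E G(2)[OF g(1)] by (intro member_le_sum) (auto intro: nrm_nonneg[OF Z])
    also have "\<dots> = q c" by (simp add: q_def g cut_def)
    finally show ?thesis using x by simp
  qed
  obtain \<Psi> where \<Psi>: "linear_map_on V \<Psi>" "\<And>x. x \<in> V \<Longrightarrow> \<Psi> x \<le> q x" "\<And>c. c \<in> cut ` G \<Longrightarrow> \<eta> \<le> \<Psi> c"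
    using linear_separation[OF V q CV C0 C qC] by blast
  define \<theta> where "\<theta> x z = (if z \<in> carr Z then \<Psi> (single x z) else 0)" for x z
  have sV: "single x z \<in> V" if "z \<in> carr Z" for x z using that Z by (simp add: V_def single_def)
  have \<theta>: "\<theta> x \<in> carr (dual_space Z)" if x: "x \<in> E" for x
    unfolding \<theta>_def
  proof (rule dominated_functional_in_dual[OF Z \<Psi>(1,2)])
    fix w assume "w \<in> carr Z"
    have "q (single x w) = (\<Sum>y\<in>E. if y = x then nrm Z w else 0)"
      unfolding q_def single_def using Z by (intro sum.cong) auto
    then show "q (single x w) \<le> nrm Z w" using E x by simp
  qed (simp_all add: sV single_add single_scaleR)
  define \<epsilon> where "\<epsilon> = \<eta> / (real (card E) + 1)"
  have \<epsilon>: "\<epsilon> > 0" using \<eta> by (simp add: \<epsilon>_def add_nonneg_pos)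
  obtain g where g: "g \<in> G" "\<And>x \<phi>. x \<in> E \<Longrightarrow> \<phi> \<in> \<theta> ` E \<Longrightarrow> \<bar>\<phi> (g x)\<bar> < \<epsilon>"
    using weak[of "\<theta> ` E" \<epsilon>] E \<theta> \<epsilon> by blast
  have "\<eta> \<le> \<Psi> (cut g)" using g by (intro \<Psi>(3)) auto
  also have "cut g = (\<Sum>x\<in>E. single x (g x))" unfolding cut_def by (rule sum_single[OF E])
  also have "\<Psi> \<dots> = (\<Sum>x\<in>E. \<theta> x (g x))"
    using G(2)[OF g(1)] sV by (simp add: linear_map_on_sum[OF V \<Psi>(1)] \<theta>_def)
  also have "\<dots> \<le> (\<Sum>x\<in>E. \<epsilon>)"
  proof (rule sum_mono)
    fix x assume "x \<in> E"
    then show "\<theta> x (g x) \<le> \<epsilon>" using g(2)[of x "\<theta> x"] by simp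
  qed
  also have "\<dots> < \<eta>" using \<eta> by (simp add: \<epsilon>_def field_simps)
  finally show False by simp
qed

lemma dual_pullback:
  assumes X: "normed_space X" and Y: "normed_space Y" and T: "linear_map_on (carr X) T" "\<And>x. x \<in> carr X \<Longrightarrow> T x \<in> carr Y"
      "\<And>x. x \<in> carr X \<Longrightarrow> nrm Y (T x) \<le> nrm X x"
    and \<phi>: "\<phi> \<in> carr (dual_space Y)"
  shows "(\<lambda>x. if x \<in> carr X then \<phi> (T x) else 0) \<in> carr (dual_space X)"
proof (rule dualI[where K = "nrm (dual_space Y) \<phi>"])
  fix x assume x: "x \<in> carr X"
  have "\<bar>\<phi> (T x)\<bar> \<le> nrm (dual_space Y) \<phi> * nrm Y (T x)" by (intro dual_apply_le Y \<phi> T x)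
  also have "\<dots> \<le> nrm (dual_space Y) \<phi> * nrm X x"
    by (intro mult_left_mono T x nrm_nonneg[OF normed_space_dual[OF Y]] \<phi>)
  finally show "\<bar>if x \<in> carr X then \<phi> (T x) else 0\<bar> \<le> nrm (dual_space Y) \<phi> * nrm X x" using x by simp
qed (simp_all add: carr_add carr_scaleR X T linear_map_on_add[OF T(1)] linear_map_on_scaleR[OF T(1)]
      linear_map_on_add[OF dual_linear[OF \<phi>]] linear_map_on_scaleR[OF dual_linear[OF \<phi>]])

text \<open>
  The maps \<open>s n\<close> need not be Lipschitz; their weak* limit is, because norms can only drop in a weak*
  limit and the Lipschitz estimate holds for large \<open>n\<close> up to any error.
\<close>

lemma weak_star_limit_in_Lip_pair:
  fixes s :: "nat \<Rightarrow> 'a::metric_space \<Rightarrow> 'v::real_vector"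
  assumes X: "normed_space X" and s: "\<And>n x. s n x \<in> carr X" "\<And>n x. x \<in> M2 \<Longrightarrow> s n x \<in> X2"
    and conv: "\<And>x \<psi>. \<psi> \<in> carr (dual_space X) \<Longrightarrow> convergent (\<lambda>n. \<psi> (s n x))"
    and bound: "\<And>n x. nrm X (s n x) \<le> b x"
    and lip: "\<And>x y e. e > 0 \<Longrightarrow> \<exists>N. \<forall>n\<ge>N. nrm X (s n x - s n y) \<le> dist x y + e"
  shows "(\<lambda>x \<psi>. if \<psi> \<in> carr (dual_space X) then lim (\<lambda>n. \<psi> (s n x)) else 0) \<in>
    Lip_pair 1 M2 (bidual X) (biannihilator X X2)"
proof -
  let ?D = "dual_space X"
  note D = normed_space_dual[OF X]
  define f where "f x \<psi> = (if \<psi> \<in> carr ?D then lim (\<lambda>n. \<psi> (s n x)) else 0)" for x \<psi>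
  have lim: "(\<lambda>n. \<psi> (s n x)) \<longlonglongrightarrow> f x \<psi>" if "\<psi> \<in> carr ?D" for x \<psi>
    using conv[OF that] that by (simp add: f_def convergent_LIMSEQ_iff)
  have fD: "f x \<in> carr (bidual X)" for x
  proof (rule dualI[where K = "b x"])
    fix \<psi> \<phi> assume *: "\<psi> \<in> carr ?D" "\<phi> \<in> carr ?D"
    then have "(\<lambda>n. (\<psi> + \<phi>) (s n x)) \<longlonglongrightarrow> f x \<psi> + f x \<phi>" using tendsto_add[OF lim lim] by simp
    then show "f x (\<psi> + \<phi>) = f x \<psi> + f x \<phi>" using lim[OF carr_add[OF D *]] LIMSEQ_unique by blast
  next
    fix c \<psi> assume *: "\<psi> \<in> carr ?D"
    then have "(\<lambda>n. (c *\<^sub>R \<psi>) (s n x)) \<longlonglongrightarrow> c * f x \<psi>" using tendsto_mult_left[OF lim] by simp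
    then show "f x (c *\<^sub>R \<psi>) = c * f x \<psi>" using lim[OF carr_scaleR[OF D *]] LIMSEQ_unique by blast
  next
    fix \<psi> assume \<psi>: "\<psi> \<in> carr ?D"
    have "\<bar>\<psi> (s n x)\<bar> \<le> b x * nrm ?D \<psi>" for n
      using dual_apply_le[OF X \<psi> s(1), of n x] mult_left_mono[OF bound nrm_nonneg[OF D \<psi>], of n x]
      by (simp add: mult.commute)
    then show "\<bar>f x \<psi>\<bar> \<le> b x * nrm ?D \<psi>"
      using LIMSEQ_le_const2[OF tendsto_rabs[OF lim[OF \<psi>]]] by blast
  qed (simp add: f_def)
  have "nrm (bidual X) (f x - f y) \<le> dist x y" for x y
  proof (rule dual_nrm_le[OF D])
    fix \<psi> assume \<psi>: "\<psi> \<in> carr ?D"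
    have n: "0 \<le> nrm ?D \<psi>" by (rule nrm_nonneg[OF D \<psi>])
    have "\<bar>f x \<psi> - f y \<psi>\<bar> \<le> dist x y * nrm ?D \<psi> + e" if "e > 0" for e
    proof -
      define e' where "e' = e / (nrm ?D \<psi> + 1)"
      have e': "e' > 0" "nrm ?D \<psi> * e' \<le> e" using that n by (auto simp: e'_def field_simps)
      obtain N where N: "\<And>n. n \<ge> N \<Longrightarrow> nrm X (s n x - s n y) \<le> dist x y + e'" using lip[OF e'(1)] by blast
      have "\<bar>\<psi> (s n x) - \<psi> (s n y)\<bar> \<le> dist x y * nrm ?D \<psi> + e" if "n \<ge> N" for n
      proof -
        have "\<bar>\<psi> (s n x) - \<psi> (s n y)\<bar> = \<bar>\<psi> (s n x - s n y)\<bar>"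
          using linear_map_on_diff[OF normed_space_subspace[OF X] dual_linear[OF \<psi>] s(1) s(1), of n x n y] by simp
        also have "\<dots> \<le> nrm ?D \<psi> * nrm X (s n x - s n y)" by (intro dual_apply_le X \<psi> carr_diff s)
        also have "\<dots> \<le> nrm ?D \<psi> * (dist x y + e')" using N[OF that] n by (intro mult_left_mono)
        also have "\<dots> \<le> dist x y * nrm ?D \<psi> + e" using e'(2) by (simp add: algebra_simps)
        finally show ?thesis .
      qed
      then show ?thesis
        using LIMSEQ_le_const2[OF tendsto_rabs[OF tendsto_diff[OF lim[OF \<psi>] lim[OF \<psi>]]]] by blast
    qed
    then have "\<bar>f x \<psi> - f y \<psi>\<bar> \<le> dist x y * nrm ?D \<psi>" by (rule field_le_epsilon)
    then show "\<bar>(f x - f y) \<psi>\<bar> \<le> dist x y * nrm ?D \<psi>" by simp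
  qed simp
  moreover have "f x \<in> biannihilator X X2" if x: "x \<in> M2" for x
  proof -
    have "f x \<psi> = 0" if \<psi>: "\<psi> \<in> annihilator X X2" for \<psi>
    proof -
      have "(\<lambda>n. \<psi> (s n x)) = (\<lambda>n. 0)" using \<psi> s(2)[OF x] by (auto simp: annihilator_def)
      then show ?thesis using lim[of \<psi> x] \<psi> LIMSEQ_unique by (auto simp: annihilator_def)
    qed
    then show ?thesis using fD by (simp add: annihilator_def[of "dual_space X"])
  qed
  ultimately have "f \<in> Lip_pair 1 M2 (bidual X) (biannihilator X X2)"
    using fD by (auto simp: Lip_pair_def)
  then show ?thesis by (simp add: f_def[abs_def])
qed

theorem net_limits_imp_pair_BAP:
  fixes p :: "'a::metric_space" and M2 :: "'a set" and lam :: real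
  assumes sep: "separable_space (euclidean :: 'a topology)" and p: "p \<in> M2" and lam: "0 \<le> lam"
    and cont: "continuum_dimensional TYPE('v::real_vector)"
    and nets: "\<And>(X1 :: 'v nspace) X2 f. banach_space X1 \<Longrightarrow> closed_subspace X1 X2 \<Longrightarrow>
      f \<in> Lip_pair 1 M2 (bidual X1) (biannihilator X1 X2) \<Longrightarrow>
      pointwise_weak_star_net_limit X1 (Lip_pair lam M2 X1 X2) f"
  shows "pair_BAP lam (lipschitz_free p) (lipschitz_free_sub p M2)"
  unfolding pair_BAP_def nrm_lipschitz_free
proof (intro allI impI)
  let ?Z = "lipschitz_free p" and ?N = "nrm (Lip0_dual p)" and ?W = "lipschitz_free_sub p M2"
  note Z = banach_space_lipschitz_free[of p] and nZ = normed_space_lipschitz_free[of p]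
  fix \<epsilon> :: real and A assume \<epsilon>: "\<epsilon> > 0" and A: "compactin (norm_topology ?Z) A"
  obtain E \<eta> where E: "finite E" and \<eta>: "\<eta> > 0"
    and SE: "\<And>S z. linear_map_on (carr ?Z) S \<Longrightarrow> S ` carr ?Z \<subseteq> carr ?Z \<Longrightarrow> (\<forall>z\<in>carr ?Z. ?N (S z) \<le> lam * ?N z) \<Longrightarrow>
      (\<forall>x\<in>E. ?N (S (lip_delta p x) - lip_delta p x) \<le> \<eta>) \<Longrightarrow> z \<in> A \<Longrightarrow> ?N (S z - z) \<le> \<epsilon>"
    using lipschitz_free_approximation_on_compact[OF A \<epsilon> lam] by blast
  obtain D r where D: "\<And>n. finite (D n)" "\<And>n x. r n x \<in> D n" "\<And>n x. x \<in> M2 \<Longrightarrow> r n x \<in> M2"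
    "\<And>x. (\<lambda>n. r n x) \<longlonglongrightarrow> x"
    using separable_pair_approximation[OF sep, of M2] p by blast
  \<comment> \<open>entry \<open>0\<close> ranges over \<open>F(M)\<close>, entry \<open>n + 1\<close> over the finite-dimensional space \<open>F(D n)\<close>\<close>
  define V where "V = case_nat (carr ?Z) (\<lambda>n. lipschitz_free_sub p (D n))"
  define V' where "V' = case_nat (carr ?Z) (\<lambda>n. lipschitz_free_sub p (D n \<inter> M2))"
  have V: "closed_subspace ?Z (V n)" and V': "closed_subspace ?Z (V' n)" for n
    by (auto simp: V_def V'_def lipschitz_free_eq_free_sub closed_subspace_free_sub split: nat.split)
  define Y where "Y = convergent_sequences ?Z V"
  define W where "W = {\<sigma> \<in> carr Y. \<forall>n. \<sigma> n \<in> V' n}"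
  note nY = normed_space_convergent_sequences[of ?Z V, OF Z V, folded Y_def]
  have "V (Suc n) \<lesssim> (UNIV :: real set)" for n
  proof -
    obtain u where u: "\<And>\<mu>. \<mu> \<in> V (Suc n) \<Longrightarrow> \<mu> = (\<Sum>e\<in>D n - {p}. \<mu> (u e) *\<^sub>R lip_delta p e)"
      using finite_free_sub_representation[OF D(1)[of n], of p] unfolding V_def nat.case by metis
    have "V (Suc n) \<subseteq> span (lip_delta p ` D n)"
    proof
      fix \<mu> assume "\<mu> \<in> V (Suc n)"
      then have "\<mu> = (\<Sum>e\<in>D n - {p}. \<mu> (u e) *\<^sub>R lip_delta p e)" by (rule u)
      also have "\<dots> \<in> span (lip_delta p ` D n)" by (intro span_sum span_scale span_base) auto
      finally show "\<mu> \<in> span (lip_delta p ` D n)" .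
    qed
    then show ?thesis using finite_span_lepoll_reals[of "lip_delta p ` D n"] D(1)[of n] subset_imp_lepoll lepoll_trans by blast
  qed
  then have "{\<sigma>. \<forall>n. \<sigma> n \<in> V (Suc n)} \<lesssim> (UNIV :: real set)" by (rule sequences_lepoll_reals)
  moreover have "carr Y \<lesssim> {\<sigma>. \<forall>n. \<sigma> n \<in> V (Suc n)}"
    unfolding lepoll_def Y_def using convergent_sequences_inj[of ?Z V, OF Z V]
    by (intro exI[of _ "\<lambda>\<sigma> n. \<sigma> (Suc n)"]) (auto simp: in_convergent_sequences_iff)
  ultimately have "carr Y \<lesssim> (UNIV :: real set)" using lepoll_trans by blast
  then obtain J :: "(nat \<Rightarrow> ('a \<Rightarrow> real) \<Rightarrow> real) \<Rightarrow> 'v" where J: "linear J" "inj_on J (carr Y)"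
    using linear_injection_exists[OF cont] by blast
  define X where "X = isometric_copy J Y"
  have X: "banach_space X" unfolding X_def
    by (intro banach_space_isometric_copy J) (unfold Y_def, intro banach_space_convergent_sequences Z V)
  note nX = banach_space_normed[OF X]
  have WY: "closed_subspace Y W"
    unfolding W_def Y_def by (intro closed_subspace_convergent_sequences Z V V')
  have JW: "closed_subspace X (J ` W)"
    unfolding X_def by (intro closed_subspace_isometric_copy nY J WY)
  have carrX: "carr X = J ` carr Y" by (simp add: X_def carr_isometric_copy)
  have nrmJ: "nrm X (J \<sigma>) = nrm Y \<sigma>" if "\<sigma> \<in> carr Y" for \<sigma> using that by (simp add: X_def nrm_isometric_copy J)
  define J' where "J' = inv_into (carr Y) J"
  have J'J: "J' (J \<sigma>) = \<sigma>" if "\<sigma> \<in> carr Y" for \<sigma> using that J by (simp add: J'_def)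
  have J': "J' v \<in> carr Y" "J (J' v) = v" "nrm Y (J' v) = nrm X v" if v: "v \<in> carr X" for v
    using v J'J nrmJ by (auto simp: carrX)
  have J'lin: "linear_map_on (carr X) J'"
    unfolding linear_map_on_def
  proof (intro conjI ballI allI)
    fix v w assume "v \<in> carr X" "w \<in> carr X"
    then obtain \<sigma> \<tau> where "\<sigma> \<in> carr Y" "\<tau> \<in> carr Y" "v = J \<sigma>" "w = J \<tau>" by (auto simp: carrX)
    then show "J' (v + w) = J' v + J' w"
      using J'J[OF carr_add[OF nY]] by (simp add: J'J linear_add[OF J(1)])
  next
    fix c v assume "v \<in> carr X"
    then obtain \<sigma> where "\<sigma> \<in> carr Y" "v = J \<sigma>" by (auto simp: carrX)
    then show "J' (c *\<^sub>R v) = c *\<^sub>R J' v"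
      using J'J[OF carr_scaleR[OF nY]] by (simp add: J'J linear_scale[OF J(1)])
  qed
  \<comment> \<open>the limit of the sequence represented by \<open>v\<close>\<close>
  define P where "P v = J' v 0" for v
  have Plin: "linear_map_on (carr X) P"
    using linear_map_on_add[OF J'lin] linear_map_on_scaleR[OF J'lin] by (simp add: linear_map_on_def P_def)
  have PZ: "P v \<in> carr ?Z" "nrm ?Z (P v) \<le> nrm X v" if "v \<in> carr X" for v
    using convergent_sequences_apply[of ?Z V, OF Z V, folded Y_def, OF J'(1)[OF that]]
      nrm_apply_le_convergent_sequences[of ?Z V, OF Z V, folded Y_def, OF J'(1)[OF that], of 0] J'(3)[OF that]
    by (auto simp: P_def)
  define z where "z x = case_nat (lip_delta p x) (\<lambda>n. lip_delta p (r n x))" for x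
  have z: "z x 0 = lip_delta p x" "z x (Suc n) = lip_delta p (r n x)" for x n by (simp_all add: z_def)
  have zY: "z x \<in> carr Y" for x
    unfolding Y_def in_convergent_sequences_iff
  proof
    show "\<forall>n. z x n \<in> V n"
      using D(2) by (auto simp: z_def V_def lip_delta_in_free_sub lip_delta_in_free split: nat.split)
    have d0: "(\<lambda>n. dist (r n x) x) \<longlonglongrightarrow> 0" by (rule iffD1[OF tendsto_dist_iff D(4)])
    have "(\<lambda>n. nrm ?Z (z x (Suc n) - z x 0)) \<longlonglongrightarrow> 0"
      by (rule tendsto_sandwich[OF _ _ tendsto_const d0])
        (auto simp: z nrm_lip_delta_diff_le intro!: always_eventually nrm_nonneg carr_diff lip_delta_in_dual normed_space_Lip0_dual)
    then show "(\<lambda>n. nrm ?Z (z x n - z x 0)) \<longlonglongrightarrow> 0" by (rule LIMSEQ_imp_Suc)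
  qed
  have zM: "z x n \<in> V' n" if "x \<in> M2" for x n
    using D(2,3) that by (auto simp: z_def V'_def lip_delta_in_free_sub lip_delta_in_free split: nat.split)
  note tailY = tail_from_in_convergent_sequences[of ?Z V, OF Z V, folded Y_def]
  \<comment> \<open>the maps whose weak* limit is the map \<open>f\<close> to be approximated\<close>
  define s where "s n x = J (tail_from n (z x))" for n x
  have sX: "s n x \<in> carr X" for n x using tailY[OF zY] by (auto simp: s_def carrX)
  define f where "f x \<psi> = (if \<psi> \<in> carr (dual_space X) then lim (\<lambda>n. \<psi> (s n x)) else 0)" for x \<psi>
  have f: "f \<in> Lip_pair 1 M2 (bidual X) (biannihilator X (J ` W))"
    unfolding f_def[abs_def]
  proof (rule weak_star_limit_in_Lip_pair[OF nX sX])
    show "s n x \<in> J ` W" if "x \<in> M2" for n x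
    proof -
      have "0 \<in> V' k" for k using V'[of k] by (auto simp: closed_subspace_def subspace_0)
      then have "tail_from n (z x) k \<in> V' k" for k using zM[OF that] by (simp add: tail_from_def)
      then have "tail_from n (z x) \<in> W" using tailY[OF zY] by (simp add: W_def)
      then show ?thesis by (auto simp: s_def)
    qed
    show "convergent (\<lambda>n. \<psi> (s n x))" if \<psi>: "\<psi> \<in> carr (dual_space X)" for x \<psi>
    proof -
      have "linear_map_on (carr Y) J" using J(1) by (simp add: linear_map_on_def linear_add linear_scale)
      then have "(\<lambda>\<sigma>. if \<sigma> \<in> carr Y then \<psi> (J \<sigma>) else 0) \<in> carr (dual_space Y)"
        by (rule dual_pullback[OF nY nX _ _ _ \<psi>]) (auto simp: carrX nrmJ)
      then have "convergent (\<lambda>n. if tail_from n (z x) \<in> carr Y then \<psi> (J (tail_from n (z x))) else 0)"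
        unfolding Y_def by (rule functional_tail_from_convergent[OF Z V zY[unfolded Y_def]])
      then show ?thesis using tailY[OF zY] by (simp add: s_def)
    qed
    show "nrm X (s n x) \<le> nrm Y (z x)" for n x
    proof -
      have "nrm ?Z (tail_from n (z x) k) \<le> nrm Y (z x)" for k
        using nrm_apply_le_convergent_sequences[of ?Z V, OF Z V, folded Y_def, OF zY, of x k] nrm_nonneg[OF nY zY[of x]] nZ
        by (simp add: tail_from_def normed_space_Lip0_dual)
      then have "nrm Y (tail_from n (z x)) \<le> nrm Y (z x)"
        unfolding Y_def by (intro nrm_convergent_sequences_le[OF Z V])
      then show ?thesis using nrmJ[OF tailY[OF zY]] by (simp add: s_def)
    qed
    show "\<exists>N. \<forall>n\<ge>N. nrm X (s n x - s n y) \<le> dist x y + e" if "e > 0" for x y e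
    proof -
      have "(\<lambda>n. dist (r n x) (r n y)) \<longlonglongrightarrow> dist x y" by (intro tendsto_dist D)
      then have "\<forall>\<^sub>F n in sequentially. dist (r n x) (r n y) < dist x y + e" using that by (intro order_tendstoD) auto
      then obtain N where N: "\<And>n. n \<ge> N \<Longrightarrow> dist (r n x) (r n y) < dist x y + e" by (auto simp: eventually_sequentially)
      have z_diff: "nrm ?Z (z x k - z y k) \<le> dist x y + e" if k: "k = 0 \<or> k > N" for k
      proof (cases k)
        case 0
        then show ?thesis using nrm_lip_delta_diff_le[of p x y] \<open>e > 0\<close> by (simp add: z)
      next
        case (Suc j)
        then show ?thesis using k N[of j] nrm_lip_delta_diff_le[of p "r j x" "r j y"] by (simp add: z)
      qed
      have "nrm X (s n x - s n y) \<le> dist x y + e" if n: "n \<ge> N" for n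
      proof -
        have "nrm X (s n x - s n y) = nrm Y (tail_from n (z x) - tail_from n (z y))"
          unfolding s_def X_def by (intro nrm_isometric_copy_diff nY J tailY zY)
        also have "\<dots> \<le> dist x y + e"
          unfolding Y_def
        proof (rule nrm_convergent_sequences_le[OF Z V])
          fix k
          show "nrm ?Z ((tail_from n (z x) - tail_from n (z y)) k) \<le> dist x y + e"
          proof (cases "k = 0 \<or> k > n")
            case True
            then show ?thesis using z_diff[of k] n by (auto simp: tail_from_def)
          next
            case False
            then show ?thesis using \<open>e > 0\<close> by (simp add: tail_from_def normed_space_Lip0_dual add_nonneg_nonneg)
          qed
        qed
        finally show ?thesis .
      qed
      then show ?thesis by blast
    qed
  qed
  have fP: "f x (\<lambda>v. if v \<in> carr X then \<phi> (P v) else 0) = \<phi> (lip_delta p x)"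
    and P\<phi>: "(\<lambda>v. if v \<in> carr X then \<phi> (P v) else 0) \<in> carr (dual_space X)"
    if \<phi>: "\<phi> \<in> carr (dual_space ?Z)" for x \<phi>
  proof -
    show *: "(\<lambda>v. if v \<in> carr X then \<phi> (P v) else 0) \<in> carr (dual_space X)"
      by (rule dual_pullback[OF nX nZ Plin PZ \<phi>])
    have "P (s n x) = lip_delta p x" for n
      using J'J[OF tailY[OF zY]] by (simp add: P_def s_def tail_from_def z)
    then show "f x (\<lambda>v. if v \<in> carr X then \<phi> (P v) else 0) = \<phi> (lip_delta p x)"
      using * sX by (simp add: f_def)
  qed
  define L where "L = Lip_pair lam M2 X (J ` W)"
  have LX: "g x \<in> carr X" if "g \<in> L" for g x using that by (auto simp: L_def Lip_pair_def)
  have approx: "\<exists>g\<in>L. \<forall>x\<in>E'. \<forall>\<psi>\<in>\<Psi>. \<bar>\<psi> (g x) - f x \<psi>\<bar> < e"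
    if "finite E'" "finite \<Psi>" "\<Psi> \<subseteq> carr (dual_space X)" "e > 0" for E' \<Psi> and e :: real
  proof -
    have "pointwise_weak_star_net_limit X L f" unfolding L_def by (rule nets[OF X JW f])
    then have "\<forall>E' \<Psi> e. finite E' \<longrightarrow> finite \<Psi> \<longrightarrow> \<Psi> \<subseteq> carr (dual_space X) \<longrightarrow> e > 0 \<longrightarrow>
        (\<exists>g\<in>L. \<forall>x\<in>E'. \<forall>\<psi>\<in>\<Psi>. \<bar>\<psi> (g x) - f x \<psi>\<bar> < e)"
      using pointwise_weak_star_net_limit_iff[of X L f] nX LX by simp
    then show ?thesis using that by simp
  qed
  \<comment> \<open>deviation from the evaluation functionals, after translation to value \<open>0\<close> at \<open>p\<close>\<close>
  define dev where "dev g = (\<lambda>x. P (g x) - P (g p) - lip_delta p x)" for g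
  have devZ: "dev g x \<in> carr ?Z" if "g \<in> L" for g x
    unfolding dev_def using LX[OF that] by (intro carr_diff nZ PZ lip_delta_in_free)
  have "convex (dev ` L)"
  proof (rule convexI)
    fix a b and u v :: real assume "a \<in> dev ` L" "b \<in> dev ` L" and uv: "0 \<le> u" "0 \<le> v" "u + v = 1"
    then obtain g h where gh: "g \<in> L" "h \<in> L" "a = dev g" "b = dev h" by blast
    have "convex L" unfolding L_def using JW by (intro convex_Lip_pair nX) (simp add: closed_subspace_def)
    then have ugvh: "u *\<^sub>R g + v *\<^sub>R h \<in> L" using gh uv by (intro convexD) auto
    moreover have "P ((u *\<^sub>R g + v *\<^sub>R h) x) = u *\<^sub>R P (g x) + v *\<^sub>R P (h x)" for x
      using LX[OF gh(1), of x] LX[OF gh(2), of x]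
      by (simp add: linear_map_on_add[OF Plin] linear_map_on_scaleR[OF Plin] carr_scaleR nX)
    moreover have \<delta>uv: "u *\<^sub>R P (g x) + v *\<^sub>R P (h x) - (u *\<^sub>R P (g p) + v *\<^sub>R P (h p)) - lip_delta p x =
        u *\<^sub>R (P (g x) - P (g p) - lip_delta p x) + v *\<^sub>R (P (h x) - P (h p) - lip_delta p x)" for x
    proof -
      have "lip_delta p x = u *\<^sub>R lip_delta p x + v *\<^sub>R lip_delta p x"
        using uv(3) by (metis scaleR_add_left scaleR_one)
      then show ?thesis by (simp add: algebra_simps)
    qed
    ultimately have "dev (u *\<^sub>R g + v *\<^sub>R h) x = (u *\<^sub>R a + v *\<^sub>R b) x" for x
      by (simp only: dev_def gh plus_fun_apply scaleR_fun_apply)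
    then have "u *\<^sub>R a + v *\<^sub>R b = dev (u *\<^sub>R g + v *\<^sub>R h)" by (intro ext) simp
    then show "u *\<^sub>R a + v *\<^sub>R b \<in> dev ` L" using ugvh by blast
  qed
  then have "\<exists>g\<in>dev ` L. \<forall>x\<in>E. nrm ?Z (g x) < \<eta> / 2"
  proof (rule weak_to_norm_approximation[OF nZ _ _ _ E])
    show "g x \<in> carr ?Z" if "g \<in> dev ` L" for g x using that devZ by blast
    show "\<eta> / 2 > 0" using \<eta> by simp
    fix \<Phi> and e :: real assume \<Phi>: "finite \<Phi>" "\<Phi> \<subseteq> carr (dual_space ?Z)" and e: "e > 0"
    define pull where "pull \<phi> = (\<lambda>v. if v \<in> carr X then \<phi> (P v) else 0)" for \<phi> :: "(('a \<Rightarrow> real) \<Rightarrow> real) \<Rightarrow> real"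
    have "finite (insert p E)" "finite (pull ` \<Phi>)" "pull ` \<Phi> \<subseteq> carr (dual_space X)" "e / 2 > 0"
      using E \<Phi> P\<phi> e by (auto simp: pull_def)
    from approx[OF this] obtain g where g: "g \<in> L" "\<forall>x\<in>insert p E. \<forall>\<psi>\<in>pull ` \<Phi>. \<bar>\<psi> (g x) - f x \<psi>\<bar> < e / 2" ..
    have "\<bar>\<phi> (dev g x)\<bar> < e" if x: "x \<in> E" and \<phi>: "\<phi> \<in> \<Phi>" for x \<phi>
    proof -
      have \<phi>D: "\<phi> \<in> carr (dual_space ?Z)" using \<phi> \<Phi> by blast
      have c: "\<bar>\<phi> (P (g y)) - \<phi> (lip_delta p y)\<bar> < e / 2" if "y \<in> insert p E" for y
      proof -
        have "\<bar>pull \<phi> (g y) - f y (pull \<phi>)\<bar> < e / 2" using g(2) that \<phi> by blast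
        then show ?thesis using fP[OF \<phi>D, of y] LX[OF g(1), of y] by (simp add: pull_def)
      qed
      note lin = linear_map_on_diff[OF normed_space_subspace[OF nZ] dual_linear[OF \<phi>D]]
      have "\<phi> (dev g x) = \<phi> (P (g x)) - \<phi> (P (g p)) - \<phi> (lip_delta p x)"
        unfolding dev_def using LX[OF g(1)] by (simp add: lin carr_diff nZ PZ lip_delta_in_free)
      moreover have "\<phi> (lip_delta p p) = 0"
        unfolding lip_delta_base by (rule linear_map_on_0[OF normed_space_subspace[OF nZ] dual_linear[OF \<phi>D]])
      moreover have "\<bar>\<phi> (P (g x)) - \<phi> (lip_delta p x)\<bar> < e / 2" "\<bar>\<phi> (P (g p)) - \<phi> (lip_delta p p)\<bar> < e / 2"
        using c x by auto
      ultimately show ?thesis by linarith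
    qed
    then show "\<exists>g\<in>dev ` L. \<forall>x\<in>E. \<forall>\<phi>\<in>\<Phi>. \<bar>\<phi> (g x)\<bar> < e" using g(1) by blast
  qed
  then obtain g where g: "g \<in> L" and gE: "\<And>x. x \<in> E \<Longrightarrow> ?N (dev g x) < \<eta> / 2" by auto
  \<comment> \<open>entry \<open>0\<close> of \<open>\<sigma> x\<close> is close to the evaluation at \<open>x\<close>; a late entry is close to entry \<open>0\<close>\<close>
  define \<sigma> where "\<sigma> x = J' (g x) - J' (g p)" for x
  have \<sigma>Y: "\<sigma> x \<in> carr Y" for x unfolding \<sigma>_def by (intro carr_diff nY J' LX g)
  have "\<forall>\<^sub>F n in sequentially. \<forall>x\<in>E. nrm ?Z (\<sigma> x (Suc n) - \<sigma> x 0) < \<eta> / 2"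
  proof (rule eventually_ball_finite[OF E], rule ballI)
    fix x assume "x \<in> E"
    have "(\<lambda>n. nrm ?Z (\<sigma> x n - \<sigma> x 0)) \<longlonglongrightarrow> 0" using \<sigma>Y by (simp add: Y_def in_convergent_sequences_iff)
    then show "\<forall>\<^sub>F n in sequentially. nrm ?Z (\<sigma> x (Suc n) - \<sigma> x 0) < \<eta> / 2"
      by (rule order_tendstoD(2)[OF LIMSEQ_Suc]) (use \<eta> in simp)
  qed
  then obtain n where n: "\<And>x. x \<in> E \<Longrightarrow> ?N (\<sigma> x (Suc n) - \<sigma> x 0) < \<eta> / 2"
    by (auto simp: eventually_sequentially)
  define h where "h x = \<sigma> x (Suc n)" for x
  have hV: "h x \<in> V (Suc n)" for x using \<sigma>Y[of x] by (simp add: h_def Y_def in_convergent_sequences_iff)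
  have hV': "h x \<in> V' (Suc n)" if "x \<in> M2" for x
  proof -
    have "J' (g y) (Suc n) \<in> V' (Suc n)" if "y \<in> M2" for y
    proof -
      have "g y \<in> J ` W" using g that by (auto simp: L_def Lip_pair_def)
      then obtain \<tau> where "\<tau> \<in> W" "g y = J \<tau>" by blast
      then show ?thesis using J'J by (auto simp: W_def)
    qed
    then show ?thesis using that p V'[of "Suc n"] by (simp add: h_def \<sigma>_def closed_subspace_def subspace_diff)
  qed
  have \<sigma>Z: "\<sigma> x k \<in> carr ?Z" for x k
    using convergent_sequences_apply[of ?Z V, OF Z V, folded Y_def, OF \<sigma>Y] .
  then have hZ: "h x \<in> carr ?Z" for x by (simp add: h_def)
  have hp: "h p = 0" by (simp add: h_def \<sigma>_def)
  have hlip: "?N (h x - h y) \<le> lam * dist x y" for x y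
  proof -
    have "\<sigma> x - \<sigma> y = J' (g x - g y)"
      by (simp add: \<sigma>_def linear_map_on_diff[OF normed_space_subspace[OF nX] J'lin LX[OF g] LX[OF g]])
    then have "h x - h y = J' (g x - g y) (Suc n)" by (simp add: h_def fun_eq_iff)
    then have "?N (h x - h y) \<le> nrm Y (J' (g x - g y))"
      using nrm_apply_le_convergent_sequences[of ?Z V, OF Z V, folded Y_def, OF J'(1)[OF carr_diff[OF nX LX[OF g] LX[OF g]]]] by simp
    also have "\<dots> = nrm X (g x - g y)" by (intro J' carr_diff nX LX g)
    also have "\<dots> \<le> lam * dist x y" using g by (auto simp: L_def Lip_pair_def)
    finally show ?thesis .
  qed
  obtain S where S: "linear_map_on (carr ?Z) S" "S ` carr ?Z \<subseteq> carr ?Z" "S ` carr ?Z \<subseteq> span (lip_delta p ` D n)"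
    "\<forall>z\<in>carr ?Z. ?N (S z) \<le> lam * ?N z" "S ` ?W \<subseteq> ?W" "\<And>x. S (lip_delta p x) = h x"
    using finite_rank_operator_of_Lipschitz_map[OF D(1)[of n] hV[unfolded V_def nat.case] hV'[unfolded V'_def nat.case] hp lam hlip]
    by blast
  have "\<forall>x\<in>E. ?N (S (lip_delta p x) - lip_delta p x) \<le> \<eta>"
  proof
    fix x assume x: "x \<in> E"
    have "S (lip_delta p x) - lip_delta p x = (h x - \<sigma> x 0) + dev g x"
      unfolding S(6) by (simp add: dev_def \<sigma>_def P_def)
    then have "?N (S (lip_delta p x) - lip_delta p x) \<le> ?N (h x - \<sigma> x 0) + ?N (dev g x)"
      using nrm_add_le[OF nZ carr_diff[OF nZ hZ \<sigma>Z] devZ[OF g]] by simp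
    also have "\<dots> \<le> \<eta>" using n[OF x] gE[OF x] by (simp add: h_def)
    finally show "?N (S (lip_delta p x) - lip_delta p x) \<le> \<eta>" .
  qed
  then have "\<forall>z\<in>A. ?N (S z - z) \<le> \<epsilon>" using SE[OF S(1,2,4)] by blast
  then show "\<exists>S. linear_map_on (carr ?Z) S \<and> S ` carr ?Z \<subseteq> carr ?Z \<and> (\<exists>B. finite B \<and> S ` carr ?Z \<subseteq> span B) \<and>
      (\<forall>z\<in>carr ?Z. ?N (S z) \<le> lam * ?N z) \<and> (\<forall>z\<in>A. ?N (S z - z) \<le> \<epsilon>) \<and> S ` ?W \<subseteq> ?W"
    using S D(1)[of n] by (intro exI[of _ S] conjI exI[of _ "lip_delta p ` D n"]) auto
qed

section \<open>The equivalence\<close>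

theorem theorem7p5:
  fixes p :: "'a::metric_space" and M2 :: "'a set" and lam :: real
  assumes "separable_space (euclidean :: 'a topology)"
    and "p \<in> M2"
    and "lam \<ge> 1"
    and "continuum_dimensional TYPE('v::real_vector)"
  shows "pair_BAP lam (lipschitz_free p) (lipschitz_free_sub p M2) \<longleftrightarrow>
    (\<forall>(X1 :: 'v nspace) X2. banach_space X1 \<longrightarrow> closed_subspace X1 X2 \<longrightarrow>
      (\<forall>f \<in> Lip_pair 1 M2 (bidual X1) (biannihilator X1 X2).
         pointwise_weak_star_net_limit X1 (Lip_pair lam M2 X1 X2) f))"
proof
  have lam: "0 \<le> lam" using assms(3) by simp
  { assume bap: "pair_BAP lam (lipschitz_free p) (lipschitz_free_sub p M2)"
    show "\<forall>(X1 :: 'v nspace) X2. banach_space X1 \<longrightarrow> closed_subspace X1 X2 \<longrightarrow>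
      (\<forall>f \<in> Lip_pair 1 M2 (bidual X1) (biannihilator X1 X2).
         pointwise_weak_star_net_limit X1 (Lip_pair lam M2 X1 X2) f)"
    proof (intro allI impI ballI)
      fix X1 :: "'v nspace" and X2 f
      assume X1: "banach_space X1" and X2: "closed_subspace X1 X2"
        and f: "f \<in> Lip_pair 1 M2 (bidual X1) (biannihilator X1 X2)"
      note nX = banach_space_normed[OF X1]
      have "subspace X2" "X2 \<subseteq> carr X1" using X2 by (simp_all add: closed_subspace_iff[OF nX])
      then show "pointwise_weak_star_net_limit X1 (Lip_pair lam M2 X1 X2) f"
        by (rule pair_BAP_imp_net_limit[OF bap assms(2) lam nX _ _ f])
    qed }
  assume "\<forall>(X1 :: 'v nspace) X2. banach_space X1 \<longrightarrow> closed_subspace X1 X2 \<longrightarrow>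
      (\<forall>f \<in> Lip_pair 1 M2 (bidual X1) (biannihilator X1 X2).
         pointwise_weak_star_net_limit X1 (Lip_pair lam M2 X1 X2) f)"
  then show "pair_BAP lam (lipschitz_free p) (lipschitz_free_sub p M2)"
    by (intro net_limits_imp_pair_BAP[OF assms(1,2) lam assms(4)]) blast
qed

end
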